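(* Let $[\![P,\varLambda\circ(TH)]\!]$ be the uncertain network model described in the context. Suppose that the nominal network $[\![P,TH]\!]$ is stable; that linear $S=\bigoplus_{i\in\mathcal V}S_i:\mathbf L_{2e}^n\to\mathbf L_{2e}^n$ and linear $S^\dagger=\bigoplus_{i\in\mathcal V}S_i^\dagger:\mathbf D\subset\mathbf L_{2e}^n\to\mathbf L_{2e}^n$ are fixed such that $\varDelta:=(\varLambda-I_{2m})\circ TS$ and $G:=S^\dagger H(P-TH)^{-1}$ are stable and $\varDelta\circ G=(\varLambda-I_{2m})\circ TH(P-TH)^{-1}$; and that for each $i\in\mathcal V$, $H_i=N_iD_i^{-1}$ with $N_i:\mathbf L_{2e}^{m_i}\to\mathbf L_{2e}$ and $D_i:\mathbf L_{2e}^{m_i}\to\mathbf L_{2e}^{m_i}$ stable linear systems satisfying $U_iN_i+V_iD_i=I_{m_i}$ for some stable linear systems $U_i:\mathbf L_{2e}\to\mathbf L_{2e}^{m_i}$, $V_i:\mathbf L_{2e}^{m_i}\to\mathbf L_{2e}^{m_i}$. Let the bounded linear self-adjoint multipliers $\bar\varPi_i$, $i\in\mathcal V$, be such that $\langle(y_i,u_i),\bar\varPi_i(y_i,u_i)\rangle\ge0$ for all $y_i\in\mathbf L_2$, $\alpha\in[0,1]$, $u_i=\alpha\varDelta_i(y_i)$, where $\varDelta_i=(\bigoplus_{k\in\mathcal M_i}\varLambda_{i,k}-I_{m_i})\circ\mathbf 1_{m_i,1}S_i$. Let $\{\mathscr F_1,\ldots,\mathscr F_c\}$ be a localized edge-partition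 of $\mathscr G$ such that $\bigcup_{p\in\mathcal O_k}\mathcal K_p\setminus\{k\}\supset\mathcal L_k$ for all $k\in\mathcal M$, and let $\hat m_p,\hat K_p,\hat W_p,\hat X_p,\hat Y_p,\hat Z_p$, $p\in[c]$, be as defined in the context. Suppose that for each $p\in[c]$ there exists $\epsilon_p\in\mathbb R_{>0}$ such that for all $\hat z\in\mathbf L_2^{\hat m_p}$ $$\left\langle \begin{bmatrix} I_{\hat m_p}\\ \hat K_p\end{bmatrix}\hat z,\ \begin{bmatrix}\hat X_p+\epsilon_p\hat W_p & \hat Y_p\\ \hat Y_p^* & \hat Z_p\end{bmatrix}\begin{bmatrix} I_{\hat m_p}\\ \hat K_p\end{bmatrix}\hat z\right\rangle\le 0 .$$ Then the uncertain network $[\![P,\varLambda\circ(TH)]\!]$ is stable.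
   Context: **Signals and systems.** $[j]=\{1,\dots,j\}$ (empty if $j=0$), $[i:j]=\{i,\dots,j\}$. $\mathbf L_2^r$ is the Hilbert space of finite-energy signals $v:\mathbb R_{\ge0}\to\mathbb R^r$, with $\langle v,u\rangle=\int_0^\infty v(t)'u(t)\,dt$; $\mathbf L_{2e}^r$ is the extended space of $v$ with $\boldsymbol\pi_\tau(v)\in\mathbf L_2^r$ for all $\tau\ge0$, where $(\boldsymbol\pi_\tau v)(t)=v(t)$ for $t<\tau$ and $0$ otherwise. A map $G:\mathbf L_{2e}^q\to\mathbf L_{2e}^r$ is a system if it is causal ($\boldsymbol\pi_\tau(G(u))=\boldsymbol\pi_\tau(G(\boldsymbol\pi_\tau u))$ for all $\tau$) and $G(0)=0$; a system is stable if moreover there is $c>0$ with $\|G(u)\|\le c\|u\|$ for all $u\in\mathbf L_2^q$. Matrices denote pointwise multiplication; $\bigoplus$ denotes block-diagonal direct sum; ${}^*$ is the Hilbert adjoint (on $\mathbf L_2$) of a bounded linear map. The feedback interconnection of $G:\mathbf L_{2e}^q\to\mathbf L_{2e}^r$ and $\varDelta:\mathbf L_{2e}^r\to\mathbf L_{2e}^q$ is well-posed if for all $(d_y,d_u)$ there is a unique $(y,u)\in\mathbf L_{2e}^r\times\mathbf L_{2e}^q$ with $y=G(u)+d_y$, $u=\varDelta(y)+d_u$, and $[\![G,\varDelta]\!]:(d_y,d_u)\mapsto(y,u)$ is causal; $[\![G,\varDelta]\!]$ is stable if it is well-posed and this map is a stable system. $\mathbf 1_{r,q}$ and $\mathbf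 0_{r,q}$ are all-ones and all-zeros matrices. **Graph.** $\mathscr G=(\mathcal V,\mathscr E)$ is a simple connected undirected graph, $\mathcal V=[n]$, $n\ge2$, $m=|\mathscr E|$, $\mathcal M=[m]$. For $i\in\mathcal V$: $\mathcal N_i$ is the set of neighbours, $\mathscr E_i=\{\{i,j\}:j\in\mathcal N_i\}$, $m_i=|\mathcal N_i|$, $\mathcal M_i=[m_i]$. Bijections $\kappa:\mathscr E\to\mathcal M$ and $\kappa_i:\mathcal N_i\to\mathcal M_i$ are fixed. Put $s_i=\sum_{h\in[i-1]}m_h$ and $\mathcal I_i=[s_i+1:s_i+m_i]$. The permutation matrix $P\in\mathbb R^{2m\times2m}$ has, for $i\in\mathcal V$, $k\in\mathcal M_i$, $r=s_i+k$: $P_{(r,q)}=1$ if $q=s_j+\kappa_j(i)$ with $j=\kappa_i^{-1}(k)$, and $P_{(r,q)}=0$ otherwise. $B\in\mathbb R^{2m\times m}$ is defined by: for $k\in\mathcal M$ with $\{i,j\}=\kappa^{-1}(k)$, $r=s_i+\kappa_i(j)$, $\hat r=s_j+\kappa_j(i)$, $B_{(r,k)}=1=-B_{(\hat r,k)}$ and all other entries of column $k$ are $0$. $L_k=B_{(\cdot,k)}B_{(\cdot,k)}'$ and $L=\sum_{k\in\mathcal M}L_k=BB'=I_{2m}-P$. **Network model.** For each $i$, agent $H_i:\mathbf L_{2e}^{m_i}\to\mathbf L_{2e}$ is linear and causal (possibly unbounded); links $\varLambda_{i,k}:\mathbf L_{2e}\to\mathbf L_{2e}$, $k\in\mathcal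 M_i$, are causal (possibly nonlinear and time-varying). $\varLambda=\bigoplus_{i\in\mathcal V}\bigoplus_{k\in\mathcal M_i}\varLambda_{i,k}$, $T=\bigoplus_{i\in\mathcal V}\mathbf 1_{m_i,1}:\mathbf L_{2e}^n\to\mathbf L_{2e}^{2m}$, $H=\bigoplus_{i\in\mathcal V}H_i:\mathbf L_{2e}^{2m}\to\mathbf L_{2e}^n$. The uncertain network model is $[\![P,\varLambda\circ(TH)]\!]$. The maps $S_i$, $S_i^\dagger$, $\varDelta$, $G$, $N_i$, $D_i$ are those fixed in the claim. **Link multipliers.** With $\varDelta_i=(\bigoplus_{k\in\mathcal M_i}\varLambda_{i,k}-I_{m_i})\circ\mathbf 1_{m_i,1}S_i$ (so $\varDelta=\bigoplus_i\varDelta_i$), the bounded linear self-adjoint multipliers are written $\bar\varPi_i=\begin{bmatrix}\varPi_{1,i}&\varPi_{2,i}\\ \varPi_{2,i}^*&\varPi_{3,i}\end{bmatrix}$ on $\mathbf L_2\times\mathbf L_2^{m_i}$. Set $\varPi_\bullet=\bigoplus_{i\in\mathcal V}\varPi_{\bullet,i}$, $\bullet\in\{1,2,3\}$. **Transformed multiplier.** $N=\bigoplus_iS_i^\dagger N_i$ (which is stable under the assumptions on $[\![P,TH]\!]$, $S$, $S^\dagger$, $N_i$, $D_i$ made in the claim), $J=\bigoplus_i(D_i-\mathbf 1_{m_i,1}N_i)$, and $$\begin{bmatrix}\varPsi_1&\varPsi_2\\ \varPsi_2^*&\varPsi_3\end{bmatrix}=\begin{bmatrix}N&\mathbf 0_{n,2m}\\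 J&-I_{2m}\end{bmatrix}^*\begin{bmatrix}\varPi_1&\varPi_2\\ \varPi_2^*&\varPi_3\end{bmatrix}\begin{bmatrix}N&\mathbf 0_{n,2m}\\ J&-I_{2m}\end{bmatrix}.$$ Each $\varPsi_\bullet$ is block diagonal, $\varPsi_\bullet=\bigoplus_{i\in\mathcal V}\varPsi_{\bullet,i}$ with $\varPsi_{\bullet,i}:\mathbf L_2^{m_i}\to\mathbf L_2^{m_i}$. **Partitions.** A localized edge-partition of cardinality $c\in\mathbb N$ is a set $\{\mathscr F_1,\dots,\mathscr F_c\}\subset2^{\mathscr E}$ (overlap allowed) such that each edge-induced subgraph $\mathscr G[\mathscr F_p]=(\{i:\mathscr E_i\cap\mathscr F_p\ne\emptyset\},\mathscr F_p)$ is connected and $\bigcup_p\mathscr F_p=\mathscr E$. Put $\mathcal U_p=\{i\in\mathcal V:\mathscr E_i\cap\mathscr F_p\ne\emptyset\}$ (naturally ordered), $\mathcal J_i=\{p\in[c]:i\in\mathcal U_p\}$, $\mathcal K_p=\{\kappa(e):e\in\mathscr F_p\}$, $\mathcal O_k=\{p\in[c]:k\in\mathcal K_p\}$, $\mathcal L_k=\{\kappa(e):e\in\mathscr E_i\cup\mathscr E_j,\ \{i,j\}=\kappa^{-1}(k)\}\setminus\{k\}$, $\mathcal Q_{k,\ell}=\{p\in[c]:\{k,\ell\}\subset\mathcal K_p\}$. For $p\in[c]$, $k\in\mathcal K_p$: $\hat m_p=\sum_{i\in\mathcal U_p}m_i$; $\hat B_{p,k}\in\mathbb R^{\hat m_p}$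 is the column vector obtained by stacking the entries $B_{(r,k)}$, $r\in\mathcal I_i$, over $i\in\mathcal U_p$ in order; $\hat L_{p,k}=\hat B_{p,k}\hat B_{p,k}'$; $\hat L_p=\sum_{k\in\mathcal K_p}\hat L_{p,k}$; $\hat D_p=\bigoplus_{i\in\mathcal U_p}D_i$; $\hat\varPsi_{\bullet,p}=\bigoplus_{i\in\mathcal U_p}\varPsi_{\bullet,i}$. With $\omega_i=\xi_i=1/|\mathcal J_i|$, $\eta_k=\zeta_k=1/|\mathcal O_k|$, $\theta_{k,\ell}=1/|\mathcal Q_{k,\ell}|$ ($\ell\in\mathcal L_k$), define $$\hat K_p=\tfrac12\hat L_p\hat D_p,\quad \hat W_p=\bigoplus_{i\in\mathcal U_p}\omega_iI_{m_i},\quad \hat X_p=\bigoplus_{i\in\mathcal U_p}\xi_i\varPsi_{1,i},\quad \hat Y_p=\hat\varPsi_{2,p}\Big(\sum_{k\in\mathcal K_p}\eta_k\hat L_{p,k}\Big),$$ $$\hat Z_p=\sum_{k\in\mathcal K_p}\zeta_k\hat L_{p,k}\hat\varPsi_{3,p}\hat L_{p,k}+\sum_{k\in\mathcal K_p}\sum_{\ell\in\mathcal K_p\cap\mathcal L_k}\theta_{k,\ell}\hat L_{p,k}\hat\varPsi_{3,p}\hat L_{p,\ell}.$$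
   Formalization: The formal theorem additionally assumes that the network with links I+α(Λ−I) in place of Λ is well-posed for every α in [0,1]; without a well-posedness assumption the claim fails, e.g. for discontinuous static links on a single edge. *)

theory Defs
  imports "HOL-Analysis.Analysis" "HOL-Library.Function_Algebras"
begin

section \<open>Scalar signals\<close>

text \<open>
  Signals on the time axis \<open>[0,\<infinity>)\<close> are identified when they agree almost everywhere, so that
  equations between signals are equations in \<open>L\<^sub>2\<^sub>e\<close>.
\<close>

abbreviation time_measure :: "real measure" where
  "time_measure \<equiv> lebesgue_on {0..}"

definition trunc_fun :: "real \<Rightarrow> (real \<Rightarrow> real) \<Rightarrow> real \<Rightarrow> real" where
  "trunc_fun \<tau> f = (\<lambda>t. if t < \<tau> then f t else 0)"

definition finite_energy_fun :: "(real \<Rightarrow> real) \<Rightarrow> bool" where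
  "finite_energy_fun f \<longleftrightarrow>
     f \<in> borel_measurable time_measure \<and> integrable time_measure (\<lambda>t. (f t)\<^sup>2)"

definition extended_fun :: "(real \<Rightarrow> real) \<Rightarrow> bool" where
  "extended_fun f \<longleftrightarrow> (\<forall>\<tau>\<ge>0. finite_energy_fun (trunc_fun \<tau> f))"

definition ae_eq :: "(real \<Rightarrow> real) \<Rightarrow> (real \<Rightarrow> real) \<Rightarrow> bool" where
  "ae_eq f g \<longleftrightarrow> extended_fun f \<and> extended_fun g \<and> (AE t in time_measure. f t = g t)"

lemma finite_energy_zero: "finite_energy_fun (\<lambda>_. 0)"
  by (simp add: finite_energy_fun_def)

lemma finite_energy_add:
  assumes "finite_energy_fun f" "finite_energy_fun g"
  shows "finite_energy_fun (\<lambda>t. f t + g t)"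
proof -
  have m: "f \<in> borel_measurable time_measure" "g \<in> borel_measurable time_measure"
    using assms by (auto simp: finite_energy_fun_def)
  have i: "integrable time_measure (\<lambda>t. 2 * (f t)\<^sup>2 + 2 * (g t)\<^sup>2)"
    using assms by (auto simp: finite_energy_fun_def)
  have "(f t + g t)\<^sup>2 \<le> 2 * (f t)\<^sup>2 + 2 * (g t)\<^sup>2" for t
    using sum_squares_bound[of "f t" "g t"] by (simp add: power2_sum)
  then have "integrable time_measure (\<lambda>t. (f t + g t)\<^sup>2)"
    by (intro Bochner_Integration.integrable_bound[OF i]) (use m in auto)
  then show ?thesis using m by (simp add: finite_energy_fun_def)
qed

lemma finite_energy_scale:
  assumes "finite_energy_fun f" shows "finite_energy_fun (\<lambda>t. a * f t)"
  using assms by (auto simp: finite_energy_fun_def power_mult_distrib)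

lemma finite_energy_trunc:
  assumes "finite_energy_fun f" shows "finite_energy_fun (trunc_fun \<tau> f)"
proof -
  have m: "f \<in> borel_measurable time_measure" and i: "integrable time_measure (\<lambda>t. (f t)\<^sup>2)"
    using assms by (auto simp: finite_energy_fun_def)
  have s: "{t \<in> space time_measure. t < \<tau>} \<in> sets time_measure"
    by (auto simp: sets_restrict_space space_restrict_space image_iff intro!: bexI[of _ "{..<\<tau>}"])
  have m': "trunc_fun \<tau> f \<in> borel_measurable time_measure"
    unfolding trunc_fun_def by (rule measurable_If[OF m _ s]) simp
  have "integrable time_measure (\<lambda>t. (trunc_fun \<tau> f t)\<^sup>2)"
    by (rule Bochner_Integration.integrable_bound[OF i]) (use m' in \<open>auto simp: trunc_fun_def\<close>)
  with m' show ?thesis by (simp add: finite_energy_fun_def)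
qed

lemma extended_zero: "extended_fun (\<lambda>_. 0)"
proof -
  have "trunc_fun \<tau> (\<lambda>_. 0) = (\<lambda>_. 0)" for \<tau> by (auto simp: trunc_fun_def)
  then show ?thesis by (simp add: extended_fun_def finite_energy_zero)
qed

lemma extended_add:
  assumes "extended_fun f" "extended_fun g" shows "extended_fun (\<lambda>t. f t + g t)"
proof -
  have "trunc_fun \<tau> (\<lambda>t. f t + g t) = (\<lambda>t. trunc_fun \<tau> f t + trunc_fun \<tau> g t)" for \<tau>
    by (auto simp: trunc_fun_def)
  then show ?thesis using assms by (simp add: extended_fun_def finite_energy_add)
qed

lemma extended_scale:
  assumes "extended_fun f" shows "extended_fun (\<lambda>t. a * f t)"
proof -
  have "trunc_fun \<tau> (\<lambda>t. a * f t) = (\<lambda>t. a * trunc_fun \<tau> f t)" for \<tau>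
    by (auto simp: trunc_fun_def)
  then show ?thesis using assms by (simp add: extended_fun_def finite_energy_scale)
qed

lemma extended_trunc:
  assumes "extended_fun f" shows "extended_fun (trunc_fun \<tau> f)"
proof -
  have "trunc_fun \<sigma> (trunc_fun \<tau> f) = trunc_fun \<tau> (trunc_fun \<sigma> f)" for \<sigma>
    by (auto simp: trunc_fun_def)
  then show ?thesis using assms by (simp add: extended_fun_def finite_energy_trunc)
qed

lemma extended_measurable:
  assumes "extended_fun f" shows "f \<in> borel_measurable time_measure"
proof (rule borel_measurable_LIMSEQ_real[where u = "\<lambda>k. trunc_fun (real k) f"])
  show "trunc_fun (real k) f \<in> borel_measurable time_measure" for k
    using assms by (auto simp: extended_fun_def finite_energy_fun_def)
  show "(\<lambda>k. trunc_fun (real k) f t) \<longlonglongrightarrow> f t" if "t \<in> space time_measure" for t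
  proof (rule tendsto_eventually)
    obtain K :: nat where "t < real K" using reals_Archimedean2 by blast
    then show "\<forall>\<^sub>F k in sequentially. trunc_fun (real k) f t = f t"
      by (intro eventually_sequentiallyI[of K]) (auto simp: trunc_fun_def)
  qed
qed

quotient_type signal = "real \<Rightarrow> real" / partial: ae_eq
proof (rule part_equivpI)
  show "\<exists>f. ae_eq f f" by (rule exI[of _ "\<lambda>_. 0"]) (simp add: ae_eq_def extended_zero)
  show "symp ae_eq" by (rule sympI) (auto simp: ae_eq_def elim: eventually_mono)
  show "transp ae_eq" by (rule transpI) (auto simp: ae_eq_def elim: eventually_elim2)
qed

instantiation signal :: real_vector
begin

lift_definition zero_signal :: signal is "\<lambda>_. 0"
  by (simp add: ae_eq_def extended_zero)

lift_definition plus_signal :: "signal \<Rightarrow> signal \<Rightarrow> signal" is "\<lambda>f g t. f t + g t"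
  by (auto simp: ae_eq_def extended_add elim: eventually_elim2)

lift_definition scaleR_signal :: "real \<Rightarrow> signal \<Rightarrow> signal" is "\<lambda>a f t. a * f t"
  by (auto simp: ae_eq_def extended_scale elim: eventually_mono)

definition uminus_signal :: "signal \<Rightarrow> signal" where "uminus_signal x = (- 1) *\<^sub>R x"

definition minus_signal :: "signal \<Rightarrow> signal \<Rightarrow> signal" where "minus_signal x y = x + - y"

instance
proof
  fix x y z :: signal and a b :: real
  show "x + y + z = x + (y + z)"
    by transfer (auto simp: ae_eq_def add.assoc intro!: extended_add)
  show "x + y = y + x" by transfer (auto simp: ae_eq_def add.commute intro!: extended_add)
  show "0 + x = x" by transfer (auto simp: ae_eq_def)
  show "- x + x = 0" unfolding uminus_signal_def
    by transfer (auto simp: ae_eq_def extended_zero)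
  show "x - y = x + - y" by (simp add: minus_signal_def)
  show "a *\<^sub>R (x + y) = a *\<^sub>R x + a *\<^sub>R y"
    by transfer (auto simp: ae_eq_def distrib_left intro!: extended_add extended_scale)
  show "(a + b) *\<^sub>R x = a *\<^sub>R x + b *\<^sub>R x"
    by transfer (auto simp: ae_eq_def distrib_right intro!: extended_add extended_scale)
  show "a *\<^sub>R b *\<^sub>R x = (a * b) *\<^sub>R x"
    by transfer (auto simp: ae_eq_def mult.assoc intro!: extended_scale)
  show "1 *\<^sub>R x = x" by transfer (auto simp: ae_eq_def)
qed

end

lift_definition trunc :: "real \<Rightarrow> signal \<Rightarrow> signal" is trunc_fun
  using extended_trunc by (auto simp: ae_eq_def trunc_fun_def[abs_def] elim!: eventually_mono)

lift_definition finite_energy :: "signal \<Rightarrow> bool" is finite_energy_fun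
proof -
  fix f g assume "ae_eq f g"
  then have m: "f \<in> borel_measurable time_measure" "g \<in> borel_measurable time_measure"
    and ae: "AE t in time_measure. f t = g t"
    by (auto simp: ae_eq_def extended_measurable)
  have "integrable time_measure (\<lambda>t. (f t)\<^sup>2) \<longleftrightarrow> integrable time_measure (\<lambda>t. (g t)\<^sup>2)"
    by (rule Bochner_Integration.integrable_cong_AE) (use m ae in \<open>auto elim: eventually_mono\<close>)
  with m show "finite_energy_fun f = finite_energy_fun g" by (simp add: finite_energy_fun_def)
qed

lift_definition signal_inner :: "signal \<Rightarrow> signal \<Rightarrow> real" is
  "\<lambda>f g. \<integral>t. f t * g t \<partial>time_measure"
proof -
  fix f f' g g' assume *: "ae_eq f f'" "ae_eq g g'"
  then have m: "f \<in> borel_measurable time_measure" "f' \<in> borel_measurable time_measure"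
    "g \<in> borel_measurable time_measure" "g' \<in> borel_measurable time_measure"
    by (auto simp: ae_eq_def extended_measurable)
  have "AE t in time_measure. f t = f' t" "AE t in time_measure. g t = g' t"
    using * by (auto simp: ae_eq_def)
  then have "AE t in time_measure. f t * g t = f' t * g' t" by eventually_elim simp
  then show "(\<integral>t. f t * g t \<partial>time_measure) = (\<integral>t. f' t * g' t \<partial>time_measure)"
    by (intro integral_cong_AE) (use m in auto)
qed


section \<open>Vector signals and systems\<close>

instantiation "fun" :: (type, real_vector) real_vector
begin

definition scaleR_fun :: "real \<Rightarrow> ('a \<Rightarrow> 'b) \<Rightarrow> 'a \<Rightarrow> 'b" where
  "scaleR_fun a f = (\<lambda>x. a *\<^sub>R f x)"

instance
  by standard (auto simp: scaleR_fun_def scaleR_add_right scaleR_add_left)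

end

text \<open>
  An \<open>r\<close>-vector signal has components \<open>1,\<dots>,r\<close>; all other components are \<open>0\<close>. Maps between signal
  spaces are HOL functions of which only the restriction to the stated domain matters.
\<close>

type_synonym vsignal = "nat \<Rightarrow> signal"
type_synonym sysmap = "vsignal \<Rightarrow> vsignal"

definition L2e :: "nat \<Rightarrow> vsignal set" where
  "L2e r = {v. \<forall>k. k \<notin> {1..r} \<longrightarrow> v k = 0}"

definition L2 :: "nat \<Rightarrow> vsignal set" where
  "L2 r = {v \<in> L2e r. \<forall>k\<in>{1..r}. finite_energy (v k)}"

definition ip :: "nat \<Rightarrow> vsignal \<Rightarrow> vsignal \<Rightarrow> real" where
  "ip r v u = (\<Sum>k\<in>{1..r}. signal_inner (v k) (u k))"

definition nrm :: "nat \<Rightarrow> vsignal \<Rightarrow> real" where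
  "nrm r v = sqrt (ip r v v)"

definition vtrunc :: "real \<Rightarrow> sysmap" where
  "vtrunc \<tau> v = (\<lambda>k. trunc \<tau> (v k))"

definition linear_on :: "vsignal set \<Rightarrow> sysmap \<Rightarrow> bool" where
  "linear_on X A \<longleftrightarrow> (\<forall>u\<in>X. \<forall>v\<in>X. A (u + v) = A u + A v) \<and>
                    (\<forall>a. \<forall>u\<in>X. A (a *\<^sub>R u) = a *\<^sub>R A u)"

definition causal :: "nat \<Rightarrow> nat \<Rightarrow> sysmap \<Rightarrow> bool" where
  "causal q r G \<longleftrightarrow> G \<in> L2e q \<rightarrow> L2e r \<and>
     (\<forall>\<tau>\<ge>0. \<forall>u\<in>L2e q. vtrunc \<tau> (G u) = vtrunc \<tau> (G (vtrunc \<tau> u)))"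

definition is_system :: "nat \<Rightarrow> nat \<Rightarrow> sysmap \<Rightarrow> bool" where
  "is_system q r G \<longleftrightarrow> causal q r G \<and> G 0 = 0"

definition stable_system :: "nat \<Rightarrow> nat \<Rightarrow> sysmap \<Rightarrow> bool" where
  "stable_system q r G \<longleftrightarrow> is_system q r G \<and>
     (\<exists>c>0. \<forall>u\<in>L2 q. G u \<in> L2 r \<and> nrm r (G u) \<le> c * nrm q u)"

definition bounded_linear_L2 :: "nat \<Rightarrow> nat \<Rightarrow> sysmap \<Rightarrow> bool" where
  "bounded_linear_L2 q r A \<longleftrightarrow> A \<in> L2 q \<rightarrow> L2 r \<and> linear_on (L2 q) A \<and>
     (\<exists>c. \<forall>u\<in>L2 q. nrm r (A u) \<le> c * nrm q u)"

text \<open>\<open>adj q r A\<close> is the Hilbert adjoint, from \<open>L2 r\<close> to \<open>L2 q\<close>, of \<open>A\<close> from \<open>L2 q\<close> to \<open>L2 r\<close>.\<close>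

definition adj :: "nat \<Rightarrow> nat \<Rightarrow> sysmap \<Rightarrow> sysmap" where
  "adj q r A w = (THE v. v \<in> L2 q \<and> (\<forall>u\<in>L2 q. ip r (A u) w = ip q u v))"

definition self_adjoint :: "nat \<Rightarrow> sysmap \<Rightarrow> bool" where
  "self_adjoint r A \<longleftrightarrow> (\<forall>u\<in>L2 r. adj r r A u = A u)"


section \<open>Block structure\<close>

text \<open>Extraction and insertion of the components \<open>s+1,\<dots>,s+d\<close>.\<close>

definition blk :: "nat \<Rightarrow> nat \<Rightarrow> sysmap" where
  "blk s d v = (\<lambda>k. if k \<in> {1..d} then v (s + k) else 0)"

definition emb :: "nat \<Rightarrow> nat \<Rightarrow> sysmap" where
  "emb s d w = (\<lambda>r. if r \<in> {s+1..s+d} then w (r - s) else 0)"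

definition vcat :: "nat \<Rightarrow> nat \<Rightarrow> vsignal \<Rightarrow> vsignal \<Rightarrow> vsignal" where
  "vcat a b x y = emb 0 a x + emb a b y"

definition mat_op :: "nat \<Rightarrow> nat \<Rightarrow> (nat \<Rightarrow> nat \<Rightarrow> real) \<Rightarrow> sysmap" where
  "mat_op r q A v = (\<lambda>a. if a \<in> {1..r} then (\<Sum>b\<in>{1..q}. A a b *\<^sub>R v b) else 0)"

text \<open>
  \<open>offset U d i\<close> is the number of components preceding block \<open>i\<close> when blocks of sizes \<open>d h\<close>,
  \<open>h \<in> U\<close>, are stacked in the natural order of \<open>U\<close>, and \<open>dsum U a b A\<close> is the corresponding
  block-diagonal direct sum of \<open>A i\<close> from \<open>L2e (a i)\<close> to \<open>L2e (b i)\<close>, \<open>i \<in> U\<close>.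
\<close>

definition offset :: "nat set \<Rightarrow> (nat \<Rightarrow> nat) \<Rightarrow> nat \<Rightarrow> nat" where
  "offset U d i = (\<Sum>h\<in>{h\<in>U. h < i}. d h)"

definition dsum :: "nat set \<Rightarrow> (nat \<Rightarrow> nat) \<Rightarrow> (nat \<Rightarrow> nat) \<Rightarrow> (nat \<Rightarrow> sysmap) \<Rightarrow> sysmap" where
  "dsum U a b A v = (\<Sum>i\<in>U. emb (offset U b i) (b i) (A i (blk (offset U a i) (a i) v)))"

text \<open>
  \<open>op22 r\<^sub>1 r\<^sub>2 q\<^sub>1 q\<^sub>2\<close> assembles a \<open>2 \<times> 2\<close> block operator with row sizes \<open>r\<^sub>1, r\<^sub>2\<close> and column
  sizes \<open>q\<^sub>1, q\<^sub>2\<close>; \<open>cut s d s' d' A\<close> is the block of \<open>A\<close> in columns \<open>s+1,\<dots>,s+d\<close> and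
  rows \<open>s'+1,\<dots>,s'+d'\<close>.
\<close>

definition op22 :: "nat \<Rightarrow> nat \<Rightarrow> nat \<Rightarrow> nat \<Rightarrow> sysmap \<Rightarrow> sysmap \<Rightarrow> sysmap \<Rightarrow> sysmap \<Rightarrow> sysmap" where
  "op22 r1 r2 q1 q2 A11 A12 A21 A22 v =
     vcat r1 r2 (A11 (blk 0 q1 v) + A12 (blk q1 q2 v)) (A21 (blk 0 q1 v) + A22 (blk q1 q2 v))"

definition cut :: "nat \<Rightarrow> nat \<Rightarrow> nat \<Rightarrow> nat \<Rightarrow> sysmap \<Rightarrow> sysmap" where
  "cut s d s' d' A w = blk s' d' (A (emb s d w))"


section \<open>Feedback interconnections\<close>

text \<open>
  For \<open>G\<close> from \<open>L2e q\<close> to \<open>L2e r\<close> and \<open>\<Delta>\<close> from \<open>L2e r\<close> to \<open>L2e q\<close>, the pairs \<open>(d\<^sub>y, d\<^sub>u)\<close> and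
  \<open>(y, u)\<close> are represented by their concatenations in \<open>L2e (r + q)\<close>.
\<close>

definition loop_eq :: "nat \<Rightarrow> nat \<Rightarrow> sysmap \<Rightarrow> sysmap \<Rightarrow> vsignal \<Rightarrow> vsignal \<Rightarrow> bool" where
  "loop_eq q r G \<Delta> d v \<longleftrightarrow> v \<in> L2e (r + q) \<and>
     (let y = blk 0 r v; u = blk r q v in
        y = G u + blk 0 r d \<and> u = \<Delta> y + blk r q d)"

definition closed_loop :: "nat \<Rightarrow> nat \<Rightarrow> sysmap \<Rightarrow> sysmap \<Rightarrow> sysmap" where
  "closed_loop q r G \<Delta> d = (THE v. loop_eq q r G \<Delta> d v)"

definition well_posed :: "nat \<Rightarrow> nat \<Rightarrow> sysmap \<Rightarrow> sysmap \<Rightarrow> bool" where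
  "well_posed q r G \<Delta> \<longleftrightarrow> (\<forall>d\<in>L2e (r + q). \<exists>!v. loop_eq q r G \<Delta> d v) \<and>
     causal (r + q) (r + q) (closed_loop q r G \<Delta>)"

definition feedback_stable :: "nat \<Rightarrow> nat \<Rightarrow> sysmap \<Rightarrow> sysmap \<Rightarrow> bool" where
  "feedback_stable q r G \<Delta> \<longleftrightarrow>
     well_posed q r G \<Delta> \<and> stable_system (r + q) (r + q) (closed_loop q r G \<Delta>)"


section \<open>The graph\<close>

text \<open>\<open>eidx\<close> is \<open>\<kappa>\<close> and \<open>nidx i\<close> is \<open>\<kappa>\<^sub>i\<close>.\<close>

record graph =
  nverts :: nat
  edges :: "nat set set"
  eidx :: "nat set \<Rightarrow> nat"
  nidx :: "nat \<Rightarrow> nat \<Rightarrow> nat"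

definition verts :: "graph \<Rightarrow> nat set" where
  "verts g = {1..nverts g}"

definition nbrs :: "graph \<Rightarrow> nat \<Rightarrow> nat set" where
  "nbrs g i = {j \<in> verts g. {i, j} \<in> edges g}"

definition inc :: "graph \<Rightarrow> nat \<Rightarrow> nat set set" where
  "inc g i = {{i, j} | j. j \<in> nbrs g i}"

definition deg :: "graph \<Rightarrow> nat \<Rightarrow> nat" where
  "deg g i = card (nbrs g i)"

definition size_m :: "graph \<Rightarrow> nat" where
  "size_m g = card (edges g)"

definition connected_graph :: "nat set \<Rightarrow> nat set set \<Rightarrow> bool" where
  "connected_graph V E \<longleftrightarrow>
     (\<forall>u\<in>V. \<forall>v\<in>V. (u, v) \<in> {(a, b). a \<in> V \<and> b \<in> V \<and> {a, b} \<in> E}\<^sup>*)"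

definition network_graph :: "graph \<Rightarrow> bool" where
  "network_graph g \<longleftrightarrow> nverts g \<ge> 2 \<and>
     (\<forall>e\<in>edges g. \<exists>i\<in>verts g. \<exists>j\<in>verts g. i \<noteq> j \<and> e = {i, j}) \<and>
     connected_graph (verts g) (edges g) \<and>
     bij_betw (eidx g) (edges g) {1..size_m g} \<and>
     (\<forall>i\<in>verts g. bij_betw (nidx g i) (nbrs g i) {1..deg g i})"

definition link_edge :: "graph \<Rightarrow> nat \<Rightarrow> nat set" where
  "link_edge g k = inv_into (edges g) (eidx g) k"

definition start :: "graph \<Rightarrow> nat \<Rightarrow> nat" where
  "start g i = offset (verts g) (deg g) i"

definition P_mat :: "graph \<Rightarrow> nat \<Rightarrow> nat \<Rightarrow> real" where
  "P_mat g r q = (if \<exists>i\<in>verts g. \<exists>k\<in>{1..deg g i}. r = start g i + k \<and>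
       (let j = inv_into (nbrs g i) (nidx g i) k in q = start g j + nidx g j i) then 1 else 0)"

text \<open>The sign of each column is arbitrary: it depends on the order in which \<open>{i, j}\<close> is written.\<close>

definition is_B_mat :: "graph \<Rightarrow> (nat \<Rightarrow> nat \<Rightarrow> real) \<Rightarrow> bool" where
  "is_B_mat g B \<longleftrightarrow> (\<forall>k\<in>{1..size_m g}. \<exists>i j. {i, j} = link_edge g k \<and>
     (let r = start g i + nidx g i j; r' = start g j + nidx g j i in
        B r k = 1 \<and> B r' k = - 1 \<and> (\<forall>a. a \<noteq> r \<and> a \<noteq> r' \<longrightarrow> B a k = 0)))"


section \<open>The network model\<close>

definition ones_op :: "nat \<Rightarrow> sysmap" where
  "ones_op d = mat_op d 1 (\<lambda>_ _. 1)"

definition P_op :: "graph \<Rightarrow> sysmap" where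
  "P_op g = mat_op (2 * size_m g) (2 * size_m g) (P_mat g)"

definition T_op :: "graph \<Rightarrow> sysmap" where
  "T_op g = dsum (verts g) (\<lambda>_. 1) (deg g) (\<lambda>i. ones_op (deg g i))"

definition H_op :: "graph \<Rightarrow> (nat \<Rightarrow> sysmap) \<Rightarrow> sysmap" where
  "H_op g H = dsum (verts g) (deg g) (\<lambda>_. 1) H"

definition S_op :: "graph \<Rightarrow> (nat \<Rightarrow> sysmap) \<Rightarrow> sysmap" where
  "S_op g S = dsum (verts g) (\<lambda>_. 1) (\<lambda>_. 1) S"

definition local_link :: "graph \<Rightarrow> (nat \<Rightarrow> nat \<Rightarrow> sysmap) \<Rightarrow> nat \<Rightarrow> sysmap" where
  "local_link g \<Lambda> i = dsum {1..deg g i} (\<lambda>_. 1) (\<lambda>_. 1) (\<Lambda> i)"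

definition link_op :: "graph \<Rightarrow> (nat \<Rightarrow> nat \<Rightarrow> sysmap) \<Rightarrow> sysmap" where
  "link_op g \<Lambda> = dsum (verts g) (deg g) (deg g) (local_link g \<Lambda>)"

definition TH_op :: "graph \<Rightarrow> (nat \<Rightarrow> sysmap) \<Rightarrow> sysmap" where
  "TH_op g H = T_op g \<circ> H_op g H"

definition H_PTH_inv :: "graph \<Rightarrow> (nat \<Rightarrow> sysmap) \<Rightarrow> sysmap" where
  "H_PTH_inv g H = H_op g H \<circ> inv_into (L2e (2 * size_m g)) (\<lambda>y. P_op g y - TH_op g H y)"

definition Delta_op :: "graph \<Rightarrow> (nat \<Rightarrow> nat \<Rightarrow> sysmap) \<Rightarrow> (nat \<Rightarrow> sysmap) \<Rightarrow> sysmap" where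
  "Delta_op g \<Lambda> S = (\<lambda>w. link_op g \<Lambda> w - w) \<circ> (T_op g \<circ> S_op g S)"

definition local_Delta ::
    "graph \<Rightarrow> (nat \<Rightarrow> nat \<Rightarrow> sysmap) \<Rightarrow> (nat \<Rightarrow> sysmap) \<Rightarrow> nat \<Rightarrow> sysmap" where
  "local_Delta g \<Lambda> S i = (\<lambda>w. local_link g \<Lambda> i w - w) \<circ> (ones_op (deg g i) \<circ> S i)"

definition G_op :: "graph \<Rightarrow> (nat \<Rightarrow> sysmap) \<Rightarrow> (nat \<Rightarrow> sysmap) \<Rightarrow> sysmap" where
  "G_op g H S\<^sub>d = S_op g S\<^sub>d \<circ> H_PTH_inv g H"


section \<open>Multipliers\<close>

text \<open>
  \<open>\<Phi> i\<close> acts on \<open>L2 (1 + deg g i)\<close>, the first component being the \<open>L2\<close> argument \<open>y\<^sub>i\<close>; its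
  blocks are \<open>\<Pi>\<^bsub>1,i\<^esub>\<close>, \<open>\<Pi>\<^bsub>2,i\<^esub>\<close>, \<open>\<Pi>\<^bsub>3,i\<^esub>\<close>.
\<close>

definition Pi1_op :: "graph \<Rightarrow> (nat \<Rightarrow> sysmap) \<Rightarrow> sysmap" where
  "Pi1_op g \<Phi> = dsum (verts g) (\<lambda>_. 1) (\<lambda>_. 1) (\<lambda>i. cut 0 1 0 1 (\<Phi> i))"

definition Pi2_op :: "graph \<Rightarrow> (nat \<Rightarrow> sysmap) \<Rightarrow> sysmap" where
  "Pi2_op g \<Phi> = dsum (verts g) (deg g) (\<lambda>_. 1) (\<lambda>i. cut 1 (deg g i) 0 1 (\<Phi> i))"

definition Pi3_op :: "graph \<Rightarrow> (nat \<Rightarrow> sysmap) \<Rightarrow> sysmap" where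
  "Pi3_op g \<Phi> = dsum (verts g) (deg g) (deg g) (\<lambda>i. cut 1 (deg g i) 1 (deg g i) (\<Phi> i))"

definition Pi_op :: "graph \<Rightarrow> (nat \<Rightarrow> sysmap) \<Rightarrow> sysmap" where
  "Pi_op g \<Phi> = (let n = nverts g; M = 2 * size_m g in
     op22 n M n M (Pi1_op g \<Phi>) (Pi2_op g \<Phi>) (adj M n (Pi2_op g \<Phi>)) (Pi3_op g \<Phi>))"

definition N_op :: "graph \<Rightarrow> (nat \<Rightarrow> sysmap) \<Rightarrow> (nat \<Rightarrow> sysmap) \<Rightarrow> sysmap" where
  "N_op g S\<^sub>d N = dsum (verts g) (deg g) (\<lambda>_. 1) (\<lambda>i. S\<^sub>d i \<circ> N i)"

definition J_op :: "graph \<Rightarrow> (nat \<Rightarrow> sysmap) \<Rightarrow> (nat \<Rightarrow> sysmap) \<Rightarrow> sysmap" where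
  "J_op g N D = dsum (verts g) (deg g) (deg g) (\<lambda>i z. D i z - ones_op (deg g i) (N i z))"

definition Psi_op ::
    "graph \<Rightarrow> (nat \<Rightarrow> sysmap) \<Rightarrow> (nat \<Rightarrow> sysmap) \<Rightarrow> (nat \<Rightarrow> sysmap) \<Rightarrow> (nat \<Rightarrow> sysmap) \<Rightarrow> sysmap" where
  "Psi_op g S\<^sub>d N D \<Phi> = (let n = nverts g; M = 2 * size_m g;
       R = op22 n M M M (N_op g S\<^sub>d N) (\<lambda>_. 0) (J_op g N D) (\<lambda>w. - w)
     in adj (M + M) (n + M) R \<circ> Pi_op g \<Phi> \<circ> R)"

text \<open>
  With \<open>\<Psi> = Psi_op \<dots>\<close>, these are the diagonal blocks \<open>\<Psi>\<^bsub>1,i\<^esub>\<close>, \<open>\<Psi>\<^bsub>2,i\<^esub>\<close>, \<open>\<Psi>\<^bsub>3,i\<^esub>\<close> of the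
  upper left, upper right and lower right blocks of \<open>\<Psi>\<close>.
\<close>

definition Psi1 :: "graph \<Rightarrow> sysmap \<Rightarrow> nat \<Rightarrow> sysmap" where
  "Psi1 g \<Psi> i = (let M = 2 * size_m g in
     cut (start g i) (deg g i) (start g i) (deg g i) (cut 0 M 0 M \<Psi>))"

definition Psi2 :: "graph \<Rightarrow> sysmap \<Rightarrow> nat \<Rightarrow> sysmap" where
  "Psi2 g \<Psi> i = (let M = 2 * size_m g in
     cut (start g i) (deg g i) (start g i) (deg g i) (cut M M 0 M \<Psi>))"

definition Psi3 :: "graph \<Rightarrow> sysmap \<Rightarrow> nat \<Rightarrow> sysmap" where
  "Psi3 g \<Psi> i = (let M = 2 * size_m g in
     cut (start g i) (deg g i) (start g i) (deg g i) (cut M M M M \<Psi>))"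


section \<open>Localized edge-partitions\<close>

definition sub_verts :: "graph \<Rightarrow> (nat \<Rightarrow> nat set set) \<Rightarrow> nat \<Rightarrow> nat set" where
  "sub_verts g F p = {i \<in> verts g. inc g i \<inter> F p \<noteq> {}}"

definition localized_edge_partition :: "graph \<Rightarrow> nat \<Rightarrow> (nat \<Rightarrow> nat set set) \<Rightarrow> bool" where
  "localized_edge_partition g c F \<longleftrightarrow> inj_on F {1..c} \<and>
     (\<forall>p\<in>{1..c}. F p \<subseteq> edges g \<and> connected_graph (sub_verts g F p) (F p)) \<and>
     (\<Union>p\<in>{1..c}. F p) = edges g"

definition J_set :: "graph \<Rightarrow> nat \<Rightarrow> (nat \<Rightarrow> nat set set) \<Rightarrow> nat \<Rightarrow> nat set" where
  "J_set g c F i = {p \<in> {1..c}. i \<in> sub_verts g F p}"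

definition K_set :: "graph \<Rightarrow> (nat \<Rightarrow> nat set set) \<Rightarrow> nat \<Rightarrow> nat set" where
  "K_set g F p = eidx g ` F p"

definition O_set :: "graph \<Rightarrow> nat \<Rightarrow> (nat \<Rightarrow> nat set set) \<Rightarrow> nat \<Rightarrow> nat set" where
  "O_set g c F k = {p \<in> {1..c}. k \<in> K_set g F p}"

definition L_set :: "graph \<Rightarrow> nat \<Rightarrow> nat set" where
  "L_set g k = eidx g ` (\<Union>i\<in>link_edge g k. inc g i) - {k}"

definition Q_set :: "graph \<Rightarrow> nat \<Rightarrow> (nat \<Rightarrow> nat set set) \<Rightarrow> nat \<Rightarrow> nat \<Rightarrow> nat set" where
  "Q_set g c F k l = {p \<in> {1..c}. {k, l} \<subseteq> K_set g F p}"

definition m_hat :: "graph \<Rightarrow> (nat \<Rightarrow> nat set set) \<Rightarrow> nat \<Rightarrow> nat" where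
  "m_hat g F p = (\<Sum>i\<in>sub_verts g F p. deg g i)"

text \<open>Entry \<open>a\<close> of the column \<open>k\<close> of \<open>B\<close> restricted to the blocks \<open>i \<in> sub_verts g F p\<close>.\<close>

definition B_hat ::
    "graph \<Rightarrow> (nat \<Rightarrow> nat \<Rightarrow> real) \<Rightarrow> (nat \<Rightarrow> nat set set) \<Rightarrow> nat \<Rightarrow> nat \<Rightarrow> nat \<Rightarrow> real" where
  "B_hat g B F p k a = (\<Sum>i\<in>sub_verts g F p. let s = offset (sub_verts g F p) (deg g) i in
     if a \<in> {s+1..s + deg g i} then B (start g i + (a - s)) k else 0)"

definition Lk_hat ::
    "graph \<Rightarrow> (nat \<Rightarrow> nat \<Rightarrow> real) \<Rightarrow> (nat \<Rightarrow> nat set set) \<Rightarrow> nat \<Rightarrow> nat \<Rightarrow> sysmap" where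
  "Lk_hat g B F p k =
     mat_op (m_hat g F p) (m_hat g F p) (\<lambda>a b. B_hat g B F p k a * B_hat g B F p k b)"

definition L_hat ::
    "graph \<Rightarrow> (nat \<Rightarrow> nat \<Rightarrow> real) \<Rightarrow> (nat \<Rightarrow> nat set set) \<Rightarrow> nat \<Rightarrow> sysmap" where
  "L_hat g B F p z = (\<Sum>k\<in>K_set g F p. Lk_hat g B F p k z)"

definition sub_dsum ::
    "graph \<Rightarrow> (nat \<Rightarrow> nat set set) \<Rightarrow> nat \<Rightarrow> (nat \<Rightarrow> sysmap) \<Rightarrow> sysmap" where
  "sub_dsum g F p A = dsum (sub_verts g F p) (deg g) (deg g) A"

definition K_hat ::
    "graph \<Rightarrow> (nat \<Rightarrow> nat \<Rightarrow> real) \<Rightarrow> (nat \<Rightarrow> nat set set) \<Rightarrow> (nat \<Rightarrow> sysmap) \<Rightarrow> nat \<Rightarrow> sysmap" where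
  "K_hat g B F D p z = (1/2) *\<^sub>R L_hat g B F p (sub_dsum g F p D z)"

definition W_hat :: "graph \<Rightarrow> nat \<Rightarrow> (nat \<Rightarrow> nat set set) \<Rightarrow> nat \<Rightarrow> sysmap" where
  "W_hat g c F p = sub_dsum g F p (\<lambda>i z. (1 / real (card (J_set g c F i))) *\<^sub>R z)"

definition X_hat :: "graph \<Rightarrow> nat \<Rightarrow> (nat \<Rightarrow> nat set set) \<Rightarrow> sysmap \<Rightarrow> nat \<Rightarrow> sysmap" where
  "X_hat g c F \<Psi> p =
     sub_dsum g F p (\<lambda>i z. (1 / real (card (J_set g c F i))) *\<^sub>R Psi1 g \<Psi> i z)"

definition Y_hat ::
    "graph \<Rightarrow> (nat \<Rightarrow> nat \<Rightarrow> real) \<Rightarrow> nat \<Rightarrow> (nat \<Rightarrow> nat set set) \<Rightarrow> sysmap \<Rightarrow> nat \<Rightarrow> sysmap" where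
  "Y_hat g B c F \<Psi> p z = sub_dsum g F p (Psi2 g \<Psi>)
     (\<Sum>k\<in>K_set g F p. (1 / real (card (O_set g c F k))) *\<^sub>R Lk_hat g B F p k z)"

definition Z_hat ::
    "graph \<Rightarrow> (nat \<Rightarrow> nat \<Rightarrow> real) \<Rightarrow> nat \<Rightarrow> (nat \<Rightarrow> nat set set) \<Rightarrow> sysmap \<Rightarrow> nat \<Rightarrow> sysmap" where
  "Z_hat g B c F \<Psi> p z =
     (\<Sum>k\<in>K_set g F p. (1 / real (card (O_set g c F k))) *\<^sub>R
        Lk_hat g B F p k (sub_dsum g F p (Psi3 g \<Psi>) (Lk_hat g B F p k z))) +
     (\<Sum>k\<in>K_set g F p. \<Sum>l\<in>K_set g F p \<inter> L_set g k. (1 / real (card (Q_set g c F k l))) *\<^sub>R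
        Lk_hat g B F p k (sub_dsum g F p (Psi3 g \<Psi>) (Lk_hat g B F p l z)))"

definition local_certificate ::
    "graph \<Rightarrow> (nat \<Rightarrow> nat \<Rightarrow> real) \<Rightarrow> nat \<Rightarrow> (nat \<Rightarrow> nat set set) \<Rightarrow> (nat \<Rightarrow> sysmap) \<Rightarrow> sysmap \<Rightarrow>
     nat \<Rightarrow> real \<Rightarrow> bool" where
  "local_certificate g B c F D \<Psi> p \<epsilon> \<longleftrightarrow> (let h = m_hat g F p in \<forall>z\<in>L2 h.
     let w = vcat h h z (K_hat g B F D p z) in
       ip (h + h) w (op22 h h h h (\<lambda>x. X_hat g c F \<Psi> p x + \<epsilon> *\<^sub>R W_hat g c F p x)
         (Y_hat g B c F \<Psi> p) (adj h h (Y_hat g B c F \<Psi> p)) (Z_hat g B c F \<Psi> p) w) \<le> 0)"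

end

theory Submission
  imports Defs
begin

text \<open>
  Writing \<open>R = (P - T H)\<^sup>-\<^sup>1\<close>, which is stable because the nominal network is, the perturbed loop with
  \<open>\<Lambda>\<close> replaced by \<open>I + \<alpha> (\<Lambda> - I)\<close> reduces to \<open>u = w + \<alpha> \<Delta> (G u)\<close> with \<open>y = R u\<close>. The quadratic
  constraint on \<open>\<Delta>\<close> and strict dissipativity of \<open>G\<close> bound \<open>u\<close> by \<open>w\<close> uniformly in \<open>\<alpha>\<close> as soon as
  \<open>u\<close> has finite energy, and finite energy is propagated from \<open>\<alpha> = 0\<close> to \<open>\<alpha> = 1\<close> in finitely many
  small-gain steps.

  Strict dissipativity comes from the local certificates. By the Bezout identities every \<open>u\<close> of finite
  energy equals \<open>(P D - T N) z\<close> with \<open>z\<close> of finite energy, and then \<open>R u = D z\<close> and \<open>G u = S\<^sup>\<dagger> N z\<close>; hence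
  the form of \<open>G\<close> at \<open>u\<close> is the form of \<open>\<Psi>\<close> at \<open>(z, L D z)\<close>, where \<open>L = I - P\<close>. The columns of \<open>B\<close> are
  orthogonal with squared norm \<open>2\<close>, so \<open>L\<^sub>k L D z = 2 L\<^sub>k D z\<close>, which is why the local operators carry the
  factor \<open>1/2\<close>. Since column \<open>k\<close> lives on the two end blocks of edge \<open>k\<close>, each term of the expanded form
  occurs in the certificates with total weight \<open>1\<close>, and the certificates add up to the global inequality.
\<close>

section \<open>The Hilbert space of finite-energy signals\<close>

text \<open>Two obstacles shape the proof. The quadratic constraint on \<Delta> speaks only of
  finite-energy signals, whereas well-posedness yields a loop signal merely in the extended space;
  hence \<alpha> moves in steps whose length does not depend on \<alpha>, and each step compares
  truncations, which causality permits. Moreover the agents may be unbounded and \<open>Sd i\<close>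
  is given only on a subspace, so neither is estimated directly: all bounds go through R, G,
  \<Delta> and the stable factors \<open>N i\<close>, \<open>D i\<close>.

  The multiplier \<Psi> is given through adjoints, which are definite descriptions. They denote the
  intended operators because the finite-energy signals are complete, which is why the Riesz
  representation theorem is proved. After that an adjoint is always moved to the other side of an
  inner product, and the blocks of \<Psi> enter only through their boundedness and their forms,
  which are forms of the local multipliers \<open>\<Phi> i\<close>.

  The certificates control |z|^2; boundedness of P D - T N turns this into the strictness in |u|^2
  that the homotopy needs.\<close>

lemma finite_energy_0 [simp]: "finite_energy 0"
  by transfer (rule finite_energy_zero)

lemma finite_energy_plus: "finite_energy x \<Longrightarrow> finite_energy y \<Longrightarrow> finite_energy (x + y)"
  by transfer (rule finite_energy_add)

lemma finite_energy_scaleR: "finite_energy x \<Longrightarrow> finite_energy (a *\<^sub>R x)"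
  by transfer (rule finite_energy_scale)

lemma finite_energy_uminus: "finite_energy x \<Longrightarrow> finite_energy (- x)"
  using finite_energy_scaleR[of x "-1"] by simp

lemma finite_energy_diff: "finite_energy x \<Longrightarrow> finite_energy y \<Longrightarrow> finite_energy (x - y)"
  using finite_energy_plus[of x "- y"] finite_energy_uminus[of y] by simp

lemma finite_energy_sum: "(\<And>i. i \<in> I \<Longrightarrow> finite_energy (x i)) \<Longrightarrow> finite_energy (sum x I)"
  by (induction I rule: infinite_finite_induct) (auto intro: finite_energy_plus)

lemma finite_energy_trunc_signal: "0 \<le> \<tau> \<Longrightarrow> finite_energy (trunc \<tau> x)"
  by transfer (auto simp: ae_eq_def extended_fun_def)

lemma trunc_0 [simp]: "trunc \<tau> 0 = 0"
  by transfer (auto simp: ae_eq_def trunc_fun_def extended_zero)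

lemma trunc_add: "trunc \<tau> (x + y) = trunc \<tau> x + trunc \<tau> y"
proof transfer
  fix \<tau> x y assume "ae_eq x x" "ae_eq y y"
  moreover have "trunc_fun \<tau> (\<lambda>t. x t + y t) = (\<lambda>t. trunc_fun \<tau> x t + trunc_fun \<tau> y t)"
    by (auto simp: trunc_fun_def)
  ultimately show "ae_eq (trunc_fun \<tau> (\<lambda>t. x t + y t)) (\<lambda>t. trunc_fun \<tau> x t + trunc_fun \<tau> y t)"
    by (auto simp: ae_eq_def intro!: extended_add extended_trunc)
qed

lemma trunc_scaleR: "trunc \<tau> (a *\<^sub>R x) = a *\<^sub>R trunc \<tau> x"
proof transfer
  fix \<tau> a x assume "ae_eq x x"
  moreover have "trunc_fun \<tau> (\<lambda>t. a * x t) = (\<lambda>t. a * trunc_fun \<tau> x t)"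
    by (auto simp: trunc_fun_def)
  ultimately show "ae_eq (trunc_fun \<tau> (\<lambda>t. a * x t)) (\<lambda>t. a * trunc_fun \<tau> x t)"
    by (auto simp: ae_eq_def intro!: extended_scale extended_trunc)
qed

lemma trunc_uminus: "trunc \<tau> (- x) = - trunc \<tau> x"
  using trunc_scaleR[of \<tau> "-1" x] by simp

lemma trunc_diff: "trunc \<tau> (x - y) = trunc \<tau> x - trunc \<tau> y"
  using trunc_add[of \<tau> x "- y"] by (simp add: trunc_uminus)

lemma trunc_sum: "trunc \<tau> (sum x I) = (\<Sum>i\<in>I. trunc \<tau> (x i))"
  by (induction I rule: infinite_finite_induct) (auto simp: trunc_add)

lemma finite_energy_fun_mult:
  assumes "finite_energy_fun f" "finite_energy_fun g"
  shows "integrable time_measure (\<lambda>t. f t * g t)"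
proof -
  have m: "f \<in> borel_measurable time_measure" "g \<in> borel_measurable time_measure"
    and i: "integrable time_measure (\<lambda>t. (f t)\<^sup>2 + (g t)\<^sup>2)"
    using assms by (auto simp: finite_energy_fun_def)
  have "\<bar>a * b\<bar> \<le> a\<^sup>2 + b\<^sup>2" for a b :: real
    using sum_squares_bound[of a b] sum_squares_bound[of a "- b"] by (auto simp: abs_if)
  then have "norm (f t * g t) \<le> norm ((f t)\<^sup>2 + (g t)\<^sup>2)" for t by simp
  then show ?thesis
    by (intro Bochner_Integration.integrable_bound[OF i]) (use m in auto)
qed

lemma signal_inner_commute: "signal_inner x y = signal_inner y x"
  by transfer (simp add: mult.commute)

lemma signal_inner_add_left:
  "finite_energy x \<Longrightarrow> finite_energy y \<Longrightarrow> finite_energy z \<Longrightarrow>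
   signal_inner (x + y) z = signal_inner x z + signal_inner y z"
  by transfer (simp add: distrib_right finite_energy_fun_mult)

lemma signal_inner_scale_left: "signal_inner (a *\<^sub>R x) y = a * signal_inner x y"
  by transfer (simp add: mult.assoc)

lemma signal_inner_nonneg: "0 \<le> signal_inner x x"
  by transfer simp

lemma signal_inner_0_left [simp]: "signal_inner 0 y = 0"
  using signal_inner_scale_left[of 0 0 y] by simp

lemma signal_inner_eq_0:
  "finite_energy x \<Longrightarrow> signal_inner x x = 0 \<Longrightarrow> x = 0"
proof transfer
  fix f :: "real \<Rightarrow> real"
  assume *: "ae_eq f f" "finite_energy_fun f" "(\<integral>t. f t * f t \<partial>time_measure) = 0"
  have "AE t in time_measure. f t * f t = 0"
    by (rule integral_nonneg_eq_0_iff_AE[THEN iffD1])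
       (use * in \<open>auto intro: finite_energy_fun_mult\<close>)
  with * show "ae_eq f (\<lambda>_. 0)" by (auto simp: ae_eq_def extended_zero)
qed

lemma signal_inner_trunc_le:
  "finite_energy x \<Longrightarrow> signal_inner (trunc \<tau> x) (trunc \<tau> x) \<le> signal_inner x x"
proof transfer
  fix f :: "real \<Rightarrow> real" and \<tau> assume "finite_energy_fun f"
  then show "(\<integral>t. trunc_fun \<tau> f t * trunc_fun \<tau> f t \<partial>time_measure) \<le> (\<integral>t. f t * f t \<partial>time_measure)"
    by (intro integral_mono finite_energy_fun_mult finite_energy_trunc) (auto simp: trunc_fun_def)
qed

text \<open>Fatou's lemma along integer truncation times: at each t the truncations are eventually
  equal to the signal. It turns bounds on truncations, uniform in the time, into finite energy of a
  signal known only in the extended space.\<close>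

lemma finite_energyI_trunc_bounded:
  "(\<And>\<tau>. 0 \<le> \<tau> \<Longrightarrow> signal_inner (trunc \<tau> x) (trunc \<tau> x) \<le> C) \<Longrightarrow> finite_energy x"
proof transfer
  fix f :: "real \<Rightarrow> real" and C
  assume f: "ae_eq f f"
    and C: "\<And>\<tau>. 0 \<le> \<tau> \<Longrightarrow> (\<integral>t. trunc_fun \<tau> f t * trunc_fun \<tau> f t \<partial>time_measure) \<le> C"
  have m: "f \<in> borel_measurable time_measure" and e: "\<And>\<tau>. 0 \<le> \<tau> \<Longrightarrow> finite_energy_fun (trunc_fun \<tau> f)"
    using f extended_measurable by (auto simp: ae_eq_def extended_fun_def)
  have mt: "trunc_fun (real k) f \<in> borel_measurable time_measure" for k
    using e[of "real k"] by (auto simp: finite_energy_fun_def)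
  have nn: "(\<integral>\<^sup>+t. ennreal ((trunc_fun (real k) f t)\<^sup>2) \<partial>time_measure) \<le> ennreal C" for k :: nat
  proof -
    have "(\<integral>\<^sup>+t. ennreal ((trunc_fun (real k) f t)\<^sup>2) \<partial>time_measure)
        = ennreal (\<integral>t. (trunc_fun (real k) f t)\<^sup>2 \<partial>time_measure)"
      by (rule nn_integral_eq_integral) (use e[of "real k"] in \<open>auto simp: finite_energy_fun_def\<close>)
    also have "\<dots> \<le> ennreal C" using C[of "real k"] by (intro ennreal_leI) (simp add: power2_eq_square)
    finally show ?thesis .
  qed
  have lim: "liminf (\<lambda>k. ennreal ((trunc_fun (real k) f t)\<^sup>2)) = ennreal ((f t)\<^sup>2)" for t
  proof (rule lim_imp_Liminf)
    obtain K :: nat where K: "t < real K" using reals_Archimedean2 by blast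
    show "(\<lambda>k. ennreal ((trunc_fun (real k) f t)\<^sup>2)) \<longlonglongrightarrow> ennreal ((f t)\<^sup>2)"
      by (rule tendsto_eventually, intro eventually_sequentiallyI[of K])
         (use K in \<open>auto simp: trunc_fun_def\<close>)
  qed simp
  have "(\<integral>\<^sup>+t. ennreal ((f t)\<^sup>2) \<partial>time_measure)
      = (\<integral>\<^sup>+t. liminf (\<lambda>k. ennreal ((trunc_fun (real k) f t)\<^sup>2)) \<partial>time_measure)"
    by (simp add: lim)
  also have "\<dots> \<le> liminf (\<lambda>k. \<integral>\<^sup>+t. ennreal ((trunc_fun (real k) f t)\<^sup>2) \<partial>time_measure)"
    by (rule nn_integral_liminf) (use mt in auto)
  also have "\<dots> \<le> ennreal C"
    by (rule Liminf_le) (use nn in simp_all)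
  finally have "(\<integral>\<^sup>+t. ennreal ((f t)\<^sup>2) \<partial>time_measure) < \<infinity>"
    by (simp add: order.strict_trans1)
  then have "integrable time_measure (\<lambda>t. (f t)\<^sup>2)"
    by (intro integrableI_nonneg) (use m in auto)
  with m show "finite_energy_fun f" by (simp add: finite_energy_fun_def)
qed

section \<open>Completeness of the space of finite-energy signals\<close>

lemma finite_energy_fun_extended: "finite_energy_fun f \<Longrightarrow> extended_fun f"
  by (simp add: extended_fun_def finite_energy_trunc)

lemma finite_energy_fun_diff:
  "finite_energy_fun f \<Longrightarrow> finite_energy_fun g \<Longrightarrow> finite_energy_fun (\<lambda>t. f t - g t)"
  using finite_energy_add[of f "\<lambda>t. (-1) * g t"] finite_energy_scale[of g "-1"] by simp

text \<open>The Riesz-Fischer argument for a sequence with a prescribed rate. The increments are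
  summable almost everywhere, which gives a pointwise limit; Fatou's lemma then carries the bound
  for \<open>f k - f n\<close> over to the limit as k grows, so the rate survives and no subsequence
  has to be extracted.\<close>

lemma finite_energy_fun_complete:
  assumes f: "\<And>n. finite_energy_fun (f n)"
    and cauchy: "\<And>n k. n \<le> k \<Longrightarrow> (\<integral>t. (f k t - f n t)\<^sup>2 \<partial>time_measure) \<le> (1/4) ^ n"
  shows "\<exists>g. finite_energy_fun g \<and> (\<forall>n. (\<integral>t. (g t - f n t)\<^sup>2 \<partial>time_measure) \<le> (1/4) ^ n)"
proof -
  have m [measurable]: "f n \<in> borel_measurable time_measure" for n
    using f by (simp add: finite_energy_fun_def)
  have int: "integrable time_measure (\<lambda>t. (f k t - f n t)\<^sup>2)" for k n
    using finite_energy_fun_diff[OF f f] by (simp add: finite_energy_fun_def)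
  have nn: "(\<integral>\<^sup>+t. ennreal ((f k t - f n t)\<^sup>2) \<partial>time_measure) \<le> ennreal ((1/4) ^ n)" if "n \<le> k" for n k
    by (subst nn_integral_eq_integral[OF int]) (use cauchy[OF that] in \<open>auto intro: ennreal_leI\<close>)
  \<comment> \<open>by AM-GM, summability of \<open>h n t\<close> with these weights gives that of \<open>f (Suc n) t - f n t\<close>\<close>
  define h where "h n t = 2 ^ n * (f (Suc n) t - f n t)\<^sup>2" for n t
  have hn: "h n t \<ge> 0" for n t by (simp add: h_def)
  have hm [measurable]: "h n \<in> borel_measurable time_measure" for n unfolding h_def by measurable
  \<comment> \<open>The weight 2^n uses up part of the rate only: 2^n (1/4)^n = (1/2)^n is still
    summable.\<close>
  have "(\<integral>\<^sup>+t. ennreal (h n t) \<partial>time_measure) \<le> ennreal ((1/2) ^ n)" for n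
  proof -
    have "(\<integral>\<^sup>+t. ennreal (h n t) \<partial>time_measure)
        = ennreal (2 ^ n) * (\<integral>\<^sup>+t. ennreal ((f (Suc n) t - f n t)\<^sup>2) \<partial>time_measure)"
      unfolding h_def by (subst nn_integral_cmult[symmetric]) (auto simp: ennreal_mult)
    also have "\<dots> \<le> ennreal (2 ^ n) * ennreal ((1/4) ^ n)"
      by (intro mult_left_mono nn) auto
    also have "\<dots> = ennreal ((1/2) ^ n)"
      by (subst ennreal_mult[symmetric]) (auto simp: power_mult_distrib[symmetric])
    finally show ?thesis .
  qed
  then have "(\<integral>\<^sup>+t. (\<Sum>n. ennreal (h n t)) \<partial>time_measure) \<le> (\<Sum>n. ennreal ((1/2) ^ n))"
    by (subst nn_integral_suminf) (auto intro!: suminf_le)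
  also have "\<dots> = ennreal (\<Sum>n. (1/2) ^ n)"
    by (rule suminf_ennreal2) (auto intro: summable_geometric)
  finally have "(\<integral>\<^sup>+t. (\<Sum>n. ennreal (h n t)) \<partial>time_measure) \<noteq> \<infinity>"
    by (auto simp: top_unique)
  then have "AE t in time_measure. (\<Sum>n. ennreal (h n t)) \<noteq> \<infinity>"
    by (intro nn_integral_PInf_AE) measurable
  then have conv: "AE t in time_measure. convergent (\<lambda>n. f n t)"
  proof eventually_elim
    case (elim t)
    have "summable (\<lambda>n. h n t)"
      by (rule summable_suminf_not_top) (use elim hn in auto)
    then have "summable (\<lambda>n. h n t + (1/2) ^ n)"
      by (intro summable_add summable_geometric) auto
    moreover have "norm (f (Suc n) t - f n t) \<le> h n t + (1/2) ^ n" for n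
    proof -
      have "2 * (2 ^ n * \<bar>f (Suc n) t - f n t\<bar>) * 1 \<le> (2 ^ n * \<bar>f (Suc n) t - f n t\<bar>)\<^sup>2 + 1\<^sup>2"
        by (rule sum_squares_bound)
      also have "(2 ^ n * \<bar>f (Suc n) t - f n t\<bar>)\<^sup>2 = 2 ^ n * h n t"
        unfolding h_def power_mult_distrib power2_abs by (simp add: power2_eq_square)
      finally have "2 * (2 ^ n * \<bar>f (Suc n) t - f n t\<bar>) \<le> 2 ^ n * h n t + 1" by simp
      then have "\<bar>f (Suc n) t - f n t\<bar> * 2 \<le> h n t + (1/2) ^ n"
        by (simp add: field_simps)
      then show ?thesis by (simp add: order_trans[OF _ \<open>_ * 2 \<le> _\<close>])
    qed
    ultimately have "summable (\<lambda>n. f (Suc n) t - f n t)"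
      by (intro summable_comparison_test[of "\<lambda>n. f (Suc n) t - f n t" "\<lambda>n. h n t + (1/2) ^ n"]) auto
    then have "convergent (\<lambda>k. \<Sum>n<k. f (Suc n) t - f n t)"
      by (simp add: summable_iff_convergent)
    then have "convergent (\<lambda>k. f k t - f 0 t)" by (simp only: sum_lessThan_telescope[of "\<lambda>n. f n t"])
    then show ?case using convergent_add[OF _ convergent_const[of "f 0 t"]] by fastforce
  qed
  \<comment> \<open>Where the sequence diverges \<open>lim\<close> is unspecified; this happens on a
    null set only, and measurability of \<open>lim\<close> holds regardless.\<close>
  define g where "g t = lim (\<lambda>n. f n t)" for t
  have gm [measurable]: "g \<in> borel_measurable time_measure"
    unfolding g_def by (rule borel_measurable_lim_metric) (rule m)
  have gn: "(\<integral>\<^sup>+t. ennreal ((g t - f n t)\<^sup>2) \<partial>time_measure) \<le> ennreal ((1/4) ^ n)" for n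
  proof -
    have "AE t in time_measure. ennreal ((g t - f n t)\<^sup>2) = liminf (\<lambda>k. ennreal ((f k t - f n t)\<^sup>2))"
      using conv
    proof eventually_elim
      case (elim t)
      then have "(\<lambda>k. f k t) \<longlonglongrightarrow> g t" by (simp add: g_def convergent_LIMSEQ_iff)
      then have "(\<lambda>k. ennreal ((f k t - f n t)\<^sup>2)) \<longlonglongrightarrow> ennreal ((g t - f n t)\<^sup>2)"
        by (intro tendsto_intros)
      from lim_imp_Liminf[OF sequentially_bot this] show ?case by (rule sym)
    qed
    then have "(\<integral>\<^sup>+t. ennreal ((g t - f n t)\<^sup>2) \<partial>time_measure)
        = (\<integral>\<^sup>+t. liminf (\<lambda>k. ennreal ((f k t - f n t)\<^sup>2)) \<partial>time_measure)"
      by (rule nn_integral_cong_AE)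
    also have "\<dots> \<le> liminf (\<lambda>k. \<integral>\<^sup>+t. ennreal ((f k t - f n t)\<^sup>2) \<partial>time_measure)"
      by (rule nn_integral_liminf) measurable
    also have "\<dots> \<le> ennreal ((1/4) ^ n)"
    proof (rule Liminf_le)
      show "\<forall>\<^sub>F k in sequentially.
          (\<integral>\<^sup>+t. ennreal ((f k t - f n t)\<^sup>2) \<partial>time_measure) \<le> ennreal ((1/4) ^ n)"
        using nn by (auto intro: eventually_sequentiallyI[of n])
    qed simp
    finally show ?thesis .
  qed
  have gi: "integrable time_measure (\<lambda>t. (g t - f n t)\<^sup>2)" for n
  proof (rule integrableI_nonneg)
    show "(\<integral>\<^sup>+t. ennreal ((g t - f n t)\<^sup>2) \<partial>time_measure) < \<infinity>"
      using gn[of n] by (rule order.strict_trans1) simp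
  qed auto
  have "finite_energy_fun (\<lambda>t. g t - f 0 t)" using gi by (simp add: finite_energy_fun_def)
  from finite_energy_add[OF this f[of 0]] have "finite_energy_fun g" by simp
  moreover have "(\<integral>t. (g t - f n t)\<^sup>2 \<partial>time_measure) \<le> (1/4) ^ n" for n
    using gn[of n] by (simp add: nn_integral_eq_integral[OF gi])
  ultimately show ?thesis by blast
qed

text \<open>Representatives are chosen for the whole sequence and the function-level statement
  supplies a limit. A function of finite energy lies in the extended space, so the limit does have a
  class.\<close>

lemma finite_energy_complete:
  assumes x: "\<And>n. finite_energy (x n)"
    and cauchy: "\<And>n k. n \<le> k \<Longrightarrow> signal_inner (x k - x n) (x k - x n) \<le> (1/4) ^ n"
  shows "\<exists>y. finite_energy y \<and> (\<forall>n. signal_inner (y - x n) (y - x n) \<le> (1/4) ^ n)"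
proof -
  define f where "f n = rep_signal (x n)" for n
  have xf: "x n = abs_signal (f n)" and ff: "ae_eq (f n) (f n)" for n
    unfolding f_def by (simp_all add: Quotient_abs_rep[OF Quotient_signal] Quotient_rep_reflp[OF Quotient_signal])
  have fe: "finite_energy_fun (f n)" for n
    using x[of n] ff[of n] by (simp add: xf finite_energy.abs_eq)
  have inner: "signal_inner (abs_signal a - abs_signal b) (abs_signal a - abs_signal b)
      = (\<integral>t. (a t - b t)\<^sup>2 \<partial>time_measure)" if "ae_eq a a" "ae_eq b b" for a b
  proof -
    have b: "ae_eq (\<lambda>t. (-1) * b t) (\<lambda>t. (-1) * b t)"
      using that extended_scale[of b "-1"] by (simp add: ae_eq_def)
    then have "ae_eq (\<lambda>t. a t + (-1) * b t) (\<lambda>t. a t + (-1) * b t)"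
      using that extended_add[of a "\<lambda>t. (-1) * b t"] by (simp add: ae_eq_def)
    moreover have "abs_signal a - abs_signal b = abs_signal (\<lambda>t. a t + (-1) * b t)"
      using that b unfolding minus_signal_def uminus_signal_def
      by (simp only: scaleR_signal.abs_eq plus_signal.abs_eq)
    ultimately show ?thesis by (simp add: signal_inner.abs_eq power2_eq_square)
  qed
  obtain g where g: "finite_energy_fun g" "\<And>n. (\<integral>t. (g t - f n t)\<^sup>2 \<partial>time_measure) \<le> (1/4) ^ n"
    using finite_energy_fun_complete[of f] fe cauchy by (auto simp: xf inner[OF ff ff])
  then have gg: "ae_eq g g" by (simp add: ae_eq_def finite_energy_fun_extended)
  show ?thesis
    by (rule exI[of _ "abs_signal g"]) (use g in \<open>simp add: finite_energy.abs_eq[OF gg] xf inner[OF gg ff]\<close>)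
qed

section \<open>Cauchy-Schwarz inequality and Riesz representation for scalar signals\<close>

lemma quadratic_form_bound:
  fixes a b c :: real
  assumes a: "0 \<le> a" and pos: "\<And>t. 0 \<le> a * t\<^sup>2 + 2 * b * t + c"
  shows "b\<^sup>2 \<le> a * c"
proof (cases "a = 0")
  case True
  have "b = 0"
  proof (rule ccontr)
    assume "b \<noteq> 0"
    \<comment> \<open>With a = 0 this argument gives the linear form the value -1.\<close>
    with pos[of "- (c + 1) / (2 * b)"] True show False by simp
  qed
  with True show ?thesis by simp
next
  case False
  with pos[of "- b / a"] have "0 \<le> c - b\<^sup>2 / a"
    by (simp add: power2_eq_square field_simps)
  with a False show ?thesis by (simp add: field_simps)
qed

lemma signal_inner_scale_right: "signal_inner x (a *\<^sub>R y) = a * signal_inner x y"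
  using signal_inner_scale_left[of a y x] by (simp add: signal_inner_commute)

lemma signal_inner_add_right:
  "finite_energy x \<Longrightarrow> finite_energy y \<Longrightarrow> finite_energy z \<Longrightarrow>
   signal_inner z (x + y) = signal_inner z x + signal_inner z y"
  using signal_inner_add_left[of x y z] by (simp add: signal_inner_commute)

lemma signal_inner_diff_left:
  "finite_energy x \<Longrightarrow> finite_energy y \<Longrightarrow> finite_energy z \<Longrightarrow>
   signal_inner (x - y) z = signal_inner x z - signal_inner y z"
  using signal_inner_add_left[of x "(-1) *\<^sub>R y" z] signal_inner_scale_left[of "-1" y z]
    finite_energy_scaleR[of y "-1"]
  by simp

lemma signal_inner_0_right [simp]: "signal_inner y 0 = 0"
  using signal_inner_0_left[of y] by (simp add: signal_inner_commute)

lemma signal_inner_square_add: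
  assumes "finite_energy x" "finite_energy y"
  shows "signal_inner (x + t *\<^sub>R y) (x + t *\<^sub>R y)
    = signal_inner y y * t\<^sup>2 + 2 * signal_inner x y * t + signal_inner x x"
  using assms signal_inner_commute[of y x]
  by (simp add: signal_inner_add_left signal_inner_add_right signal_inner_scale_left
      signal_inner_scale_right finite_energy_plus finite_energy_scaleR power2_eq_square algebra_simps)

lemma signal_inner_Cauchy_Schwarz:
  assumes "finite_energy x" "finite_energy y"
  shows "(signal_inner x y)\<^sup>2 \<le> signal_inner x x * signal_inner y y"
  using quadratic_form_bound[of "signal_inner y y" "signal_inner x y" "signal_inner x x"]
    signal_inner_square_add[OF assms] signal_inner_nonneg
  by (metis mult.commute)

text \<open>Variational proof of Riesz's theorem. Completing the square bounds \<open>Q\<close>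
  below by -C^2; the midpoint of two near-minimizers cannot beat the infimum, which makes a
  minimizing sequence Cauchy; stationarity of the limit in the direction u is the asserted
  identity.\<close>

lemma signal_riesz:
  assumes add: "\<And>x y. finite_energy x \<Longrightarrow> finite_energy y \<Longrightarrow> \<phi> (x + y) = \<phi> x + \<phi> y"
    and scale: "\<And>a x. finite_energy x \<Longrightarrow> \<phi> (a *\<^sub>R x) = a * \<phi> x"
    and bound: "\<And>x. finite_energy x \<Longrightarrow> \<phi> x \<le> C * sqrt (signal_inner x x)"
  shows "\<exists>v. finite_energy v \<and> (\<forall>u. finite_energy u \<longrightarrow> \<phi> u = signal_inner u v)"
proof -
  \<comment> \<open>the representing signal is the minimizer of \<open>Q\<close>\<close>
  define Q where "Q x = signal_inner x x - 2 * \<phi> x" for x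
  define m where "m = Inf (Q ` {x. finite_energy x})"
  have "- C\<^sup>2 \<le> Q x" if "finite_energy x" for x
  proof -
    have "0 \<le> (sqrt (signal_inner x x) - C)\<^sup>2" by simp
    then have "0 \<le> signal_inner x x - 2 * (C * sqrt (signal_inner x x)) + C\<^sup>2"
      by (simp add: power2_diff signal_inner_nonneg mult_ac)
    with bound[OF that] show ?thesis by (simp add: Q_def)
  qed
  then have bdd: "bdd_below (Q ` {x. finite_energy x})" by (intro bdd_belowI[of _ "- C\<^sup>2"]) auto
  have Qm: "m \<le> Q x" if "finite_energy x" for x
    unfolding m_def by (rule cInf_lower[OF _ bdd]) (use that in auto)
  \<comment> \<open>The slack is a quarter of (1/4)^n because the midpoint comparison below loses a
    factor 4: one quarter of the squared distance is at most the average excess over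
    \<open>m\<close>.\<close>
  have "\<exists>x. finite_energy x \<and> Q x < m + (1/4) ^ n / 4" for n :: nat
  proof -
    have "Q ` {x. finite_energy x} \<noteq> {}" using finite_energy_0 by blast
    moreover have "m < m + (1/4) ^ n / 4" by simp
    ultimately have "\<exists>q\<in>Q ` {x. finite_energy x}. q < m + (1/4) ^ n / 4"
      unfolding m_def by (rule cInf_lessD)
    then show ?thesis by auto
  qed
  then obtain x where x: "\<And>n. finite_energy (x n)" and Qx: "\<And>n. Q (x n) < m + (1/4) ^ n / 4"
    by metis
  have quad: "Q (y + t *\<^sub>R z) = Q y + signal_inner z z * t\<^sup>2 + 2 * (signal_inner y z - \<phi> z) * t"
    if "finite_energy y" "finite_energy z" for y z t
    using that signal_inner_square_add[OF that]
    by (simp add: Q_def add scale finite_energy_scaleR algebra_simps)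
  have "signal_inner (x k - x n) (x k - x n) \<le> (1/4) ^ n" if "n \<le> k" for n k
  proof -
    have d: "finite_energy (x k - x n)" using x by (simp add: finite_energy_diff)
    define a where "a = signal_inner (x k - x n) (x k - x n)"
    define b where "b = 2 * (signal_inner (x n) (x k - x n) - \<phi> (x k - x n))"
    \<comment> \<open>The values of \<open>Q\<close> at the ends and at the midpoint of the segment
      eliminate the first-order term \<open>b\<close> and leave a bound on \<open>a\<close>.\<close>
    have "m \<le> Q (x n + (1/2) *\<^sub>R (x k - x n))"
      by (intro Qm finite_energy_plus finite_energy_scaleR x d)
    moreover have "Q (x n + (1/2) *\<^sub>R (x k - x n)) = Q (x n) + a / 4 + b / 2"
      using quad[OF x d, of n "1/2"] by (simp add: a_def b_def power2_eq_square)
    moreover have "Q (x k) = Q (x n) + a + b"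
      using quad[OF x d, of n 1] by (simp add: a_def b_def)
    moreover have "(1/4 :: real) ^ k \<le> (1/4) ^ n" using that by (intro power_decreasing) auto
    ultimately show ?thesis using Qx[of n] Qx[of k] unfolding a_def[symmetric] by argo
  qed
  from finite_energy_complete[of x, OF x this] obtain v where v: "finite_energy v"
    and vx: "\<And>n. signal_inner (v - x n) (v - x n) \<le> (1/4) ^ n" by blast
  have "\<phi> u = signal_inner u v" if u: "finite_energy u" for u
  proof -
    have lim: "(\<lambda>n. signal_inner (x n) u) \<longlonglongrightarrow> signal_inner v u"
    proof (rule LIM_zero_cancel, rule Lim_null_comparison)
      have "\<bar>signal_inner (x n) u - signal_inner v u\<bar> \<le> (1/2) ^ n * sqrt (signal_inner u u)" for n
      proof (rule power2_le_imp_le)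
        have "(signal_inner (x n) u - signal_inner v u)\<^sup>2 = (signal_inner (v - x n) u)\<^sup>2"
          using x v u by (simp add: signal_inner_diff_left power2_commute)
        also have "\<dots> \<le> signal_inner (v - x n) (v - x n) * signal_inner u u"
          by (intro signal_inner_Cauchy_Schwarz finite_energy_diff x v u)
        also have "\<dots> \<le> (1/4) ^ n * signal_inner u u"
          by (intro mult_right_mono vx signal_inner_nonneg)
        also have "\<dots> = ((1/2) ^ n * sqrt (signal_inner u u))\<^sup>2"
          using signal_inner_nonneg[of u]
          by (simp add: power_mult_distrib) (simp add: power2_eq_square flip: power_mult_distrib)
        finally show "\<bar>signal_inner (x n) u - signal_inner v u\<bar>\<^sup>2 \<le> ((1/2) ^ n * sqrt (signal_inner u u))\<^sup>2"
          by simp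
        show "0 \<le> (1/2) ^ n * sqrt (signal_inner u u)" by (simp add: signal_inner_nonneg)
      qed
      then show "\<forall>\<^sub>F n in sequentially. norm (signal_inner (x n) u - signal_inner v u)
          \<le> (1/2) ^ n * sqrt (signal_inner u u)" by simp
      show "(\<lambda>n. (1/2) ^ n * sqrt (signal_inner u u)) \<longlonglongrightarrow> 0"
        by (intro tendsto_mult_left_zero LIMSEQ_power_zero) auto
    qed
    \<comment> \<open>Minimality is tested at \<open>x n\<close> with slack, and then n tends to
      infinity; only the inner product with u has to converge for this.\<close>
    have "0 \<le> signal_inner u u * t\<^sup>2 + 2 * (signal_inner v u - \<phi> u) * t + 0" for t
    proof (rule LIMSEQ_le_const)
      show "(\<lambda>n. signal_inner u u * t\<^sup>2 + 2 * (signal_inner (x n) u - \<phi> u) * t + (1/4) ^ n / 4)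
          \<longlonglongrightarrow> signal_inner u u * t\<^sup>2 + 2 * (signal_inner v u - \<phi> u) * t + 0"
        by (intro tendsto_intros lim tendsto_divide_zero LIMSEQ_power_zero) auto
      have "0 \<le> signal_inner u u * t\<^sup>2 + 2 * (signal_inner (x n) u - \<phi> u) * t + (1/4) ^ n / 4" for n
        using quad[OF x u, of n t] Qm[of "x n + t *\<^sub>R u"] Qx[of n] x[of n] u
        by (simp add: finite_energy_plus finite_energy_scaleR)
      then show "\<exists>N. \<forall>n\<ge>N. 0 \<le> signal_inner u u * t\<^sup>2 + 2 * (signal_inner (x n) u - \<phi> u) * t + (1/4) ^ n / 4"
        by blast
    qed
    \<comment> \<open>A nonnegative quadratic polynomial with constant term 0 has no linear
      term.\<close>
    then have "(signal_inner v u - \<phi> u)\<^sup>2 \<le> signal_inner u u * 0"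
      by (intro quadratic_form_bound signal_inner_nonneg)
    then show ?thesis by (simp add: signal_inner_commute)
  qed
  with v show ?thesis by blast
qed

section \<open>Vector signals\<close>

lemma sum_fun_eval: "(sum f A) x = (\<Sum>a\<in>A. f a x)"
  by (induction A rule: infinite_finite_induct) auto

lemma scaleR_fun_eval [simp]: "(a *\<^sub>R f) x = a *\<^sub>R f x"
  by (simp add: scaleR_fun_def)

lemma L2e_0 [simp]: "0 \<in> L2e r" by (simp add: L2e_def)

lemma L2e_add: "x \<in> L2e r \<Longrightarrow> y \<in> L2e r \<Longrightarrow> x + y \<in> L2e r" by (auto simp: L2e_def)

lemma L2e_scaleR: "x \<in> L2e r \<Longrightarrow> a *\<^sub>R x \<in> L2e r" by (auto simp: L2e_def)

lemma L2e_uminus: "x \<in> L2e r \<Longrightarrow> - x \<in> L2e r" by (auto simp: L2e_def)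

lemma L2e_diff: "x \<in> L2e r \<Longrightarrow> y \<in> L2e r \<Longrightarrow> x - y \<in> L2e r" by (auto simp: L2e_def)

lemma L2e_sum: "(\<And>i. i \<in> I \<Longrightarrow> x i \<in> L2e r) \<Longrightarrow> sum x I \<in> L2e r"
  by (auto simp: L2e_def sum_fun_eval)

lemma L2_imp_L2e: "x \<in> L2 r \<Longrightarrow> x \<in> L2e r" by (simp add: L2_def)

lemma finite_energy_L2: "x \<in> L2 r \<Longrightarrow> finite_energy (x k)"
  by (cases "k \<in> {1..r}") (auto simp: L2_def L2e_def)

lemma L2I: "x \<in> L2e r \<Longrightarrow> (\<And>k. finite_energy (x k)) \<Longrightarrow> x \<in> L2 r" by (simp add: L2_def)

lemma L2_0 [simp]: "0 \<in> L2 r" by (auto intro: L2I)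

lemma L2_add: "x \<in> L2 r \<Longrightarrow> y \<in> L2 r \<Longrightarrow> x + y \<in> L2 r"
  by (rule L2I) (simp_all add: L2e_add finite_energy_plus finite_energy_L2 L2_imp_L2e)

lemma L2_scaleR: "x \<in> L2 r \<Longrightarrow> a *\<^sub>R x \<in> L2 r"
  by (rule L2I) (simp_all add: L2e_scaleR finite_energy_scaleR finite_energy_L2 L2_imp_L2e)

lemma L2_uminus: "x \<in> L2 r \<Longrightarrow> - x \<in> L2 r"
  by (rule L2I) (simp_all add: L2e_uminus finite_energy_uminus finite_energy_L2 L2_imp_L2e)

lemma L2_diff: "x \<in> L2 r \<Longrightarrow> y \<in> L2 r \<Longrightarrow> x - y \<in> L2 r"
  by (rule L2I) (simp_all add: L2e_diff finite_energy_diff finite_energy_L2 L2_imp_L2e)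

lemma L2_sum: "(\<And>i. i \<in> I \<Longrightarrow> x i \<in> L2 r) \<Longrightarrow> sum x I \<in> L2 r"
  by (induction I rule: infinite_finite_induct) (auto intro: L2_add)

lemma ip_commute: "ip r x y = ip r y x"
  by (simp add: ip_def signal_inner_commute)

lemma ip_add_left: "x \<in> L2 r \<Longrightarrow> y \<in> L2 r \<Longrightarrow> z \<in> L2 r \<Longrightarrow> ip r (x + y) z = ip r x z + ip r y z"
  by (simp add: ip_def signal_inner_add_left finite_energy_L2 sum.distrib)

lemma ip_scale_left: "ip r (a *\<^sub>R x) y = a * ip r x y"
  by (simp add: ip_def signal_inner_scale_left sum_distrib_left)

lemma ip_0_left [simp]: "ip r 0 y = 0"
  by (simp add: ip_def)

lemma ip_uminus_left: "ip r (- x) y = - ip r x y"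
  using ip_scale_left[of r "-1" x y] by simp

lemma ip_diff_left: "x \<in> L2 r \<Longrightarrow> y \<in> L2 r \<Longrightarrow> z \<in> L2 r \<Longrightarrow> ip r (x - y) z = ip r x z - ip r y z"
  using ip_add_left[of x r "- y" z] by (simp add: L2_uminus ip_uminus_left)

lemma ip_sum_left:
  "(\<And>i. i \<in> I \<Longrightarrow> x i \<in> L2 r) \<Longrightarrow> z \<in> L2 r \<Longrightarrow> ip r (sum x I) z = (\<Sum>i\<in>I. ip r (x i) z)"
  by (induction I rule: infinite_finite_induct) (auto simp: ip_add_left L2_sum)

lemma ip_add_right: "x \<in> L2 r \<Longrightarrow> y \<in> L2 r \<Longrightarrow> z \<in> L2 r \<Longrightarrow> ip r z (x + y) = ip r z x + ip r z y"
  using ip_add_left[of x r y z] by (simp add: ip_commute)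

lemma ip_scale_right: "ip r y (a *\<^sub>R x) = a * ip r y x"
  using ip_scale_left[of r a x y] by (simp add: ip_commute)

lemma ip_0_right [simp]: "ip r y 0 = 0"
  using ip_0_left[of r y] by (simp add: ip_commute)

lemma ip_diff_right: "x \<in> L2 r \<Longrightarrow> y \<in> L2 r \<Longrightarrow> z \<in> L2 r \<Longrightarrow> ip r z (x - y) = ip r z x - ip r z y"
  using ip_diff_left[of x r y z] by (simp add: ip_commute)

lemma ip_sum_right:
  "(\<And>i. i \<in> I \<Longrightarrow> x i \<in> L2 r) \<Longrightarrow> z \<in> L2 r \<Longrightarrow> ip r z (sum x I) = (\<Sum>i\<in>I. ip r z (x i))"
  using ip_sum_left[of I x r z] by (simp add: ip_commute)

lemma ip_nonneg: "0 \<le> ip r x x"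
  by (simp add: ip_def sum_nonneg signal_inner_nonneg)

lemma ip_eq_0: "x \<in> L2 r \<Longrightarrow> ip r x x = 0 \<Longrightarrow> x = 0"
proof
  fix k assume x: "x \<in> L2 r" "ip r x x = 0"
  show "x k = 0 k"
  proof (cases "k \<in> {1..r}")
    case True
    with x have "signal_inner (x k) (x k) = 0"
      by (simp add: ip_def sum_nonneg_eq_0_iff signal_inner_nonneg)
    then show ?thesis using x signal_inner_eq_0 by (simp add: finite_energy_L2)
  qed (use x in \<open>auto simp: L2_def L2e_def\<close>)
qed

lemma nrm_nonneg [simp]: "0 \<le> nrm r x" by (simp add: nrm_def ip_nonneg)

lemma nrm_square: "(nrm r x)\<^sup>2 = ip r x x" by (simp add: nrm_def ip_nonneg)

lemma nrm_0 [simp]: "nrm r 0 = 0" by (simp add: nrm_def)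

lemma nrm_scaleR: "nrm r (a *\<^sub>R x) = \<bar>a\<bar> * nrm r x"
  by (simp add: nrm_def ip_scale_left ip_scale_right real_sqrt_mult flip: mult.assoc)

lemma nrm_uminus: "nrm r (- x) = nrm r x"
  using nrm_scaleR[of r "-1" x] by simp

lemma ip_Cauchy_Schwarz:
  assumes x: "x \<in> L2 r" and y: "y \<in> L2 r" shows "\<bar>ip r x y\<bar> \<le> nrm r x * nrm r y"
proof -
  have "0 \<le> ip r y y * t\<^sup>2 + 2 * ip r x y * t + ip r x x" for t
    using ip_nonneg[of r "x + t *\<^sub>R y"] x y
    by (simp add: ip_add_left ip_add_right ip_scale_left ip_scale_right L2_add L2_scaleR
        power2_eq_square ip_commute[of r y x] algebra_simps)
  then have "(ip r x y)\<^sup>2 \<le> ip r y y * ip r x x"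
    by (rule quadratic_form_bound[OF ip_nonneg])
  then have "\<bar>ip r x y\<bar>\<^sup>2 \<le> (nrm r x * nrm r y)\<^sup>2"
    by (simp add: power_mult_distrib nrm_square mult.commute)
  then show ?thesis by (rule power2_le_imp_le) simp
qed

lemma ip_le_nrm: "x \<in> L2 r \<Longrightarrow> y \<in> L2 r \<Longrightarrow> ip r x y \<le> nrm r x * nrm r y"
  using ip_Cauchy_Schwarz[of x r y] by linarith

lemma nrm_triangle:
  assumes x: "x \<in> L2 r" and y: "y \<in> L2 r" shows "nrm r (x + y) \<le> nrm r x + nrm r y"
proof (rule power2_le_imp_le)
  have "(nrm r (x + y))\<^sup>2 = ip r x x + 2 * ip r x y + ip r y y"
    using x y by (simp add: nrm_square ip_add_left ip_add_right L2_add ip_commute[of r y x])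
  also have "\<dots> \<le> (nrm r x + nrm r y)\<^sup>2"
    using ip_le_nrm[OF x y] by (simp add: power2_sum nrm_square)
  finally show "(nrm r (x + y))\<^sup>2 \<le> (nrm r x + nrm r y)\<^sup>2" .
qed simp

lemma nrm_triangle_diff:
  "x \<in> L2 r \<Longrightarrow> y \<in> L2 r \<Longrightarrow> nrm r (x - y) \<le> nrm r x + nrm r y"
  using nrm_triangle[of x r "- y"] by (simp add: L2_uminus nrm_uminus)

lemma vtrunc_add: "vtrunc \<tau> (x + y) = vtrunc \<tau> x + vtrunc \<tau> y"
  by (auto simp: vtrunc_def trunc_add)

lemma vtrunc_diff: "vtrunc \<tau> (x - y) = vtrunc \<tau> x - vtrunc \<tau> y"
  by (auto simp: vtrunc_def trunc_diff)

lemma vtrunc_scaleR: "vtrunc \<tau> (a *\<^sub>R x) = a *\<^sub>R vtrunc \<tau> x"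
  by (auto simp: vtrunc_def trunc_scaleR)

lemma vtrunc_sum: "vtrunc \<tau> (sum x I) = (\<Sum>i\<in>I. vtrunc \<tau> (x i))"
  by (auto simp: vtrunc_def trunc_sum sum_fun_eval)

lemma vtrunc_L2e: "x \<in> L2e r \<Longrightarrow> vtrunc \<tau> x \<in> L2e r"
  by (auto simp: L2e_def vtrunc_def)

lemma vtrunc_L2: "0 \<le> \<tau> \<Longrightarrow> x \<in> L2e r \<Longrightarrow> vtrunc \<tau> x \<in> L2 r"
  by (rule L2I[OF vtrunc_L2e]) (simp_all add: vtrunc_def finite_energy_trunc_signal)

lemma nrm_vtrunc_le: "x \<in> L2 r \<Longrightarrow> nrm r (vtrunc \<tau> x) \<le> nrm r x"
  by (auto simp: nrm_def ip_def vtrunc_def intro!: sum_mono signal_inner_trunc_le finite_energy_L2)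

lemma L2I_vtrunc_bounded:
  assumes x: "x \<in> L2e r" and C: "\<And>\<tau>. 0 \<le> \<tau> \<Longrightarrow> nrm r (vtrunc \<tau> x) \<le> C"
  shows "x \<in> L2 r"
proof (rule L2I[OF x])
  fix k
  show "finite_energy (x k)"
  proof (cases "k \<in> {1..r}")
    case True
    show ?thesis
    proof (rule finite_energyI_trunc_bounded[where C = "C\<^sup>2"])
      fix \<tau> :: real assume \<tau>: "0 \<le> \<tau>"
      have "signal_inner (trunc \<tau> (x k)) (trunc \<tau> (x k)) \<le> ip r (vtrunc \<tau> x) (vtrunc \<tau> x)"
        unfolding ip_def vtrunc_def using True
        by (intro member_le_sum) (auto simp: signal_inner_nonneg)
      also have "\<dots> = (nrm r (vtrunc \<tau> x))\<^sup>2" by (simp add: nrm_square)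
      also have "\<dots> \<le> C\<^sup>2" by (intro power_mono C \<tau>) simp
      finally show "signal_inner (trunc \<tau> (x k)) (trunc \<tau> (x k)) \<le> C\<^sup>2" .
    qed
  qed (use x in \<open>auto simp: L2e_def\<close>)
qed


section \<open>Bounded operators and adjoints\<close>

lemma linear_on_add: "linear_on X A \<Longrightarrow> u \<in> X \<Longrightarrow> v \<in> X \<Longrightarrow> A (u + v) = A u + A v"
  by (simp add: linear_on_def)

lemma linear_on_scaleR: "linear_on X A \<Longrightarrow> u \<in> X \<Longrightarrow> A (a *\<^sub>R u) = a *\<^sub>R A u"
  by (simp add: linear_on_def)

lemma linear_on_0: "linear_on X A \<Longrightarrow> 0 \<in> X \<Longrightarrow> A 0 = 0"
  using linear_on_scaleR[of X A 0 0] by simp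

lemma linear_on_diff:
  assumes "linear_on X A" "u \<in> X" "v \<in> X" "- v \<in> X" shows "A (u - v) = A u - A v"
  using linear_on_add[OF assms(1,2,4)] linear_on_scaleR[OF assms(1,3), of "-1"] by simp

lemma bounded_L2_closed: "bounded_linear_L2 q r A \<Longrightarrow> u \<in> L2 q \<Longrightarrow> A u \<in> L2 r"
  by (auto simp: bounded_linear_L2_def)

lemma bounded_L2_linear: "bounded_linear_L2 q r A \<Longrightarrow> linear_on (L2 q) A"
  by (simp add: bounded_linear_L2_def)

lemma bounded_L2_add:
  "bounded_linear_L2 q r A \<Longrightarrow> u \<in> L2 q \<Longrightarrow> v \<in> L2 q \<Longrightarrow> A (u + v) = A u + A v"
  by (rule linear_on_add[OF bounded_L2_linear])

lemma bounded_L2_scaleR: "bounded_linear_L2 q r A \<Longrightarrow> u \<in> L2 q \<Longrightarrow> A (a *\<^sub>R u) = a *\<^sub>R A u"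
  by (simp add: bounded_linear_L2_def linear_on_def)

lemma bounded_L2_0: "bounded_linear_L2 q r A \<Longrightarrow> A 0 = 0"
  using bounded_L2_linear linear_on_0 L2_0 by blast

lemma bounded_L2_sum:
  "bounded_linear_L2 q r A \<Longrightarrow> (\<And>i. i \<in> I \<Longrightarrow> u i \<in> L2 q) \<Longrightarrow> A (sum u I) = (\<Sum>i\<in>I. A (u i))"
  by (induction I rule: infinite_finite_induct)
     (auto simp: bounded_L2_0[of q r A] bounded_L2_add[of q r A] L2_sum)

lemma bounded_L2_bound:
  assumes "bounded_linear_L2 q r A"
  obtains c where "c \<ge> 0" "\<And>u. u \<in> L2 q \<Longrightarrow> nrm r (A u) \<le> c * nrm q u"
proof -
  from assms obtain c where c: "\<And>u. u \<in> L2 q \<Longrightarrow> nrm r (A u) \<le> c * nrm q u"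
    by (auto simp: bounded_linear_L2_def)
  show thesis
  proof (rule that[of "max c 0"])
    fix u assume "u \<in> L2 q"
    then have "nrm r (A u) \<le> c * nrm q u" by (rule c)
    also have "\<dots> \<le> max c 0 * nrm q u" by (intro mult_right_mono) auto
    finally show "nrm r (A u) \<le> max c 0 * nrm q u" .
  qed simp
qed

lemma bounded_L2I:
  assumes "\<And>u. u \<in> L2 q \<Longrightarrow> A u \<in> L2 r"
    and "\<And>u v. u \<in> L2 q \<Longrightarrow> v \<in> L2 q \<Longrightarrow> A (u + v) = A u + A v"
    and "\<And>a u. u \<in> L2 q \<Longrightarrow> A (a *\<^sub>R u) = a *\<^sub>R A u"
    and "\<And>u. u \<in> L2 q \<Longrightarrow> nrm r (A u) \<le> c * nrm q u"
  shows "bounded_linear_L2 q r A"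
  unfolding bounded_linear_L2_def linear_on_def Pi_iff
  by (intro conjI exI[of _ c] ballI allI assms)

lemma bounded_L2_cong:
  "bounded_linear_L2 q r A \<Longrightarrow> (\<And>u. u \<in> L2 q \<Longrightarrow> A' u = A u) \<Longrightarrow> bounded_linear_L2 q r A'"
  by (auto simp: bounded_linear_L2_def linear_on_def L2_add L2_scaleR)

lemma bounded_L2_zero: "bounded_linear_L2 q r (\<lambda>_. 0)"
  by (rule bounded_L2I[where c = 0]) auto

lemma bounded_L2_uminus: "bounded_linear_L2 r r (\<lambda>w. - w)"
  by (rule bounded_L2I[where c = 1]) (auto simp: L2_uminus nrm_uminus)

lemma bounded_L2_plus:
  assumes A: "bounded_linear_L2 q r A" and B: "bounded_linear_L2 q r B"
  shows "bounded_linear_L2 q r (\<lambda>u. A u + B u)"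
proof -
  obtain a b where a: "\<And>u. u \<in> L2 q \<Longrightarrow> nrm r (A u) \<le> a * nrm q u"
    and b: "\<And>u. u \<in> L2 q \<Longrightarrow> nrm r (B u) \<le> b * nrm q u"
    using bounded_L2_bound[OF A] bounded_L2_bound[OF B] by metis
  show ?thesis
  proof (rule bounded_L2I[where c = "a + b"])
    fix u assume u: "u \<in> L2 q"
    show "nrm r (A u + B u) \<le> (a + b) * nrm q u"
      using nrm_triangle[OF bounded_L2_closed[OF A u] bounded_L2_closed[OF B u]] a[OF u] b[OF u]
      by (simp add: distrib_right)
  qed (simp_all add: L2_add bounded_L2_closed[OF A] bounded_L2_closed[OF B] scaleR_add_right
      bounded_L2_add[OF A] bounded_L2_scaleR[OF A]
      bounded_L2_add[OF B] bounded_L2_scaleR[OF B] add_ac)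
qed

lemma bounded_L2_scaled:
  assumes A: "bounded_linear_L2 q r A" shows "bounded_linear_L2 q r (\<lambda>u. a *\<^sub>R A u)"
proof -
  obtain c where c: "\<And>u. u \<in> L2 q \<Longrightarrow> nrm r (A u) \<le> c * nrm q u"
    using bounded_L2_bound[OF A] by metis
  show ?thesis
    by (rule bounded_L2I[where c = "\<bar>a\<bar> * c"])
       (simp_all add: bounded_L2_add[OF A] bounded_L2_scaleR[OF A] scaleR_add_right
          nrm_scaleR mult.assoc scaleR_left_commute mult_left_mono L2_scaleR bounded_L2_closed[OF A] c)
qed

lemma bounded_L2_scale_id: "bounded_linear_L2 r r (\<lambda>z. a *\<^sub>R z)"
  by (rule bounded_L2I[where c = "\<bar>a\<bar>"]) (simp_all add: L2_scaleR scaleR_add_right nrm_scaleR)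

lemma bounded_L2_minus:
  assumes A: "bounded_linear_L2 q r A" and B: "bounded_linear_L2 q r B"
  shows "bounded_linear_L2 q r (\<lambda>u. A u - B u)"
  using bounded_L2_plus[OF A bounded_L2_scaled[OF B, of "-1"]] by simp

lemma bounded_L2_sum_op:
  "(\<And>i. i \<in> I \<Longrightarrow> bounded_linear_L2 q r (A i)) \<Longrightarrow> bounded_linear_L2 q r (\<lambda>u. \<Sum>i\<in>I. A i u)"
  by (induction I rule: infinite_finite_induct)
     (auto simp: bounded_L2_zero bounded_L2_plus)

lemma bounded_L2_comp:
  assumes A: "bounded_linear_L2 q r A" and B: "bounded_linear_L2 r s B"
  shows "bounded_linear_L2 q s (\<lambda>u. B (A u))"
proof -
  obtain a b where a: "\<And>u. u \<in> L2 q \<Longrightarrow> nrm r (A u) \<le> a * nrm q u"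
    and b: "b \<ge> 0" "\<And>u. u \<in> L2 r \<Longrightarrow> nrm s (B u) \<le> b * nrm r u"
    using bounded_L2_bound[OF A] bounded_L2_bound[OF B] by metis
  show ?thesis
  proof (rule bounded_L2I[where c = "b * a"])
    fix u assume u: "u \<in> L2 q"
    have "nrm s (B (A u)) \<le> b * nrm r (A u)" by (intro b bounded_L2_closed[OF A u])
    also have "\<dots> \<le> b * (a * nrm q u)" by (intro mult_left_mono a u b)
    finally show "nrm s (B (A u)) \<le> b * a * nrm q u" by (simp add: mult.assoc)
  qed (simp_all add: bounded_L2_closed[OF A] bounded_L2_closed[OF B]
      bounded_L2_add[OF A] bounded_L2_scaleR[OF A]
      bounded_L2_add[OF B] bounded_L2_scaleR[OF B])
qed

lemma stable_system_causal: "stable_system q r A \<Longrightarrow> causal q r A"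
  by (simp add: stable_system_def is_system_def)

lemma causal_closed: "causal q r A \<Longrightarrow> u \<in> L2e q \<Longrightarrow> A u \<in> L2e r"
  by (auto simp: causal_def)

lemma causal_vtrunc: "causal q r A \<Longrightarrow> 0 \<le> \<tau> \<Longrightarrow> u \<in> L2e q \<Longrightarrow> vtrunc \<tau> (A u) = vtrunc \<tau> (A (vtrunc \<tau> u))"
  by (auto simp: causal_def)

lemma stable_system_bound:
  assumes "stable_system q r A"
  obtains c where "c > 0" "\<And>u. u \<in> L2 q \<Longrightarrow> A u \<in> L2 r" "\<And>u. u \<in> L2 q \<Longrightarrow> nrm r (A u) \<le> c * nrm q u"
  using assms by (auto simp: stable_system_def)

lemma linear_on_subset: "linear_on X A \<Longrightarrow> Y \<subseteq> X \<Longrightarrow> linear_on Y A"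
  unfolding linear_on_def by blast

lemma stable_linear_bounded:
  "stable_system q r A \<Longrightarrow> linear_on (L2e q) A \<Longrightarrow> bounded_linear_L2 q r A"
  using linear_on_subset[of "L2e q" A "L2 q"] L2_imp_L2e
  unfolding stable_system_def bounded_linear_L2_def by blast

section \<open>Existence of Hilbert adjoints\<close>

definition single :: "nat \<Rightarrow> signal \<Rightarrow> vsignal" where
  "single k x = (\<lambda>j. if j = k then x else 0)"

text \<open>The scalar theorem is applied to each coordinate functional; a vector is the sum of its
  coordinates embedded by \<open>single\<close>, so additivity of \<phi> puts the representation
  together.\<close>

lemma L2_riesz:
  assumes add: "\<And>x y. x \<in> L2 q \<Longrightarrow> y \<in> L2 q \<Longrightarrow> \<phi> (x + y) = \<phi> x + \<phi> y"
    and scale: "\<And>a x. x \<in> L2 q \<Longrightarrow> \<phi> (a *\<^sub>R x) = a * \<phi> x"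
    and bound: "\<And>x. x \<in> L2 q \<Longrightarrow> \<phi> x \<le> C * nrm q x"
  shows "\<exists>v. v \<in> L2 q \<and> (\<forall>u\<in>L2 q. \<phi> u = ip q u v)"
proof -
  have s: "single k x \<in> L2 q" if "finite_energy x" "k \<in> {1..q}" for k x
    using that by (auto simp: L2_def L2e_def single_def)
  have "\<exists>v. finite_energy v \<and> (\<forall>u. finite_energy u \<longrightarrow> \<phi> (single k u) = signal_inner u v)"
    if k: "k \<in> {1..q}" for k
  proof (rule signal_riesz)
    show "\<phi> (single k (x + y)) = \<phi> (single k x) + \<phi> (single k y)"
      if "finite_energy x" "finite_energy y" for x y
    proof -
      have "single k (x + y) = single k x + single k y" by (auto simp: single_def)
      then show ?thesis using that k by (simp add: add s)
    qed
    show "\<phi> (single k (a *\<^sub>R x)) = a * \<phi> (single k x)" if "finite_energy x" for a x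
    proof -
      have "single k (a *\<^sub>R x) = a *\<^sub>R single k x" by (auto simp: single_def)
      then show ?thesis using that k by (simp add: scale s)
    qed
    show "\<phi> (single k x) \<le> C * sqrt (signal_inner x x)" if x: "finite_energy x" for x
    proof -
      have "ip q (single k x) (single k x) = (\<Sum>j\<in>{1..q}. if j = k then signal_inner x x else 0)"
        unfolding ip_def single_def by (rule sum.cong) auto
      also have "\<dots> = signal_inner x x" using k by simp
      finally show ?thesis using bound[OF s[OF x k]] by (simp add: nrm_def)
    qed
  qed
  then obtain w where w: "\<And>k. k \<in> {1..q} \<Longrightarrow> finite_energy (w k)"
    "\<And>k u. k \<in> {1..q} \<Longrightarrow> finite_energy u \<Longrightarrow> \<phi> (single k u) = signal_inner u (w k)"
    by metis
  \<comment> \<open>Membership in \<open>L2 q\<close> requires the value 0 outside {1..q}, where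
    \<open>w\<close> is unconstrained.\<close>
  define v where "v k = (if k \<in> {1..q} then w k else 0)" for k
  have "v \<in> L2 q" using w by (auto simp: v_def L2_def L2e_def)
  moreover have "\<phi> u = ip q u v" if u: "u \<in> L2 q" for u
  proof -
    have "\<phi> (sum f I) = (\<Sum>i\<in>I. \<phi> (f i))" if "\<And>i. i \<in> I \<Longrightarrow> f i \<in> L2 q" for I and f :: "nat \<Rightarrow> vsignal"
      using that scale[OF L2_0, of 0]
      by (induction I rule: infinite_finite_induct) (auto simp: add L2_sum)
    from this[of "{1..q}" "\<lambda>k. single k (u k)"]
    have "\<phi> (\<Sum>k\<in>{1..q}. single k (u k)) = (\<Sum>k\<in>{1..q}. signal_inner (u k) (w k))"
      using u by (simp add: s w(2) finite_energy_L2)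
    moreover have "(\<Sum>k\<in>{1..q}. single k (u k)) = u"
      using L2_imp_L2e[OF u] by (auto simp: single_def sum_fun_eval L2e_def)
    ultimately show ?thesis by (simp add: ip_def v_def)
  qed
  ultimately show ?thesis by blast
qed

text \<open>Riesz's theorem supplies a vector meeting the description in \<open>adj\<close>, and
  testing with the difference of two such vectors shows uniqueness. Everything later about adjoints
  uses these two facts, never the description itself.\<close>

lemma adj:
  assumes A: "bounded_linear_L2 q r A" and w: "w \<in> L2 r"
  shows adj_closed: "adj q r A w \<in> L2 q"
    and adj_inner: "\<And>u. u \<in> L2 q \<Longrightarrow> ip q u (adj q r A w) = ip r (A u) w"
proof -
  obtain c where c: "\<And>u. u \<in> L2 q \<Longrightarrow> nrm r (A u) \<le> c * nrm q u"
    using bounded_L2_bound[OF A] by metis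
  have "\<exists>v. v \<in> L2 q \<and> (\<forall>u\<in>L2 q. ip r (A u) w = ip q u v)"
  proof (rule L2_riesz[where C = "c * nrm r w"])
    fix u assume u: "u \<in> L2 q"
    have "ip r (A u) w \<le> nrm r (A u) * nrm r w"
      by (intro ip_le_nrm bounded_L2_closed[OF A u] w)
    also have "\<dots> \<le> c * nrm q u * nrm r w" by (intro mult_right_mono c u) simp
    finally show "ip r (A u) w \<le> c * nrm r w * nrm q u" by (simp add: mult_ac)
  qed (simp_all add: bounded_L2_add[OF A] bounded_L2_scaleR[OF A] ip_add_left
      ip_scale_left bounded_L2_closed[OF A] w)
  then obtain v where v: "v \<in> L2 q" "\<And>u. u \<in> L2 q \<Longrightarrow> ip r (A u) w = ip q u v" by blast
  have "adj q r A w = v" unfolding adj_def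
  proof (rule the_equality)
    fix v' assume v': "v' \<in> L2 q \<and> (\<forall>u\<in>L2 q. ip r (A u) w = ip q u v')"
    with v have "ip q (v' - v) (v' - v) = 0"
      using ip_diff_right[of v' q v "v' - v"] by (simp add: L2_diff)
    then show "v' = v" using ip_eq_0[of "v' - v" q] v v' by (simp add: L2_diff)
  qed (use v in auto)
  with v show "adj q r A w \<in> L2 q" "\<And>u. u \<in> L2 q \<Longrightarrow> ip q u (adj q r A w) = ip r (A u) w" by auto
qed

lemma L2_ext:
  assumes "x \<in> L2 r" "y \<in> L2 r" "\<And>u. u \<in> L2 r \<Longrightarrow> ip r u x = ip r u y" shows "x = y"
  using ip_eq_0[of "x - y" r] assms by (simp add: L2_diff ip_diff_right)

text \<open>The bound comes from |A* u|^2 = <A A* u, u> <= c |A* u| |u|, and linearity from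
  nondegeneracy of the inner product.\<close>

lemma adj_bounded_linear:
  assumes A: "bounded_linear_L2 q r A" shows "bounded_linear_L2 r q (adj q r A)"
proof -
  obtain c where c: "c \<ge> 0" "\<And>u. u \<in> L2 q \<Longrightarrow> nrm r (A u) \<le> c * nrm q u"
    using bounded_L2_bound[OF A] by metis
  note [simp] = adj_closed[OF A] adj_inner[OF A] bounded_L2_closed[OF A]
  show ?thesis
  proof (rule bounded_L2I[where c = c])
    fix u v assume "u \<in> L2 r" "v \<in> L2 r"
    then show "adj q r A (u + v) = adj q r A u + adj q r A v"
      by (intro L2_ext[where r = q]) (simp_all add: L2_add ip_add_right)
  next
    fix u a assume "u \<in> L2 r"
    then show "adj q r A (a *\<^sub>R u) = a *\<^sub>R adj q r A u"
      by (intro L2_ext[where r = q]) (simp_all add: L2_scaleR ip_scale_right)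
  next
    fix u assume u: "u \<in> L2 r"
    let ?v = "adj q r A u"
    have "nrm q ?v * nrm q ?v = ip q ?v ?v" by (simp add: nrm_square flip: power2_eq_square)
    also have "\<dots> = ip r (A ?v) u" using u by simp
    also have "\<dots> \<le> nrm r (A ?v) * nrm r u" using u by (intro ip_le_nrm) auto
    also have "\<dots> \<le> c * nrm q ?v * nrm r u" using u by (intro mult_right_mono c) auto
    finally have "nrm q ?v * nrm q ?v \<le> nrm q ?v * (c * nrm r u)" by (simp add: mult_ac)
    then show "nrm q ?v \<le> c * nrm r u"
      by (cases "nrm q ?v = 0") (use c in \<open>auto simp: less_le\<close>)
  qed auto
qed

lemma self_adjoint_inner:
  "bounded_linear_L2 r r A \<Longrightarrow> self_adjoint r A \<Longrightarrow> u \<in> L2 r \<Longrightarrow> w \<in> L2 r \<Longrightarrow> ip r u (A w) = ip r (A u) w"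
  using adj_inner[of r r A w u] by (simp add: self_adjoint_def)

section \<open>Blocks\<close>

lemma blk_L2e [simp]: "blk s d v \<in> L2e d" by (simp add: blk_def L2e_def)

lemma blk_L2: "v \<in> L2 r \<Longrightarrow> blk s d v \<in> L2 d"
  by (rule L2I[OF blk_L2e]) (simp add: blk_def finite_energy_L2)

lemma blk_0 [simp]: "blk s d 0 = 0" by (auto simp: blk_def)

lemma blk_add: "blk s d (x + y) = blk s d x + blk s d y" by (auto simp: blk_def)

lemma blk_diff: "blk s d (x - y) = blk s d x - blk s d y" by (auto simp: blk_def)

lemma blk_scaleR: "blk s d (a *\<^sub>R x) = a *\<^sub>R blk s d x" by (auto simp: blk_def)

lemma blk_sum: "blk s d (sum x I) = (\<Sum>i\<in>I. blk s d (x i))"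
  by (rule ext) (auto simp: blk_def sum_fun_eval)

lemma vtrunc_blk: "vtrunc \<tau> (blk s d x) = blk s d (vtrunc \<tau> x)"
  by (auto simp: blk_def vtrunc_def)

lemma emb_L2e: "s + d \<le> r \<Longrightarrow> emb s d w \<in> L2e r" by (auto simp: emb_def L2e_def)

lemma emb_L2: "s + d \<le> r \<Longrightarrow> w \<in> L2 d \<Longrightarrow> emb s d w \<in> L2 r"
  by (rule L2I[OF emb_L2e]) (simp_all add: emb_def finite_energy_L2)

lemma emb_0 [simp]: "emb s d 0 = 0" by (auto simp: emb_def)

lemma emb_add: "emb s d (x + y) = emb s d x + emb s d y" by (auto simp: emb_def)

lemma emb_diff: "emb s d (x - y) = emb s d x - emb s d y" by (auto simp: emb_def)

lemma emb_scaleR: "emb s d (a *\<^sub>R x) = a *\<^sub>R emb s d x" by (auto simp: emb_def)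

lemma emb_sum: "emb s d (sum x I) = (\<Sum>i\<in>I. emb s d (x i))"
  by (rule ext) (auto simp: emb_def sum_fun_eval)

lemma vtrunc_emb: "vtrunc \<tau> (emb s d x) = emb s d (vtrunc \<tau> x)"
  by (auto simp: emb_def vtrunc_def)

lemma blk_emb_same: "w \<in> L2e d \<Longrightarrow> blk s d (emb s d w) = w"
  by (auto simp: blk_def emb_def L2e_def fun_eq_iff)

lemma blk_emb_disjoint: "s + d \<le> s' \<or> s' + d' \<le> s \<Longrightarrow> blk s d (emb s' d' w) = 0"
  by (auto simp: blk_def emb_def fun_eq_iff)

text \<open>Inclusion and extraction of a coordinate block are adjoint to each other. The norm
  bounds for both maps and the block forms further down come from this identity.\<close>

lemma ip_emb:
  assumes "s + d \<le> r" shows "ip r (emb s d x) v = ip d x (blk s d v)"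
proof -
  have "ip r (emb s d x) v = (\<Sum>k\<in>{s+1..s+d}. signal_inner (x (k - s)) (v k))"
    unfolding ip_def by (rule sum.mono_neutral_cong_right) (use assms in \<open>auto simp: emb_def\<close>)
  also have "\<dots> = (\<Sum>k\<in>{1..d}. signal_inner (x k) (v (s + k)))"
    by (rule sum.reindex_bij_witness[where i = "\<lambda>k. s + k" and j = "\<lambda>k. k - s"]) auto
  finally show ?thesis by (simp add: ip_def blk_def)
qed

lemma ip_emb_right: "s + d \<le> r \<Longrightarrow> ip r v (emb s d x) = ip d (blk s d v) x"
  using ip_emb[of s d r x v] by (simp add: ip_commute)

lemma nrm_emb: "s + d \<le> r \<Longrightarrow> w \<in> L2 d \<Longrightarrow> nrm r (emb s d w) = nrm d w"
  by (simp add: nrm_def ip_emb blk_emb_same L2_imp_L2e)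

lemma nrm_blk_le:
  assumes "s + d \<le> r" "v \<in> L2 r" shows "nrm d (blk s d v) \<le> nrm r v"
proof (cases "nrm d (blk s d v) = 0")
  case False
  have "nrm d (blk s d v) * nrm d (blk s d v) = ip r (emb s d (blk s d v)) v"
    by (simp add: ip_emb[OF assms(1)] nrm_square flip: power2_eq_square)
  also have "\<dots> \<le> nrm r (emb s d (blk s d v)) * nrm r v"
    by (intro ip_le_nrm emb_L2 blk_L2[OF assms(2)] assms)
  also have "\<dots> = nrm d (blk s d v) * nrm r v"
    using blk_L2[OF assms(2)] assms by (simp add: nrm_emb)
  finally show ?thesis using False by (simp add: less_le)
qed simp

lemma bounded_L2_blk: "s + d \<le> r \<Longrightarrow> bounded_linear_L2 r d (blk s d)"
  by (rule bounded_L2I[where c = 1]) (simp_all add: blk_L2 blk_add blk_scaleR nrm_blk_le)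

lemma bounded_L2_emb: "s + d \<le> r \<Longrightarrow> bounded_linear_L2 d r (emb s d)"
  by (rule bounded_L2I[where c = 1]) (simp_all add: emb_L2 emb_add emb_scaleR nrm_emb)

lemma vcat_L2e [simp]: "vcat a b x y \<in> L2e (a + b)"
  unfolding vcat_def by (intro L2e_add emb_L2e) auto

lemma vcat_L2: "x \<in> L2 a \<Longrightarrow> y \<in> L2 b \<Longrightarrow> vcat a b x y \<in> L2 (a + b)"
  unfolding vcat_def by (intro L2_add emb_L2) auto

lemma vcat_0 [simp]: "vcat a b 0 0 = 0" by (simp add: vcat_def)

lemma blk_vcat_left: "x \<in> L2e a \<Longrightarrow> blk 0 a (vcat a b x y) = x"
  unfolding vcat_def by (simp add: blk_add blk_emb_same blk_emb_disjoint)

lemma blk_vcat_right: "y \<in> L2e b \<Longrightarrow> blk a b (vcat a b x y) = y"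
  unfolding vcat_def by (simp add: blk_add blk_emb_same blk_emb_disjoint)

lemma vcat_blk: "v \<in> L2e (a + b) \<Longrightarrow> vcat a b (blk 0 a v) (blk a b v) = v"
  by (auto simp: vcat_def blk_def emb_def L2e_def fun_eq_iff)

lemma vcat_add: "vcat a b (x + x') (y + y') = vcat a b x y + vcat a b x' y'"
  by (simp add: vcat_def emb_add add_ac)

lemma ip_vcat_left:
  "x \<in> L2 a \<Longrightarrow> y \<in> L2 b \<Longrightarrow> v \<in> L2 (a + b) \<Longrightarrow>
   ip (a + b) (vcat a b x y) v = ip a x (blk 0 a v) + ip b y (blk a b v)"
  unfolding vcat_def by (simp add: ip_add_left emb_L2 ip_emb)

lemma ip_vcat:
  "x \<in> L2 a \<Longrightarrow> y \<in> L2 b \<Longrightarrow> x' \<in> L2 a \<Longrightarrow> y' \<in> L2 b \<Longrightarrow>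
   ip (a + b) (vcat a b x y) (vcat a b x' y') = ip a x x' + ip b y y'"
  by (simp add: ip_vcat_left vcat_L2 blk_vcat_left blk_vcat_right L2_imp_L2e)

lemma nrm_vcat_le:
  "x \<in> L2 a \<Longrightarrow> y \<in> L2 b \<Longrightarrow> nrm (a + b) (vcat a b x y) \<le> nrm a x + nrm b y"
  unfolding vcat_def using nrm_triangle[of "emb 0 a x" "a + b" "emb a b y"]
  by (simp add: emb_L2 nrm_emb)

lemma bounded_L2_vcat:
  assumes "bounded_linear_L2 q a A" "bounded_linear_L2 q b B"
  shows "bounded_linear_L2 q (a + b) (\<lambda>v. vcat a b (A v) (B v))"
  unfolding vcat_def
  by (intro bounded_L2_plus bounded_L2_comp[OF assms(1) bounded_L2_emb]
      bounded_L2_comp[OF assms(2) bounded_L2_emb]) auto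

lemma bounded_L2_op22:
  assumes "bounded_linear_L2 q1 r1 A11" "bounded_linear_L2 q2 r1 A12"
    "bounded_linear_L2 q1 r2 A21" "bounded_linear_L2 q2 r2 A22"
  shows "bounded_linear_L2 (q1 + q2) (r1 + r2) (op22 r1 r2 q1 q2 A11 A12 A21 A22)"
proof -
  have b: "bounded_linear_L2 (q1 + q2) q1 (blk 0 q1)" "bounded_linear_L2 (q1 + q2) q2 (blk q1 q2)"
    by (auto intro: bounded_L2_blk)
  show ?thesis unfolding op22_def[abs_def]
    by (intro bounded_L2_vcat bounded_L2_plus bounded_L2_comp[OF b(1)]
        bounded_L2_comp[OF b(2)] assms)
qed

lemma op22_vcat:
  "x \<in> L2e q1 \<Longrightarrow> y \<in> L2e q2 \<Longrightarrow> op22 r1 r2 q1 q2 A11 A12 A21 A22 (vcat q1 q2 x y)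
     = vcat r1 r2 (A11 x + A12 y) (A21 x + A22 y)"
  by (simp add: op22_def blk_vcat_left blk_vcat_right)

text \<open>The adjoint in the lower left corner is moved to the other argument, so only
  \<open>B\<close> has to be evaluated. This serves both the multiplier \<Pi> and the local
  certificates.\<close>

lemma ip_op22_symmetric:
  assumes A: "bounded_linear_L2 a a A" and B: "bounded_linear_L2 b a B" and C: "bounded_linear_L2 b b C"
    and x: "x \<in> L2 a" "x' \<in> L2 a" and y: "y \<in> L2 b" "y' \<in> L2 b"
  shows "ip (a + b) (vcat a b x y) (op22 a b a b A B (adj b a B) C (vcat a b x' y'))
    = ip a x (A x') + ip a x (B y') + ip a (B y) x' + ip b y (C y')"
  using x y bounded_L2_closed[OF A] bounded_L2_closed[OF B] bounded_L2_closed[OF C]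
    adj_closed[OF B] adj_inner[OF B]
  by (simp add: op22_vcat L2_imp_L2e ip_vcat L2_add ip_add_right)

section \<open>Stacked blocks and block-diagonal sums\<close>

lemma sum_offset_max:
  assumes "finite A" "\<And>a. a \<in> A \<Longrightarrow> a < b"
  shows "offset (insert b A) d b = sum d A"
    and "\<And>i. i \<in> A \<Longrightarrow> offset (insert b A) d i = offset A d i"
proof -
  show "offset (insert b A) d b = sum d A"
    unfolding offset_def by (rule sum.cong) (use assms in auto)
  fix i assume "i \<in> A"
  then show "offset (insert b A) d i = offset A d i"
    unfolding offset_def using assms(2)[of i] by (intro sum.cong) auto
qed

text \<open>Induction on the largest index: a new largest block is appended at the end and leaves
  the offsets of the others unchanged, as \<open>sum_offset_max\<close> records.\<close>

lemma sum_blocks: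
  fixes f :: "nat \<Rightarrow> 'a::comm_monoid_add"
  assumes "finite U"
  shows "(\<Sum>a\<in>{1..sum d U}. f a) = (\<Sum>i\<in>U. \<Sum>t\<in>{1..d i}. f (offset U d i + t))"
  using assms
proof (induction U rule: finite_linorder_max_induct)
  case (insert b A)
  have b: "b \<notin> A" using insert by auto
  have "(\<Sum>a\<in>{1..sum d (insert b A)}. f a) = (\<Sum>a\<in>{1..sum d A} \<union> {sum d A + 1..sum d A + d b}. f a)"
    by (rule sum.cong) (use insert b in auto)
  also have "\<dots> = (\<Sum>a\<in>{1..sum d A}. f a) + (\<Sum>a\<in>{sum d A + 1..sum d A + d b}. f a)"
    by (rule sum.union_disjoint) auto
  also have "(\<Sum>a\<in>{sum d A + 1..sum d A + d b}. f a) = (\<Sum>t\<in>{1..d b}. f (sum d A + t))"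
    by (rule sum.reindex_bij_witness[where i = "\<lambda>t. sum d A + t" and j = "\<lambda>a. a - sum d A"]) auto
  also have "(\<Sum>a\<in>{1..sum d A}. f a) = (\<Sum>i\<in>A. \<Sum>t\<in>{1..d i}. f (offset (insert b A) d i + t))"
    using insert.IH sum_offset_max(2)[OF insert.hyps(1), of b _ d] insert.hyps(2) by (auto intro!: sum.cong)
  finally show ?case using insert b sum_offset_max(1)[of A b d] by (simp add: add.commute)
qed simp

text \<open>\<open>sum_blocks\<close> applied to the indicator of r: a nonzero double sum has a
  nonzero term, whose indices are the block and the position.\<close>

lemma block_cover:
  assumes "finite U" "r \<in> {1..sum d U}"
  obtains i t where "i \<in> U" "t \<in> {1..d i}" "r = offset U d i + t"
proof -
  have "(\<Sum>a\<in>{1..sum d U}. if a = r then 1 else 0 :: nat) \<noteq> 0" using assms by simp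
  then have "(\<Sum>i\<in>U. \<Sum>t\<in>{1..d i}. if offset U d i + t = r then 1 else 0 :: nat) \<noteq> 0"
    by (simp only: sum_blocks[OF assms(1)] not_False_eq_True)
  then have "\<exists>i\<in>U. \<exists>t\<in>{1..d i}. r = offset U d i + t"
    by (rule contrapos_np) (force intro!: sum.neutral)
  then show thesis using that by blast
qed

lemma offset_le:
  assumes "finite U" "i \<in> U" shows "offset U d i + d i \<le> sum d U"
proof -
  have "offset U d i + d i = sum d (insert i {h \<in> U. h < i})"
    unfolding offset_def using assms by (subst sum.insert) auto
  also have "\<dots> \<le> sum d U" using assms by (intro sum_mono2) auto
  finally show ?thesis .
qed

lemma offset_less:
  assumes "finite U" "i \<in> U" "i < j" shows "offset U d i + d i \<le> offset U d j"
proof -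
  have "offset U d i + d i = sum d (insert i {h \<in> U. h < i})"
    unfolding offset_def using assms by (subst sum.insert) auto
  also have "\<dots> \<le> offset U d j" unfolding offset_def using assms by (intro sum_mono2) auto
  finally show ?thesis .
qed

lemma offset_disjoint:
  assumes "finite U" "i \<in> U" "j \<in> U" "i \<noteq> j"
  shows "offset U d i + d i \<le> offset U d j \<or> offset U d j + d j \<le> offset U d i"
  using offset_less[of U i j d] offset_less[of U j i d] assms by (meson nat_neq_iff)

lemma offset_inject:
  assumes "finite U" "i \<in> U" "j \<in> U" "s \<in> {1..d i}" "t \<in> {1..d j}" "offset U d i + s = offset U d j + t"
  shows "i = j \<and> s = t"
proof -
  have "i = j"
  proof (rule ccontr)
    assume "i \<noteq> j"
    with offset_disjoint[OF assms(1-3), of d] assms(4-) show False by auto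
  qed
  with assms(6) show ?thesis by simp
qed

text \<open>Vectors described by their blocks. Each value of \<open>dsum\<close> is a
  \<open>stack\<close>, so block-diagonal operators, inner products and the edge operators can all
  be computed block by block.\<close>

definition stack :: "nat set \<Rightarrow> (nat \<Rightarrow> nat) \<Rightarrow> (nat \<Rightarrow> vsignal) \<Rightarrow> vsignal" where
  "stack U d f = (\<Sum>i\<in>U. emb (offset U d i) (d i) (f i))"

lemma dsum_eq_stack: "dsum U a b A v = stack U b (\<lambda>i. A i (blk (offset U a i) (a i) v))"
  by (simp add: dsum_def stack_def)

lemma stack_sum: "(\<Sum>k\<in>I. stack U d (f k)) = stack U d (\<lambda>i. \<Sum>k\<in>I. f k i)"
  unfolding stack_def emb_sum by (rule sum.swap)

lemma stack_scaleR: "a *\<^sub>R stack U d f = stack U d (\<lambda>i. a *\<^sub>R f i)"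
  by (simp add: stack_def emb_scaleR scaleR_sum_right)

lemma stack_add: "stack U d f + stack U d f' = stack U d (\<lambda>i. f i + f' i)"
  by (simp add: stack_def emb_add sum.distrib)

lemma stack_cong: "(\<And>i. i \<in> U \<Longrightarrow> f i = f' i) \<Longrightarrow> stack U d f = stack U d f'"
  by (simp add: stack_def)

context
  fixes U :: "nat set" assumes U: "finite U"
begin

lemma stack_L2e: "stack U d f \<in> L2e (sum d U)"
  unfolding stack_def by (intro L2e_sum emb_L2e offset_le U)

lemma stack_L2: "(\<And>i. i \<in> U \<Longrightarrow> f i \<in> L2 (d i)) \<Longrightarrow> stack U d f \<in> L2 (sum d U)"
  unfolding stack_def by (intro L2_sum emb_L2 offset_le U)

lemma blk_stack:
  assumes "i \<in> U" "f i \<in> L2e (d i)" shows "blk (offset U d i) (d i) (stack U d f) = f i"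
proof -
  have "blk (offset U d i) (d i) (stack U d f)
      = (\<Sum>j\<in>U. blk (offset U d i) (d i) (emb (offset U d j) (d j) (f j)))"
    unfolding stack_def by (rule blk_sum)
  also have "\<dots> = (\<Sum>j\<in>U. if j = i then f i else 0)"
    by (rule sum.cong) (use assms in \<open>auto simp: blk_emb_same blk_emb_disjoint offset_disjoint[OF U]\<close>)
  finally show ?thesis using assms U by simp
qed

lemma stack_eval:
  assumes "i \<in> U" "t \<in> {1..d i}" shows "stack U d f (offset U d i + t) = f i t"
proof -
  have "stack U d f (offset U d i + t) = (\<Sum>j\<in>U. emb (offset U d j) (d j) (f j) (offset U d i + t))"
    unfolding stack_def by (rule sum_fun_eval)
  also have "\<dots> = (\<Sum>j\<in>U. if j = i then f i t else 0)"
  proof (rule sum.cong)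
    fix j assume "j \<in> U"
    with assms offset_disjoint[OF U, of i j d]
    show "emb (offset U d j) (d j) (f j) (offset U d i + t) = (if j = i then f i t else 0)"
      by (auto simp: emb_def)
  qed simp
  finally show ?thesis using assms U by simp
qed

lemma L2e_ext_blocks:
  assumes "v \<in> L2e (sum d U)" "w \<in> L2e (sum d U)"
    and "\<And>i t. i \<in> U \<Longrightarrow> t \<in> {1..d i} \<Longrightarrow> v (offset U d i + t) = w (offset U d i + t)"
  shows "v = w"
proof
  fix r show "v r = w r"
  proof (cases "r \<in> {1..sum d U}")
    case True
    then show ?thesis using assms(3) block_cover[OF U] by metis
  qed (use assms in \<open>auto simp: L2e_def\<close>)
qed

lemma stack_blk: "v \<in> L2e (sum d U) \<Longrightarrow> stack U d (\<lambda>i. blk (offset U d i) (d i) v) = v"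
  by (rule L2e_ext_blocks[OF stack_L2e]) (simp_all add: stack_eval blk_def)

lemma L2e_ext_blk:
  assumes "v \<in> L2e (sum d U)" "w \<in> L2e (sum d U)"
    and "\<And>i. i \<in> U \<Longrightarrow> blk (offset U d i) (d i) v = blk (offset U d i) (d i) w"
  shows "v = w"
  using stack_blk[OF assms(1)] stack_blk[OF assms(2)] assms(3) unfolding stack_def
  by (metis (no_types, lifting) sum.cong)

lemma blk_dsum:
  "i \<in> U \<Longrightarrow> A i (blk (offset U a i) (a i) v) \<in> L2e (b i) \<Longrightarrow>
   blk (offset U b i) (b i) (dsum U a b A v) = A i (blk (offset U a i) (a i) v)"
  unfolding dsum_eq_stack by (rule blk_stack)

lemma dsum_stack:
  "(\<And>i. i \<in> U \<Longrightarrow> f i \<in> L2e (a i)) \<Longrightarrow> dsum U a b A (stack U a f) = stack U b (\<lambda>i. A i (f i))"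
  unfolding dsum_eq_stack by (auto simp: stack_def[of U b] blk_stack intro!: sum.cong)

lemma dsum_L2e: "dsum U a b A v \<in> L2e (sum b U)"
  unfolding dsum_eq_stack by (rule stack_L2e)

lemma ip_stack:
  assumes "\<And>i. i \<in> U \<Longrightarrow> f i \<in> L2 (d i)" "v \<in> L2 (sum d U)"
  shows "ip (sum d U) (stack U d f) v = (\<Sum>i\<in>U. ip (d i) (f i) (blk (offset U d i) (d i) v))"
  unfolding stack_def using assms
  by (simp add: ip_sum_left emb_L2 offset_le[OF U] ip_emb)

lemma ip_stack_stack:
  assumes "\<And>i. i \<in> U \<Longrightarrow> f i \<in> L2 (d i)" "\<And>i. i \<in> U \<Longrightarrow> h i \<in> L2 (d i)"
  shows "ip (sum d U) (stack U d f) (stack U d h) = (\<Sum>i\<in>U. ip (d i) (f i) (h i))"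
  using assms by (simp add: ip_stack stack_L2 blk_stack L2_imp_L2e)

lemma ip_blocks:
  assumes "v \<in> L2 (sum d U)" "w \<in> L2 (sum d U)"
  shows "ip (sum d U) v w
    = (\<Sum>i\<in>U. ip (d i) (blk (offset U d i) (d i) v) (blk (offset U d i) (d i) w))"
  using ip_stack[of "\<lambda>i. blk (offset U d i) (d i) v" d w] assms
  by (simp add: stack_blk L2_imp_L2e blk_L2[of _ "sum d U"])

lemma bounded_L2_dsum:
  assumes A: "\<And>i. i \<in> U \<Longrightarrow> bounded_linear_L2 (a i) (b i) (A i)"
  shows "bounded_linear_L2 (sum a U) (sum b U) (dsum U a b A)"
  unfolding dsum_def[abs_def]
proof (rule bounded_L2_sum_op)
  fix i assume i: "i \<in> U"
  show "bounded_linear_L2 (sum a U) (sum b U)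
      (\<lambda>v. emb (offset U b i) (b i) (A i (blk (offset U a i) (a i) v)))"
    by (rule bounded_L2_comp[OF bounded_L2_comp[OF bounded_L2_blk A[OF i]]
          bounded_L2_emb]) (use i in \<open>auto intro: offset_le[OF U]\<close>)
qed

lemma L2I_blocks:
  assumes "v \<in> L2e (sum d U)" "\<And>i. i \<in> U \<Longrightarrow> blk (offset U d i) (d i) v \<in> L2 (d i)"
  shows "v \<in> L2 (sum d U)"
  using stack_L2[of "\<lambda>i. blk (offset U d i) (d i) v" d] assms by (simp add: stack_blk)

lemma causal_dsum:
  assumes "\<And>i. i \<in> U \<Longrightarrow> causal (a i) (b i) (A i)"
  shows "causal (sum a U) (sum b U) (dsum U a b A)"
  unfolding causal_def
proof (intro conjI allI impI ballI Pi_I dsum_L2e)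
  fix \<tau> :: real and u assume \<tau>: "0 \<le> \<tau>"
  have "vtrunc \<tau> (dsum U a b A u)
      = (\<Sum>i\<in>U. emb (offset U b i) (b i) (vtrunc \<tau> (A i (blk (offset U a i) (a i) u))))" for u
    by (simp add: dsum_def vtrunc_sum vtrunc_emb)
  then show "vtrunc \<tau> (dsum U a b A u) = vtrunc \<tau> (dsum U a b A (vtrunc \<tau> u))"
    by (simp add: causal_vtrunc[OF assms \<tau> blk_L2e, symmetric] vtrunc_blk[symmetric] cong: sum.cong)
qed

end

section \<open>Operators given by matrices\<close>

lemma mat_op_L2e [simp]: "mat_op r q A v \<in> L2e r" by (simp add: mat_op_def L2e_def)

lemma mat_op_0 [simp]: "mat_op r q A 0 = 0" by (auto simp: mat_op_def)

lemma mat_op_add: "mat_op r q A (x + y) = mat_op r q A x + mat_op r q A y"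
  by (auto simp: mat_op_def scaleR_add_right sum.distrib)

lemma mat_op_scaleR: "mat_op r q A (a *\<^sub>R x) = a *\<^sub>R mat_op r q A x"
  by (auto simp: mat_op_def scaleR_sum_right mult.commute)

lemma mat_op_diff: "mat_op r q A (x - y) = mat_op r q A x - mat_op r q A y"
  using mat_op_add[of r q A x "(-1) *\<^sub>R y"] mat_op_scaleR[of r q A "-1" y] by simp

lemma mat_op_sum: "mat_op r q A (sum x I) = (\<Sum>i\<in>I. mat_op r q A (x i))"
  by (induction I rule: infinite_finite_induct)
     (simp_all only: sum.infinite sum.empty sum.insert mat_op_0 mat_op_add not_False_eq_True)

lemma vtrunc_mat_op: "vtrunc \<tau> (mat_op r q A x) = mat_op r q A (vtrunc \<tau> x)"
  by (auto simp: mat_op_def vtrunc_def trunc_sum trunc_scaleR)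

text \<open>The matrix is the sum of its entries, each a scaled composition of reading one component
  and writing one. Components are numbered from 1 while \<open>blk\<close> and \<open>emb\<close>
  take the number of preceding components, whence a - 1 and b - 1.\<close>

lemma bounded_L2_mat_op: "bounded_linear_L2 q r (mat_op r q A)"
proof -
  have "bounded_linear_L2 q r (\<lambda>v. \<Sum>a\<in>{1..r}. \<Sum>b\<in>{1..q}. A a b *\<^sub>R emb (a - 1) 1 (blk (b - 1) 1 v))"
    by (intro bounded_L2_sum_op bounded_L2_scaled
        bounded_L2_comp[OF bounded_L2_blk bounded_L2_emb]) auto
  moreover have "mat_op r q A v = (\<Sum>a\<in>{1..r}. \<Sum>b\<in>{1..q}. A a b *\<^sub>R emb (a - 1) 1 (blk (b - 1) 1 v))" for v
  proof
    fix k
    have "(\<Sum>a\<in>{1..r}. \<Sum>b\<in>{1..q}. A a b *\<^sub>R emb (a - 1) 1 (blk (b - 1) 1 v)) k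
        = (\<Sum>a\<in>{1..r}. \<Sum>b\<in>{1..q}. A a b *\<^sub>R emb (a - 1) 1 (blk (b - 1) 1 v) k)"
      by (simp add: sum_fun_eval)
    also have "\<dots> = (\<Sum>a\<in>{1..r}. if a = k then (\<Sum>b\<in>{1..q}. A a b *\<^sub>R v b) else 0)"
      by (intro sum.cong refl) (auto simp: emb_def blk_def intro!: sum.cong sum.neutral)
    also have "\<dots> = mat_op r q A v k" by (simp add: mat_op_def)
    finally show "mat_op r q A v k = (\<Sum>a\<in>{1..r}. \<Sum>b\<in>{1..q}. A a b *\<^sub>R emb (a - 1) 1 (blk (b - 1) 1 v)) k" ..
  qed
  ultimately show ?thesis by (rule bounded_L2_cong)
qed

text \<open>Self-adjointness of \<open>F\<close> turns the lower left term <y, F x'> into <F y, x'>,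
  which involves the upper right block only. In this shape it matches
  \<open>ip_op22_symmetric\<close>, where the lower left block is an adjoint by definition.\<close>

lemma ip_vcat_block_form:
  assumes F: "bounded_linear_L2 (a + b) (a + b) F" and sa: "self_adjoint (a + b) F"
    and x: "x \<in> L2 a" "x' \<in> L2 a" and y: "y \<in> L2 b" "y' \<in> L2 b"
  shows "ip (a + b) (vcat a b x y) (F (vcat a b x' y'))
    = ip a x (cut 0 a 0 a F x') + ip a x (cut a b 0 a F y')
      + ip a (cut a b 0 a F y) x' + ip b y (cut a b a b F y')"
proof -
  let ?E = "emb 0 a" and ?E' = "emb a b"
  have E: "?E x \<in> L2 (a + b)" "?E x' \<in> L2 (a + b)" "?E' y \<in> L2 (a + b)" "?E' y' \<in> L2 (a + b)"
    using x y by (auto intro: emb_L2)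
  note FE = E[THEN bounded_L2_closed[OF F]]
  have "F (vcat a b x' y') = F (?E x') + F (?E' y')"
    unfolding vcat_def by (rule bounded_L2_add[OF F E(2,4)])
  then have "ip (a + b) (vcat a b x y) (F (vcat a b x' y'))
     = ip (a + b) (?E x) (F (?E x')) + ip (a + b) (?E x) (F (?E' y'))
       + ip (a + b) (?E' y) (F (?E x')) + ip (a + b) (?E' y) (F (?E' y'))"
    unfolding vcat_def using E FE by (simp add: ip_add_left ip_add_right L2_add)
  also have "ip (a + b) (?E' y) (F (?E x')) = ip (a + b) (F (?E' y)) (?E x')"
    by (rule self_adjoint_inner[OF F sa E(3,2)])
  finally show ?thesis by (simp add: cut_def ip_emb ip_emb_right)
qed

lemma bounded_L2_cut:
  assumes "bounded_linear_L2 q r A" "s + d \<le> q" "s' + d' \<le> r"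
  shows "bounded_linear_L2 d d' (cut s d s' d' A)"
  unfolding cut_def[abs_def]
  by (rule bounded_L2_comp[OF bounded_L2_comp[OF bounded_L2_emb assms(1)]
        bounded_L2_blk]) (use assms in auto)

lemma bounded_L2_ones_op: "bounded_linear_L2 1 d (ones_op d)"
  unfolding ones_op_def by (rule bounded_L2_mat_op)

section \<open>Arcs, the routing matrix and the edge matrix\<close>

locale network =
  fixes g :: graph and B :: "nat \<Rightarrow> nat \<Rightarrow> real"
  assumes graph: "network_graph g" and B: "is_B_mat g B"
begin

definition M :: nat where "M = 2 * size_m g"

abbreviation "V \<equiv> verts g"
abbreviation "dg \<equiv> deg g"
abbreviation "st \<equiv> start g"

lemma finite_verts [simp]: "finite V" by (simp add: verts_def)

lemma finite_nbrs [simp]: "finite (nbrs g i)" by (simp add: nbrs_def)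

lemma edgeE:
  assumes "e \<in> edges g"
  obtains i j where "i \<in> V" "j \<in> V" "i \<noteq> j" "e = {i, j}"
  using graph assms by (auto simp: network_graph_def)

lemma finite_edges [simp]: "finite (edges g)"
proof (rule finite_subset)
  show "edges g \<subseteq> Pow V" using edgeE by (metis Pow_iff empty_subsetI insert_subset subsetI)
qed simp

lemma nbrsD:
  assumes "j \<in> nbrs g i"
  shows "{i, j} \<in> edges g" "i \<in> V" "j \<in> V" "i \<noteq> j" "i \<in> nbrs g j"
proof -
  have e: "{i, j} \<in> edges g" "j \<in> V" using assms by (auto simp: nbrs_def)
  from edgeE[OF this(1)] obtain a b where ab: "a \<in> V" "b \<in> V" "a \<noteq> b" "{i, j} = {a, b}" by metis
  then show "i \<in> V" "i \<noteq> j" by (auto simp: doubleton_eq_iff)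
  with e show "i \<in> nbrs g j" by (simp add: nbrs_def insert_commute)
qed (use assms in \<open>auto simp: nbrs_def\<close>)

text \<open>Arcs, that is ordered pairs of adjacent vertices, are counted once by their tails and
  once by their edges; each edge carries two of them.\<close>

lemma handshake: "sum dg V = M"
proof -
  let ?A = "SIGMA i:V. nbrs g i"
  have "sum dg V = card ?A" by (simp add: deg_def)
  also have "?A = (\<Union>e\<in>edges g. {(i, j). {i, j} = e})"
  proof (intro set_eqI iffI)
    fix x assume "x \<in> (\<Union>e\<in>edges g. {(i, j). {i, j} = e})"
    then obtain i j where x: "x = (i, j)" "{i, j} \<in> edges g" by auto
    from edgeE[OF this(2)] obtain a b where "a \<in> V" "b \<in> V" "a \<noteq> b" "{i, j} = {a, b}" by metis
    with x show "x \<in> ?A" by (auto simp: nbrs_def doubleton_eq_iff insert_commute)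
  qed (auto simp: nbrs_def)
  also have "card \<dots> = (\<Sum>e\<in>edges g. card {(i, j). {i, j} = e})"
  proof (rule card_UN_disjoint)
    show "\<forall>e\<in>edges g. finite {(i, j). {i, j} = e}"
    proof
      fix e assume e: "e \<in> edges g"
      have "e \<subseteq> V" using edgeE[OF e] by (metis empty_subsetI insert_subset)
      then show "finite {(i, j). {i, j} = e}"
        by (rule_tac finite_subset[of _ "V \<times> V"]) auto
    qed
  qed auto
  also have "\<dots> = (\<Sum>e\<in>edges g. 2)"
  proof (rule sum.cong)
    fix e assume "e \<in> edges g"
    then obtain a b where "a \<noteq> b" "e = {a, b}" using edgeE by metis
    then have "{(i, j). {i, j} = e} = {(a, b), (b, a)}" by (auto simp: doubleton_eq_iff)
    with \<open>a \<noteq> b\<close> show "card {(i, j). {i, j} = e} = 2" by simp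
  qed simp
  finally show ?thesis by (simp add: size_m_def M_def)
qed

section \<open>Arcs as components and the routing matrix\<close>

lemma nidx_bij: "i \<in> V \<Longrightarrow> bij_betw (nidx g i) (nbrs g i) {1..dg i}"
  using graph by (simp add: network_graph_def)

lemma eidx_bij: "bij_betw (eidx g) (edges g) {1..size_m g}"
  using graph by (simp add: network_graph_def)

text \<open>Component \<open>st i + t\<close> stands for the arc from i to \<open>nb i t\<close>; P
  and B are evaluated in these coordinates.\<close>

definition nb :: "nat \<Rightarrow> nat \<Rightarrow> nat" where
  "nb i t = inv_into (nbrs g i) (nidx g i) t"

lemma nidx_range: "j \<in> nbrs g i \<Longrightarrow> nidx g i j \<in> {1..dg i}"
  using nidx_bij[of i] nbrsD(2) by (auto simp: bij_betw_def)

lemma nb_nbrs: "i \<in> V \<Longrightarrow> t \<in> {1..dg i} \<Longrightarrow> nb i t \<in> nbrs g i"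
  unfolding nb_def using nidx_bij[of i] by (metis bij_betw_def inv_into_into)

lemma nidx_nb: "i \<in> V \<Longrightarrow> t \<in> {1..dg i} \<Longrightarrow> nidx g i (nb i t) = t"
  unfolding nb_def using nidx_bij[of i] by (metis bij_betw_def f_inv_into_f)

lemma nb_nidx: "j \<in> nbrs g i \<Longrightarrow> nb i (nidx g i j) = j"
  unfolding nb_def using nidx_bij[of i] nbrsD(2) by (metis bij_betw_def inv_into_f_f)

lemma start_inject:
  "i \<in> V \<Longrightarrow> j \<in> V \<Longrightarrow> s \<in> {1..dg i} \<Longrightarrow> t \<in> {1..dg j} \<Longrightarrow> st i + s = st j + t \<Longrightarrow> i = j \<and> s = t"
  unfolding start_def by (rule offset_inject[OF finite_verts])

lemma start_le: "i \<in> V \<Longrightarrow> st i + dg i \<le> M"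
  using offset_le[OF finite_verts, of i dg] by (simp add: start_def handshake)

lemma P_op_eq: "P_op g = mat_op M M (P_mat g)"
  by (simp add: P_op_def M_def)

text \<open>Row \<open>st i + t\<close> of P has a single 1, at the reversed arc; injectivity of the
  arc numbering rules out other witnesses in \<open>P_mat\<close>.\<close>

lemma P_op_eval:
  assumes i: "i \<in> V" and t: "t \<in> {1..dg i}"
  shows "P_op g v (st i + t) = v (st (nb i t) + nidx g (nb i t) i)"
proof -
  let ?q = "st (nb i t) + nidx g (nb i t) i"
  have nb: "nb i t \<in> nbrs g i" using i t by (rule nb_nbrs)
  then have r: "nidx g (nb i t) i \<in> {1..dg (nb i t)}" by (rule nidx_range[OF nbrsD(5)])
  have q: "?q \<in> {1..M}" using r start_le[of "nb i t"] nbrsD(3)[OF nb] by auto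
  have P: "P_mat g (st i + t) q = (if q = ?q then 1 else 0)" for q
  proof -
    have "(\<exists>i'\<in>V. \<exists>k\<in>{1..dg i'}. st i + t = st i' + k \<and>
       (let j = inv_into (nbrs g i') (nidx g i') k in q = st j + nidx g j i')) \<longleftrightarrow> q = ?q"
      unfolding nb_def[symmetric] Let_def
    proof
      assume "\<exists>i'\<in>V. \<exists>k\<in>{1..dg i'}. st i + t = st i' + k \<and> q = st (nb i' k) + nidx g (nb i' k) i'"
      then obtain i' k where "i' \<in> V" "k \<in> {1..dg i'}" "st i + t = st i' + k"
        "q = st (nb i' k) + nidx g (nb i' k) i'" by blast
      with start_inject[OF i \<open>i' \<in> V\<close> t] show "q = ?q" by simp
    qed (use i t in blast)
    then show ?thesis by (simp add: P_mat_def)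
  qed
  have "st i + t \<in> {1..M}" using i t start_le[OF i] by auto
  then have "P_op g v (st i + t) = (\<Sum>b\<in>{1..M}. P_mat g (st i + t) b *\<^sub>R v b)"
    by (simp add: P_op_eq mat_op_def)
  also have "\<dots> = (\<Sum>b\<in>{1..M}. if b = ?q then v b else 0)"
    by (intro sum.cong refl) (simp add: P)
  also have "\<dots> = v ?q" using q by simp
  finally show ?thesis .
qed

lemma P_op_L2e [simp]: "P_op g v \<in> L2e M" by (simp add: P_op_eq)

lemma M_ext:
  "v \<in> L2e M \<Longrightarrow> w \<in> L2e M \<Longrightarrow> (\<And>i t. i \<in> V \<Longrightarrow> t \<in> {1..dg i} \<Longrightarrow> v (st i + t) = w (st i + t)) \<Longrightarrow> v = w"
  using L2e_ext_blocks[OF finite_verts, of v dg w] by (simp add: handshake start_def)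

text \<open>Reversing an arc twice restores it. This is what allows u to be eliminated from y = P u
  + d in the loop equations.\<close>

lemma P_op_involution: "v \<in> L2e M \<Longrightarrow> P_op g (P_op g v) = v"
proof (rule M_ext)
  fix i t assume it: "i \<in> V" "t \<in> {1..dg i}"
  let ?j = "nb i t"
  have nb: "?j \<in> nbrs g i" using it by (rule nb_nbrs)
  then have j: "?j \<in> V" "nidx g ?j i \<in> {1..dg ?j}" "nb ?j (nidx g ?j i) = i"
    by (rule nbrsD(3), rule nidx_range[OF nbrsD(5)], rule nb_nidx[OF nbrsD(5)])
  show "P_op g (P_op g v) (st i + t) = v (st i + t)"
    using it by (simp only: P_op_eval[OF it] P_op_eval[OF j(1,2)] j(3) nidx_nb)
qed auto

text \<open>The first step of a path to another vertex leads to a neighbour. It ensures that every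
  vertex lies in some part of the partition and, later, that the output of \<open>N i\<close> can be
  read off from its copies.\<close>

lemma deg_pos: assumes "i \<in> V" shows "1 \<le> dg i"
proof -
  have "\<exists>u\<in>V. u \<noteq> i"
  proof (cases "i = 1")
    case True then show ?thesis using graph by (intro bexI[of _ 2]) (auto simp: network_graph_def verts_def)
  next
    case False then show ?thesis using graph by (intro bexI[of _ 1]) (auto simp: network_graph_def verts_def)
  qed
  then obtain u where u: "u \<in> V" "u \<noteq> i" by blast
  then have "(i, u) \<in> {(a, b). a \<in> V \<and> b \<in> V \<and> {a, b} \<in> edges g}\<^sup>*"
    using graph assms by (auto simp: network_graph_def connected_graph_def)
  then obtain b where "b \<in> nbrs g i"
    by (cases rule: converse_rtranclE) (use u in \<open>auto simp: nbrs_def\<close>)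
  then have "0 < card (nbrs g i)" by (auto simp: card_gt_0_iff)
  then show ?thesis by (simp add: deg_def)
qed

section \<open>Edges and the columns of the edge matrix\<close>

lemma link_edge_eidx: "e \<in> edges g \<Longrightarrow> link_edge g (eidx g e) = e"
  unfolding link_edge_def using eidx_bij by (metis bij_betw_def inv_into_f_f)

lemma link_edge_edges: "k \<in> {1..size_m g} \<Longrightarrow> link_edge g k \<in> edges g"
  unfolding link_edge_def using eidx_bij by (metis bij_betw_def inv_into_into)

lemma eidx_link_edge: "k \<in> {1..size_m g} \<Longrightarrow> eidx g (link_edge g k) = k"
  unfolding link_edge_def using eidx_bij by (metis bij_betw_def f_inv_into_f)

lemma eidx_range: "e \<in> edges g \<Longrightarrow> eidx g e \<in> {1..size_m g}"
  using eidx_bij by (auto simp: bij_betw_def)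

text \<open>\<open>is_B_mat\<close> leaves the sign of a column open. The order of i and j records
  the choice: i is the end with entry 1, j the end with entry -1.\<close>

definition edge_ends :: "nat \<Rightarrow> nat \<Rightarrow> nat \<Rightarrow> bool" where
  "edge_ends k i j \<longleftrightarrow> j \<in> nbrs g i \<and> link_edge g k = {i, j} \<and>
     (\<forall>h\<in>V. \<forall>t\<in>{1..dg h}. B (st h + t) k =
       (if h = i \<and> t = nidx g i j then 1 else if h = j \<and> t = nidx g j i then - 1 else 0))"

lemma edge_endsD:
  assumes "edge_ends k i j"
  shows "j \<in> nbrs g i" "link_edge g k = {i, j}"
    "\<And>h t. h \<in> V \<Longrightarrow> t \<in> {1..dg h} \<Longrightarrow> B (st h + t) k =
       (if h = i \<and> t = nidx g i j then 1 else if h = j \<and> t = nidx g j i then - 1 else 0)"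
  using assms unfolding edge_ends_def by (blast, blast, blast)

lemma edge_ends_exist:
  assumes k: "k \<in> {1..size_m g}" shows "\<exists>i j. edge_ends k i j"
proof -
  from B k have "\<exists>i j. {i, j} = link_edge g k \<and>
     (let r = st i + nidx g i j; r' = st j + nidx g j i in
        B r k = 1 \<and> B r' k = - 1 \<and> (\<forall>a. a \<noteq> r \<and> a \<noteq> r' \<longrightarrow> B a k = 0))"
    unfolding is_B_mat_def by (rule bspec)
  then obtain i j where ij: "{i, j} = link_edge g k"
    and Bk: "B (st i + nidx g i j) k = 1" "B (st j + nidx g j i) k = - 1"
      "\<And>a. a \<noteq> st i + nidx g i j \<Longrightarrow> a \<noteq> st j + nidx g j i \<Longrightarrow> B a k = 0"
    unfolding Let_def by (elim exE conjE) simp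
  \<comment> \<open>\<open>is_B_mat\<close> does not itself say that i and j are distinct vertices;
    this comes from the edge being one of a simple graph.\<close>
  obtain a b where "a \<in> V" "b \<in> V" "a \<noteq> b" "link_edge g k = {a, b}"
    using edgeE[OF link_edge_edges[OF k]] by metis
  then have nb: "j \<in> nbrs g i" using ij link_edge_edges[OF k] by (auto simp: nbrs_def doubleton_eq_iff insert_commute)
  note V = nbrsD[OF nb] and r = nidx_range[OF nb] nidx_range[OF nbrsD(5)[OF nb]]
  have "B (st h + t) k =
       (if h = i \<and> t = nidx g i j then 1 else if h = j \<and> t = nidx g j i then - 1 else 0)"
    if ht: "h \<in> V" "t \<in> {1..dg h}" for h t
  proof -
    consider "h = i" "t = nidx g i j" | "h = j" "t = nidx g j i"
      | "st h + t \<noteq> st i + nidx g i j" "st h + t \<noteq> st j + nidx g j i"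
      using start_inject[OF ht(1) V(2) ht(2) r(1)] start_inject[OF ht(1) V(3) ht(2) r(2)] by blast
    then show ?thesis
    proof cases
      case 3
      then have "B (st h + t) k = 0" by (rule Bk)
      with 3 show ?thesis by auto
    qed (use Bk V(4) in auto)
  qed
  then have "edge_ends k i j" unfolding edge_ends_def using nb ij by blast
  then show ?thesis by blast
qed

text \<open>A row of B is an arc, and an arc lies on one edge. Distinct columns therefore have
  disjoint supports.\<close>

lemma B_nonzeroD:
  assumes "k \<in> {1..size_m g}" "i \<in> V" "t \<in> {1..dg i}" "B (st i + t) k \<noteq> 0"
  shows "k = eidx g {i, nb i t}"
proof -
  obtain a b where "edge_ends k a b" using edge_ends_exist[OF assms(1)] by blast
  note ab = edge_endsD[OF this]
  have "{i, nb i t} = link_edge g k"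
    using assms(4) ab(2) ab(3)[OF assms(2,3)] nb_nidx[OF ab(1)] nb_nidx[OF nbrsD(5)[OF ab(1)]] by (auto split: if_splits)
  then show ?thesis using eidx_link_edge[OF assms(1)] by simp
qed

text \<open>Column k has its two nonzero entries in the blocks of its ends, so every vertex set
  containing them gives the same value. The comparison of subgraph operators with global ones rests
  on this.\<close>

lemma sum_B_column:
  fixes f :: "nat \<Rightarrow> nat \<Rightarrow> 'a::real_vector"
  assumes ends: "edge_ends k i j"
    and U: "U \<subseteq> V" "i \<in> U" "j \<in> U"
  shows "(\<Sum>h\<in>U. \<Sum>t\<in>{1..dg h}. B (st h + t) k *\<^sub>R f h t) = f i (nidx g i j) - f j (nidx g j i)"
proof -
  have fin: "finite U" by (rule finite_subset[OF U(1)]) simp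
  note col = edge_endsD(3)[OF ends] and nij = edge_endsD(1)[OF ends]
  note nb = nbrsD[OF nij]
  have "(\<Sum>h\<in>U. \<Sum>t\<in>{1..dg h}. B (st h + t) k *\<^sub>R f h t)
      = (\<Sum>h\<in>U. \<Sum>t\<in>{1..dg h}. (if t = nidx g i j then if h = i then f h t else 0 else 0)
          - (if t = nidx g j i then if h = j then f h t else 0 else 0))"
  proof (intro sum.cong refl)
    fix h t assume "h \<in> U" and t: "t \<in> {1..dg h}"
    with U have "h \<in> V" by blast
    from col[OF this t] show "B (st h + t) k *\<^sub>R f h t
      = (if t = nidx g i j then if h = i then f h t else 0 else 0)
        - (if t = nidx g j i then if h = j then f h t else 0 else 0)"
      using nb(4) by simp
  qed
  also have "\<dots> = (\<Sum>h\<in>U. (if h = i then f h (nidx g i j) else 0) - (if h = j then f h (nidx g j i) else 0))"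
    using nidx_range[OF nij] nidx_range[OF nb(5)]
    by (intro sum.cong refl) (auto simp: sum_subtractf)
  also have "\<dots> = f i (nidx g i j) - f j (nidx g j i)"
    using U fin by (simp add: sum_subtractf)
  finally show ?thesis .
qed

text \<open>\<open>edge_diff U k x\<close> is the product of row \<open>k\<close> of \<open>B'\<close>, restricted to the blocks in \<open>U\<close>, with
  the stacked blocks \<open>x i\<close>; \<open>edge_col k i s\<close> is block \<open>i\<close> of column \<open>k\<close> of \<open>B\<close> times the signal \<open>s\<close>.\<close>

definition edge_diff :: "nat set \<Rightarrow> nat \<Rightarrow> (nat \<Rightarrow> vsignal) \<Rightarrow> signal" where
  "edge_diff U k x = (\<Sum>h\<in>U. \<Sum>t\<in>{1..dg h}. B (st h + t) k *\<^sub>R x h t)"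

definition edge_col :: "nat \<Rightarrow> nat \<Rightarrow> signal \<Rightarrow> vsignal" where
  "edge_col k i s = (\<lambda>t. if t \<in> {1..dg i} then B (st i + t) k *\<^sub>R s else 0)"

lemma edge_col_L2e [simp]: "edge_col k i s \<in> L2e (dg i)"
  by (simp add: edge_col_def L2e_def)

lemma edge_col_L2: "finite_energy s \<Longrightarrow> edge_col k i s \<in> L2 (dg i)"
  by (rule L2I[OF edge_col_L2e]) (simp add: edge_col_def finite_energy_scaleR)

lemma edge_diff_finite_energy: "(\<And>i. i \<in> U \<Longrightarrow> x i \<in> L2 (dg i)) \<Longrightarrow> finite_energy (edge_diff U k x)"
  unfolding edge_diff_def by (intro finite_energy_sum finite_energy_scaleR finite_energy_L2) auto

lemma edge_col_eq_0:
  assumes k: "k \<in> {1..size_m g}" and i: "i \<in> V" "i \<notin> link_edge g k"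
  shows "edge_col k i s = 0"
proof -
  have "B (st i + t) k = 0" if t: "t \<in> {1..dg i}" for t
  proof (rule ccontr)
    assume "B (st i + t) k \<noteq> 0"
    from B_nonzeroD[OF k i(1) t this] have "link_edge g k = {i, nb i t}"
      using link_edge_eidx nbrsD(1)[OF nb_nbrs[OF i(1) t]] by simp
    with i show False by simp
  qed
  then show ?thesis by (auto simp: edge_col_def)
qed

lemma edge_diff_mono:
  assumes "k \<in> {1..size_m g}" "U \<subseteq> V" "link_edge g k \<subseteq> U"
  shows "edge_diff U k x = edge_diff V k x"
proof -
  obtain i j where ends: "edge_ends k i j" using edge_ends_exist[OF assms(1)] by blast
  note ij = edge_endsD(1,2)[OF ends] and col = edge_endsD(3)[OF ends]
  show ?thesis unfolding edge_diff_def
    using sum_B_column[OF ends, of U x] sum_B_column[OF ends, of V x] assms(2,3) ij(2) nbrsD[OF ij(1)] by simp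
qed

text \<open>\<open>sum_B_column\<close> with column l in place of the signals leaves the difference
  of two entries of column l: 1 and -1 if l = k, both 0 otherwise. Only the ends of k need to lie in
  U, since column k vanishes elsewhere.\<close>

lemma edge_columns_orthogonal:
  assumes k: "k \<in> {1..size_m g}" and l: "l \<in> {1..size_m g}" and U: "U \<subseteq> V" "link_edge g k \<subseteq> U"
  shows "(\<Sum>h\<in>U. \<Sum>t\<in>{1..dg h}. B (st h + t) k * B (st h + t) l) = (if k = l then 2 else 0)"
proof -
  obtain i j where ends: "edge_ends k i j" using edge_ends_exist[OF k] by blast
  note ij = edge_endsD(1,2)[OF ends] and col = edge_endsD(3)[OF ends]
  note nb = nbrsD[OF ij(1)]
  have r: "nidx g i j \<in> {1..dg i}" "nidx g j i \<in> {1..dg j}" using nidx_range ij(1) nb(5) by auto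
  have "(\<Sum>h\<in>U. \<Sum>t\<in>{1..dg h}. B (st h + t) k * B (st h + t) l)
      = B (st i + nidx g i j) l - B (st j + nidx g j i) l"
    using sum_B_column[OF ends, of U "\<lambda>h t. B (st h + t) l"] U ij(2) by simp
  also have "\<dots> = (if k = l then 2 else 0)"
  proof (cases "k = l")
    case True
    then show ?thesis using col[OF nb(2) r(1)] col[OF nb(3) r(2)] nb(4) by simp
  next
    case False
    have "k = eidx g {i, j}" using ij eidx_link_edge[OF k] by simp
    with False have "B (st i + nidx g i j) l = 0" "B (st j + nidx g j i) l = 0"
      using B_nonzeroD[OF l nb(2) r(1)] B_nonzeroD[OF l nb(3) r(2)]
      by (auto simp: nb_nidx ij(1) nb(5) insert_commute)
    with False show ?thesis by simp
  qed
  finally show ?thesis .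
qed

text \<open>One row of B B' = I - P. Only the edge of the arc (i, t) contributes, and its arbitrary
  sign occurs twice, once in \<open>edge_diff\<close> and once in \<open>edge_col\<close>, so it
  cancels.\<close>

lemma sum_edge_col:
  assumes i: "i \<in> V" and t: "t \<in> {1..dg i}"
  shows "(\<Sum>k\<in>{1..size_m g}. edge_col k i (edge_diff V k x) t)
    = x i t - x (nb i t) (nidx g (nb i t) i)"
proof -
  let ?k = "eidx g {i, nb i t}"
  have e: "{i, nb i t} \<in> edges g" using nbrsD(1)[OF nb_nbrs[OF i t]] .
  have k: "?k \<in> {1..size_m g}" by (rule eidx_range[OF e])
  obtain a b where ends: "edge_ends ?k a b" using edge_ends_exist[OF k] by blast
  note ab = edge_endsD(1,2)[OF ends] and col = edge_endsD(3)[OF ends]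
  have d: "edge_diff V ?k x = x a (nidx g a b) - x b (nidx g b a)"
    unfolding edge_diff_def using sum_B_column[OF ends, of V x] nbrsD[OF ab(1)] by simp
  have "(\<Sum>k\<in>{1..size_m g}. edge_col k i (edge_diff V k x) t)
      = (\<Sum>k\<in>{1..size_m g}. if k = ?k then edge_col ?k i (edge_diff V ?k x) t else 0)"
    by (intro sum.cong refl) (use B_nonzeroD[OF _ i t] t in \<open>auto simp: edge_col_def\<close>)
  also have "\<dots> = edge_col ?k i (edge_diff V ?k x) t" using k by simp
  also have "\<dots> = B (st i + t) ?k *\<^sub>R (x a (nidx g a b) - x b (nidx g b a))"
    using t by (simp add: edge_col_def d)
  also have "\<dots> = x i t - x (nb i t) (nidx g (nb i t) i)"
  proof -
    have "{a, b} = {i, nb i t}" using ab(2) link_edge_eidx[OF e] by simp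
    then consider "a = i" "b = nb i t" | "b = i" "a = nb i t" by (auto simp: doubleton_eq_iff)
    then show ?thesis
      by cases (use nbrsD(4)[OF ab(1)] nidx_nb[OF i t] col[OF i t] in auto)
  qed
  finally show ?thesis .
qed

lemma block_P_op:
  assumes x: "\<And>i. i \<in> V \<Longrightarrow> x i \<in> L2e (dg i)" and i: "i \<in> V"
  shows "(\<Sum>k\<in>{1..size_m g}. edge_col k i (edge_diff V k x))
    = x i - blk (st i) (dg i) (P_op g (stack V dg x))"
proof
  fix t
  show "(\<Sum>k\<in>{1..size_m g}. edge_col k i (edge_diff V k x)) t
      = (x i - blk (st i) (dg i) (P_op g (stack V dg x))) t"
  proof (cases "t \<in> {1..dg i}")
    case True
    have nb: "nb i t \<in> nbrs g i" by (rule nb_nbrs[OF i True])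
    have "P_op g (stack V dg x) (st i + t) = x (nb i t) (nidx g (nb i t) i)"
      unfolding P_op_eval[OF i True] unfolding start_def
      by (rule stack_eval) (use nbrsD[OF nb] nidx_range in auto)
    with True show ?thesis unfolding sum_fun_eval sum_edge_col[OF i True] by (simp add: blk_def)
  next
    case False
    then show ?thesis using x[OF i] by (auto simp: sum_fun_eval edge_col_def blk_def L2e_def)
  qed
qed

end

section \<open>Summation over the partition\<close>

text \<open>Double counting: an element is met once per set of the cover containing it, and its
  weight is the reciprocal of that multiplicity. It accounts for all the weights of the
  certificates: over vertices, over edges and over pairs of edges.\<close>

lemma sum_over_cover:
  fixes f :: "'b \<Rightarrow> real"
  assumes "finite A" "finite C" "\<And>p. p \<in> C \<Longrightarrow> S p \<subseteq> A" "\<And>a. a \<in> A \<Longrightarrow> \<exists>p\<in>C. a \<in> S p"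
  shows "(\<Sum>p\<in>C. \<Sum>a\<in>S p. (1 / real (card {p\<in>C. a \<in> S p})) * f a) = (\<Sum>a\<in>A. f a)"
proof -
  let ?w = "\<lambda>a. 1 / real (card {p\<in>C. a \<in> S p})"
  have "(\<Sum>p\<in>C. \<Sum>a\<in>S p. ?w a * f a) = (\<Sum>p\<in>C. \<Sum>a\<in>{a\<in>A. a \<in> S p}. ?w a * f a)"
    by (intro sum.cong refl) (use assms(3) in auto)
  also have "\<dots> = (\<Sum>a\<in>A. \<Sum>p\<in>{p\<in>C. a \<in> S p}. ?w a * f a)"
    by (rule sum.swap_restrict) (use assms in auto)
  also have "\<dots> = (\<Sum>a\<in>A. f a)"
  proof (rule sum.cong)
    fix a assume "a \<in> A"
    then have "card {p\<in>C. a \<in> S p} \<noteq> 0" using assms(2,4) by auto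
    then show "(\<Sum>p\<in>{p\<in>C. a \<in> S p}. ?w a * f a) = f a" by simp
  qed simp
  finally show ?thesis .
qed

locale partitioned_network = network +
  fixes c :: nat and F :: "nat \<Rightarrow> nat set set"
  assumes partition: "localized_edge_partition g c F"
    and cover: "\<And>k. k \<in> {1..size_m g} \<Longrightarrow> L_set g k \<subseteq> (\<Union>p\<in>O_set g c F k. K_set g F p) - {k}"
begin

abbreviation "VV \<equiv> sub_verts g F"

lemma sub_verts_subset: "VV p \<subseteq> V" by (auto simp: sub_verts_def)

lemma finite_sub_verts [simp]: "finite (VV p)"
  using finite_subset[OF sub_verts_subset] by simp

lemma F_edges: "p \<in> {1..c} \<Longrightarrow> F p \<subseteq> edges g"
  using partition by (auto simp: localized_edge_partition_def)

lemma K_set_subset: "p \<in> {1..c} \<Longrightarrow> K_set g F p \<subseteq> {1..size_m g}"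
  using F_edges eidx_range by (auto simp: K_set_def simp del: atLeastAtMost_iff)

lemma link_edge_K_set: "p \<in> {1..c} \<Longrightarrow> k \<in> K_set g F p \<Longrightarrow> link_edge g k \<subseteq> VV p"
proof
  fix i assume p: "p \<in> {1..c}" and k: "k \<in> K_set g F p" and i: "i \<in> link_edge g k"
  from k obtain e where e: "e \<in> F p" "k = eidx g e" by (auto simp: K_set_def)
  with F_edges[OF p] have "e \<in> edges g" by auto
  with e i link_edge_eidx have "i \<in> e" by auto
  moreover from \<open>e \<in> edges g\<close> obtain a b where "a \<in> V" "b \<in> V" "e = {a, b}" using edgeE by metis
  ultimately have "e \<in> inc g i" "i \<in> V"
    using \<open>e \<in> edges g\<close> by (auto simp: inc_def nbrs_def insert_commute)
  with e show "i \<in> VV p" by (auto simp: sub_verts_def)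
qed

lemma edge_covered: "e \<in> edges g \<Longrightarrow> \<exists>p\<in>{1..c}. e \<in> F p"
  using partition by (auto simp: localized_edge_partition_def)

lemma vert_covered: assumes "i \<in> V" shows "\<exists>p\<in>{1..c}. i \<in> VV p"
proof -
  have "nbrs g i \<noteq> {}" using deg_pos[OF assms] by (auto simp: deg_def)
  then obtain j where "j \<in> nbrs g i" by auto
  then have j: "{i, j} \<in> edges g" "{i, j} \<in> inc g i" using nbrsD by (auto simp: inc_def)
  then obtain p where "p \<in> {1..c}" "{i, j} \<in> F p" using edge_covered[OF j(1)] by blast
  with j assms show ?thesis by (auto simp: sub_verts_def)
qed

lemma L_set_subset: "k \<in> {1..size_m g} \<Longrightarrow> L_set g k \<subseteq> {1..size_m g}"
proof
  fix l assume "l \<in> L_set g k"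
  then obtain i e where "e \<in> inc g i" "l = eidx g e" by (auto simp: L_set_def)
  then show "l \<in> {1..size_m g}" using nbrsD(1) eidx_range by (auto simp: inc_def simp del: atLeastAtMost_iff)
qed

lemma L_setI:
  assumes "k \<in> {1..size_m g}" "l \<in> {1..size_m g}" "k \<noteq> l" "i \<in> link_edge g k" "i \<in> link_edge g l"
  shows "l \<in> L_set g k"
proof -
  obtain a b where ab: "a \<in> V" "b \<in> V" "link_edge g l = {a, b}"
    using edgeE[OF link_edge_edges[OF assms(2)]] by metis
  then have "link_edge g l \<in> inc g i"
    using assms(5) link_edge_edges[OF assms(2)] by (auto simp: inc_def nbrs_def insert_commute)
  then have "eidx g (link_edge g l) \<in> eidx g ` (\<Union>i\<in>link_edge g k. inc g i)" using assms(4) by auto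
  then show ?thesis using assms(1-3) by (simp add: L_set_def eidx_link_edge)
qed

text \<open>The certificate of part p with the signals abstracted into reals: \<open>Q1 i\<close>,
  \<open>Q2 i k\<close> and \<open>Q3 i k l\<close> stand for the forms of block i at the local
  signal and at the columns k and l.\<close>

definition weighted_form ::
    "nat \<Rightarrow> (nat \<Rightarrow> real) \<Rightarrow> (nat \<Rightarrow> nat \<Rightarrow> real) \<Rightarrow> (nat \<Rightarrow> nat \<Rightarrow> nat \<Rightarrow> real) \<Rightarrow> real" where
  "weighted_form p Q1 Q2 Q3 =
     (\<Sum>i\<in>VV p. (1 / real (card (J_set g c F i))) * Q1 i)
     + 2 * (\<Sum>k\<in>K_set g F p. (1 / real (card (O_set g c F k))) * (\<Sum>i\<in>VV p. Q2 i k))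
     + (\<Sum>k\<in>K_set g F p. (1 / real (card (O_set g c F k))) * (\<Sum>i\<in>VV p. Q3 i k k))
     + (\<Sum>k\<in>K_set g F p. \<Sum>l\<in>K_set g F p \<inter> L_set g k.
          (1 / real (card (Q_set g c F k l))) * (\<Sum>i\<in>VV p. Q3 i k l))"

text \<open>The combinatorial core, free of signals. Because column k vanishes off the ends of edge
  k, the inner sums over \<open>VV p\<close> may run over all vertices; apart from the margins, p is
  then present only in weights and ranges, and \<open>sum_over_cover\<close> applies. Pairs of
  distinct edges without a common end contribute nothing, and the cover assumption places every
  adjacent pair in a common part.\<close>

lemma certificate_sum:
  fixes Q1 E :: "nat \<Rightarrow> real" and Q2 :: "nat \<Rightarrow> nat \<Rightarrow> real" and Q3 :: "nat \<Rightarrow> nat \<Rightarrow> nat \<Rightarrow> real"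
  assumes Q2: "\<And>i k. i \<in> V \<Longrightarrow> k \<in> {1..size_m g} \<Longrightarrow> i \<notin> link_edge g k \<Longrightarrow> Q2 i k = 0"
    and Q3: "\<And>i k l. i \<in> V \<Longrightarrow> k \<in> {1..size_m g} \<Longrightarrow> l \<in> {1..size_m g} \<Longrightarrow>
        i \<notin> link_edge g k \<or> i \<notin> link_edge g l \<Longrightarrow> Q3 i k l = 0"
    and E: "\<And>i. i \<in> V \<Longrightarrow> 0 \<le> E i"
    and e: "\<And>p. p \<in> {1..c} \<Longrightarrow> e \<le> \<epsilon> p"
    and le: "\<And>p. p \<in> {1..c} \<Longrightarrow>
      weighted_form p (\<lambda>i. Q1 i + \<epsilon> p * E i) Q2 Q3 \<le> 0"
  shows "(\<Sum>i\<in>V. Q1 i) + 2 * (\<Sum>k\<in>{1..size_m g}. \<Sum>i\<in>V. Q2 i k)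
    + (\<Sum>k\<in>{1..size_m g}. \<Sum>l\<in>{1..size_m g}. \<Sum>i\<in>V. Q3 i k l) \<le> - e * (\<Sum>i\<in>V. E i)"
proof -
  let ?K = "\<lambda>p. K_set g F p" and ?m = "{1..size_m g}"
  let ?J = "\<lambda>i. 1 / real (card (J_set g c F i))" and ?O = "\<lambda>k. 1 / real (card (O_set g c F k))"
  let ?Q = "\<lambda>k l. 1 / real (card (Q_set g c F k l))"
  have fK: "finite (?K p)" if "p \<in> {1..c}" for p using K_set_subset[OF that] finite_subset by auto
  have K: "\<exists>p\<in>{1..c}. k \<in> ?K p" if k: "k \<in> ?m" for k
  proof -
    obtain p where "p \<in> {1..c}" "link_edge g k \<in> F p"
      using edge_covered[OF link_edge_edges[OF k]] by blast
    then show ?thesis using eidx_link_edge[OF k] by (metis K_set_def imageI)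
  qed
  have sV: "(\<Sum>p\<in>{1..c}. \<Sum>i\<in>VV p. ?J i * f i) = (\<Sum>i\<in>V. f i)" for f
    unfolding J_set_def using sub_verts_subset vert_covered
    by (intro sum_over_cover) auto
  have sK: "(\<Sum>p\<in>{1..c}. \<Sum>k\<in>?K p. ?O k * f k) = (\<Sum>k\<in>?m. f k)" for f
    unfolding O_set_def using K_set_subset K
    by (intro sum_over_cover) auto
  \<comment> \<open>Ordered pairs of adjacent edges, so that the sums with weights \<theta> are sums
    over a cover as well.\<close>
  let ?A = "SIGMA k:?m. L_set g k" and ?S = "\<lambda>p. SIGMA k:?K p. ?K p \<inter> L_set g k"
  have fA: "finite ?A" using finite_subset[OF L_set_subset] by (intro finite_SigmaI) auto
  have sQ: "(\<Sum>p\<in>{1..c}. \<Sum>k\<in>?K p. \<Sum>l\<in>?K p \<inter> L_set g k. ?Q k l * f k l)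
      = (\<Sum>k\<in>?m. \<Sum>l\<in>L_set g k. f k l)" for f
  proof -
    have "(\<Sum>p\<in>{1..c}. \<Sum>k\<in>?K p. \<Sum>l\<in>?K p \<inter> L_set g k. ?Q k l * f k l)
        = (\<Sum>p\<in>{1..c}. \<Sum>(k, l)\<in>?S p. ?Q k l * f k l)"
      by (intro sum.cong refl sum.Sigma) (auto simp: fK)
    also have "\<dots> = (\<Sum>p\<in>{1..c}. \<Sum>x\<in>?S p. (1 / real (card {p\<in>{1..c}. x \<in> ?S p})) * f (fst x) (snd x))"
    proof (intro sum.cong refl)
      fix p x assume x: "x \<in> ?S p"
      then have "Q_set g c F (fst x) (snd x) = {p\<in>{1..c}. x \<in> ?S p}" by (auto simp: Q_set_def)
      then show "(case x of (k, l) \<Rightarrow> ?Q k l * f k l)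
          = (1 / real (card {p\<in>{1..c}. x \<in> ?S p})) * f (fst x) (snd x)"
        by (simp add: case_prod_beta)
    qed
    also have "\<dots> = (\<Sum>x\<in>?A. f (fst x) (snd x))"
    proof (rule sum_over_cover[OF fA])
      fix x assume "x \<in> ?A"
      then have x: "fst x \<in> ?m" "snd x \<in> L_set g (fst x)" by auto
      with cover[OF x(1)] obtain p where "p \<in> O_set g c F (fst x)" "snd x \<in> ?K p" by blast
      with x show "\<exists>p\<in>{1..c}. x \<in> ?S p" by (cases x) (auto simp: O_set_def)
    next
      fix p assume "p \<in> {1..c}"
      then show "?S p \<subseteq> ?A" using K_set_subset by blast
    qed simp
    also have "\<dots> = (\<Sum>k\<in>?m. \<Sum>l\<in>L_set g k. f k l)"
    proof -
      have "\<forall>k\<in>?m. finite (L_set g k)" using finite_subset[OF L_set_subset] by blast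
      then show ?thesis by (subst sum.Sigma) (auto simp: case_prod_beta)
    qed
    finally show ?thesis .
  qed
  have ext: "(\<Sum>i\<in>VV p. h i) = (\<Sum>i\<in>V. h i)" if "p \<in> {1..c}" "k \<in> ?K p"
      "\<And>i. i \<in> V \<Longrightarrow> i \<notin> link_edge g k \<Longrightarrow> h i = 0" for h :: "nat \<Rightarrow> real" and p k
    by (rule sum.mono_neutral_left) (use that link_edge_K_set sub_verts_subset in auto)
  have Km: "k \<in> ?m" if "p \<in> {1..c}" "k \<in> ?K p" for p k using that K_set_subset by blast
  define S1 where "S1 p = (\<Sum>i\<in>VV p. ?J i * (Q1 i + \<epsilon> p * E i))" for p
  define S2 where "S2 p = (\<Sum>k\<in>?K p. ?O k * (\<Sum>i\<in>V. Q2 i k))" for p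
  define S3 where "S3 p = (\<Sum>k\<in>?K p. ?O k * (\<Sum>i\<in>V. Q3 i k k))" for p
  define S4 where "S4 p = (\<Sum>k\<in>?K p. \<Sum>l\<in>?K p \<inter> L_set g k. ?Q k l * (\<Sum>i\<in>V. Q3 i k l))" for p
  have "S1 p + 2 * S2 p + S3 p + S4 p \<le> 0" if p: "p \<in> {1..c}" for p
  proof -
    have "(\<Sum>i\<in>V. Q2 i k) = (\<Sum>i\<in>VV p. Q2 i k)" if k: "k \<in> ?K p" for k
      by (rule ext[OF p k, symmetric]) (rule Q2[OF _ Km[OF p k]])
    then have "S2 p = (\<Sum>k\<in>?K p. ?O k * (\<Sum>i\<in>VV p. Q2 i k))"
      unfolding S2_def by (simp cong: sum.cong)
    moreover have q3: "(\<Sum>i\<in>V. Q3 i k l) = (\<Sum>i\<in>VV p. Q3 i k l)" if k: "k \<in> ?K p" and l: "l \<in> ?K p" for k l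
      by (rule ext[OF p k, symmetric]) (rule Q3[OF _ Km[OF p k] Km[OF p l]], simp_all)
    then have "S3 p = (\<Sum>k\<in>?K p. ?O k * (\<Sum>i\<in>VV p. Q3 i k k))"
      unfolding S3_def by (simp cong: sum.cong)
    moreover have "S4 p = (\<Sum>k\<in>?K p. \<Sum>l\<in>?K p \<inter> L_set g k. ?Q k l * (\<Sum>i\<in>VV p. Q3 i k l))"
      unfolding S4_def by (auto simp: q3 intro!: sum.cong[OF refl])
    ultimately show ?thesis using le[OF p] unfolding S1_def weighted_form_def by simp
  qed
  then have "(\<Sum>p\<in>{1..c}. S1 p + 2 * S2 p + S3 p + S4 p) \<le> 0" by (intro sum_nonpos) auto
  then have "(\<Sum>p\<in>{1..c}. S1 p) + 2 * (\<Sum>k\<in>?m. \<Sum>i\<in>V. Q2 i k) + (\<Sum>k\<in>?m. \<Sum>i\<in>V. Q3 i k k)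
      + (\<Sum>k\<in>?m. \<Sum>l\<in>L_set g k. \<Sum>i\<in>V. Q3 i k l) \<le> 0"
    unfolding sum.distrib sum_distrib_left[symmetric] S2_def S3_def S4_def sK sQ .
  \<comment> \<open>The margins differ from part to part; as \<open>E\<close> is nonnegative, each
    may be lowered to the common \<open>e\<close> before the cover sum is taken.\<close>
  moreover have "(\<Sum>i\<in>V. Q1 i) + e * (\<Sum>i\<in>V. E i) \<le> (\<Sum>p\<in>{1..c}. S1 p)"
  proof -
    have "(\<Sum>i\<in>V. Q1 i) + e * (\<Sum>i\<in>V. E i) = (\<Sum>i\<in>V. Q1 i + e * E i)"
      by (simp add: sum.distrib sum_distrib_left)
    also have "\<dots> = (\<Sum>p\<in>{1..c}. \<Sum>i\<in>VV p. ?J i * (Q1 i + e * E i))" by (rule sV[symmetric])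
    also have "\<dots> \<le> (\<Sum>p\<in>{1..c}. S1 p)"
      unfolding S1_def using e E sub_verts_subset by (intro sum_mono mult_left_mono add_left_mono mult_right_mono) auto
    finally show ?thesis .
  qed
  moreover have "(\<Sum>k\<in>?m. \<Sum>l\<in>?m. \<Sum>i\<in>V. Q3 i k l)
      = (\<Sum>k\<in>?m. \<Sum>i\<in>V. Q3 i k k) + (\<Sum>k\<in>?m. \<Sum>l\<in>L_set g k. \<Sum>i\<in>V. Q3 i k l)"
  proof -
    have "(\<Sum>l\<in>?m. \<Sum>i\<in>V. Q3 i k l) = (\<Sum>i\<in>V. Q3 i k k) + (\<Sum>l\<in>L_set g k. \<Sum>i\<in>V. Q3 i k l)"
      if k: "k \<in> ?m" for k
    proof -
      have "(\<Sum>l\<in>?m. \<Sum>i\<in>V. Q3 i k l) = (\<Sum>l\<in>insert k (L_set g k). \<Sum>i\<in>V. Q3 i k l)"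
      proof (rule sum.mono_neutral_right)
        show "\<forall>l\<in>?m - insert k (L_set g k). (\<Sum>i\<in>V. Q3 i k l) = 0"
          using L_setI[OF k] Q3[OF _ k] by (intro ballI sum.neutral) blast
      qed (use k L_set_subset[OF k] in auto)
      also have "\<dots> = (\<Sum>i\<in>V. Q3 i k k) + (\<Sum>l\<in>L_set g k. \<Sum>i\<in>V. Q3 i k l)"
        using finite_subset[OF L_set_subset[OF k]] by (intro sum.insert) (simp, simp add: L_set_def)
      finally show ?thesis .
    qed
    then show ?thesis by (simp add: sum.distrib)
  qed
  ultimately show ?thesis by linarith
qed

end

section \<open>Homotopy\<close>

text \<open>Perturbation estimate for the form of an operator with gain k. It is applied with a = (G
  u, u) and b = (0, w), so that a - b = (G u, \<alpha> \<Delta> (G u)) is subject to the quadratic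
  constraint.\<close>

lemma quadratic_gap:
  assumes \<Theta>: "bounded_linear_L2 r r \<Theta>" and a: "a \<in> L2 r" and b: "b \<in> L2 r"
    and k: "\<And>x. x \<in> L2 r \<Longrightarrow> nrm r (\<Theta> x) \<le> k * nrm r x"
  shows "ip r (a - b) (\<Theta> (a - b)) \<le> ip r a (\<Theta> a) + 2 * k * nrm r a * nrm r b + k * (nrm r b)\<^sup>2"
proof -
  note cl = bounded_L2_closed[OF \<Theta> a] bounded_L2_closed[OF \<Theta> b]
  have d: "\<Theta> (a - b) = \<Theta> a - \<Theta> b"
    using linear_on_diff[OF bounded_L2_linear[OF \<Theta>] a b] b by (simp add: L2_uminus)
  have ex: "ip r (a - b) (\<Theta> (a - b)) = ip r a (\<Theta> a) - ip r a (\<Theta> b) - ip r b (\<Theta> a) + ip r b (\<Theta> b)"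
    using a b cl by (simp add: d ip_diff_left ip_diff_right L2_diff)
  have est: "\<bar>ip r x (\<Theta> y)\<bar> \<le> nrm r x * (k * nrm r y)" if "x \<in> L2 r" "y \<in> L2 r" for x y
  proof -
    have "\<bar>ip r x (\<Theta> y)\<bar> \<le> nrm r x * nrm r (\<Theta> y)"
      by (rule ip_Cauchy_Schwarz[OF that(1) bounded_L2_closed[OF \<Theta> that(2)]])
    also have "\<dots> \<le> nrm r x * (k * nrm r y)" by (intro mult_left_mono k that nrm_nonneg)
    finally show ?thesis .
  qed
  have e1: "- ip r a (\<Theta> b) \<le> k * nrm r a * nrm r b" using est[OF a b] by (simp add: mult_ac)
  have e2: "- ip r b (\<Theta> a) \<le> k * nrm r a * nrm r b" using est[OF b a] by (simp add: mult_ac)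
  have e3: "ip r b (\<Theta> b) \<le> k * (nrm r b)\<^sup>2" using est[OF b b] by (simp add: mult_ac power2_eq_square)
  show ?thesis unfolding ex using e1 e2 e3 by linarith
qed

text \<open>\<open>X \<alpha>\<close> is an abstract solution operator of u = w + \<alpha> \<Delta>
  (G u). A step enlarges \<alpha> by 1/N and counts the extra feedback as part of the input. That
  input is not known to have finite energy, so the a priori bound is applied to the solution for the
  truncated input, and causality brings the estimate back to the truncated u. As the bound does not
  depend on \<alpha>, neither does the step length.\<close>

lemma IQC_homotopy:
  fixes G \<Delta> :: sysmap and X :: "real \<Rightarrow> sysmap"
  assumes G: "stable_system m n G" and \<Delta>: "stable_system n m \<Delta>"
    and \<Theta>: "bounded_linear_L2 (n + m) (n + m) \<Theta>"
    and sol: "\<And>\<alpha> w. \<alpha> \<in> {0..1} \<Longrightarrow> w \<in> L2e m \<Longrightarrow> X \<alpha> w \<in> L2e m \<and> X \<alpha> w = w + \<alpha> *\<^sub>R \<Delta> (G (X \<alpha> w))"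
    and uniq: "\<And>\<alpha> w u. \<alpha> \<in> {0..1} \<Longrightarrow> w \<in> L2e m \<Longrightarrow> u \<in> L2e m \<Longrightarrow> u = w + \<alpha> *\<^sub>R \<Delta> (G u) \<Longrightarrow> u = X \<alpha> w"
    and X_causal: "\<And>\<alpha> w \<tau>. \<alpha> \<in> {0..1} \<Longrightarrow> w \<in> L2e m \<Longrightarrow> 0 \<le> \<tau> \<Longrightarrow>
      vtrunc \<tau> (X \<alpha> w) = vtrunc \<tau> (X \<alpha> (vtrunc \<tau> w))"
    and pos: "\<And>\<alpha> y. \<alpha> \<in> {0..1} \<Longrightarrow> y \<in> L2 n \<Longrightarrow>
      0 \<le> ip (n + m) (vcat n m y (\<alpha> *\<^sub>R \<Delta> y)) (\<Theta> (vcat n m y (\<alpha> *\<^sub>R \<Delta> y)))"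
    and \<epsilon>: "0 < \<epsilon>"
    and neg: "\<And>u. u \<in> L2 m \<Longrightarrow> ip (n + m) (vcat n m (G u) u) (\<Theta> (vcat n m (G u) u)) \<le> - \<epsilon> * (nrm m u)\<^sup>2"
  shows "\<exists>C\<ge>0. \<forall>w\<in>L2 m. X 1 w \<in> L2 m \<and> nrm m (X 1 w) \<le> C * nrm m w"
proof -
  obtain cG where cG: "0 < cG" "\<And>u. u \<in> L2 m \<Longrightarrow> G u \<in> L2 n" "\<And>u. u \<in> L2 m \<Longrightarrow> nrm n (G u) \<le> cG * nrm m u"
    using stable_system_bound[OF G] by metis
  obtain cD where cD: "0 < cD" "\<And>y. y \<in> L2 n \<Longrightarrow> \<Delta> y \<in> L2 m" "\<And>y. y \<in> L2 n \<Longrightarrow> nrm m (\<Delta> y) \<le> cD * nrm n y"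
    using stable_system_bound[OF \<Delta>] by metis
  obtain k where k: "0 \<le> k" "\<And>x. x \<in> L2 (n + m) \<Longrightarrow> nrm (n + m) (\<Theta> x) \<le> k * nrm (n + m) x"
    using bounded_L2_bound[OF \<Theta>] by metis
  \<comment> \<open>If |w| <= |u|, the right-hand side of the estimate \<open>*\<close> below is at
    most K |u| |w|.\<close>
  define K where "K = 2 * k * (cG + 1) + k"
  have K: "0 \<le> K" using k cG by (simp add: K_def)
  \<comment> \<open>The 1 covers the case |u| <= |w|, the quotient the opposite case.\<close>
  define C where "C = max 1 (2 * K / \<epsilon>)"
  have C1: "1 \<le> C" by (simp add: C_def)
  have apriori: "nrm m u \<le> C * nrm m w"
    if \<alpha>: "\<alpha> \<in> {0..1}" and u: "u \<in> L2 m" and w: "w \<in> L2 m" and eq: "u = w + \<alpha> *\<^sub>R \<Delta> (G u)" for \<alpha> u w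
  proof -
    let ?a = "vcat n m (G u) u" and ?b = "vcat n m 0 w"
    have a: "?a \<in> L2 (n + m)" and b: "?b \<in> L2 (n + m)" using u w cG by (auto intro: vcat_L2)
    have na: "nrm (n + m) ?a \<le> (cG + 1) * nrm m u"
      using nrm_vcat_le[OF cG(2)[OF u] u] cG(3)[OF u] by (simp add: algebra_simps)
    have nb: "nrm (n + m) ?b \<le> nrm m w" using nrm_vcat_le[OF L2_0 w, of n] by simp
    have "\<alpha> *\<^sub>R \<Delta> (G u) = u - w" using eq by (metis add_diff_cancel_left')
    then have "0 \<le> ip (n + m) (vcat n m (G u) (u - w)) (\<Theta> (vcat n m (G u) (u - w)))"
      using pos[OF \<alpha> cG(2)[OF u]] by simp
    also have "vcat n m (G u) (u - w) = ?a - ?b"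
      by (simp add: vcat_def emb_diff)
    also have "ip (n + m) (?a - ?b) (\<Theta> (?a - ?b))
        \<le> ip (n + m) ?a (\<Theta> ?a) + 2 * k * nrm (n + m) ?a * nrm (n + m) ?b + k * (nrm (n + m) ?b)\<^sup>2"
      by (rule quadratic_gap[OF \<Theta> a b k(2)])
    also have "\<dots> \<le> - \<epsilon> * (nrm m u)\<^sup>2 + 2 * k * ((cG + 1) * nrm m u) * nrm m w + k * (nrm m w)\<^sup>2"
      using neg[OF u] na nb k(1) cG(1) by (intro add_mono mult_mono power_mono) auto
    finally have *: "\<epsilon> * (nrm m u)\<^sup>2 \<le> 2 * k * ((cG + 1) * nrm m u) * nrm m w + k * (nrm m w)\<^sup>2" by simp
    show ?thesis
    proof (cases "nrm m u \<le> nrm m w")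
      case True
      also have "nrm m w \<le> C * nrm m w" using C1 mult_right_mono[OF C1, of "nrm m w"] by simp
      finally show ?thesis .
    next
      case False
      then have up: "0 < nrm m u" using nrm_nonneg[of m w] by linarith
      have "nrm m w * nrm m w \<le> nrm m u * nrm m w" using False by (intro mult_right_mono) auto
      then have "k * (nrm m w)\<^sup>2 \<le> k * (nrm m u * nrm m w)"
        using k(1) by (simp add: power2_eq_square mult_left_mono)
      with * have "\<epsilon> * (nrm m u)\<^sup>2 \<le> K * (nrm m u * nrm m w)" by (simp add: K_def algebra_simps)
      also have "\<dots> \<le> 2 * K * (nrm m u * nrm m w)" using K by (intro mult_right_mono) auto
      finally have "nrm m u * (\<epsilon> * nrm m u) \<le> nrm m u * (2 * K * nrm m w)"
        by (simp add: power2_eq_square mult_ac)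
      then have "\<epsilon> * nrm m u \<le> 2 * K * nrm m w" using up by simp
      then have "nrm m u \<le> (2 * K / \<epsilon>) * nrm m w" using \<epsilon> by (simp add: field_simps)
      also have "\<dots> \<le> C * nrm m w" by (intro mult_right_mono) (auto simp: C_def)
      finally show ?thesis .
    qed
  qed
  \<comment> \<open>Makes C cD cG / N at most 1/2, so that the extra feedback of a step can be
    absorbed into the left-hand side.\<close>
  obtain N :: nat where N: "2 * C * (cD * cG) < real N" using reals_Archimedean2 by blast
  have "0 < 2 * C * (cD * cG)" using C1 cD cG by simp
  then have N0: "0 < real N" using N by linarith
  have L2X: "\<forall>w\<in>L2 m. X (real j / real N) w \<in> L2 m" if "j \<le> N" for j
    using that
  proof (induction j)
    case 0
    have "X 0 w = w" if "w \<in> L2 m" for w using sol[of 0 w] that by (simp add: L2_imp_L2e)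
    then show ?case by simp
  next
    case (Suc j)
    let ?\<alpha> = "real j / real N" and ?\<beta> = "real (Suc j) / real N"
    have \<alpha>: "?\<alpha> \<in> {0..1}" and \<beta>: "?\<beta> \<in> {0..1}" using Suc.prems N0 by auto
    show ?case
    proof
      fix w assume w: "w \<in> L2 m"
      define u where "u = X ?\<beta> w"
      have u: "u \<in> L2e m" "u = w + ?\<beta> *\<^sub>R \<Delta> (G u)"
        using sol[OF \<beta> L2_imp_L2e[OF w]] by (auto simp: u_def)
      have GDu: "\<Delta> (G u) \<in> L2e m"
        by (intro causal_closed[OF stable_system_causal[OF \<Delta>]] causal_closed[OF stable_system_causal[OF G]] u)
      \<comment> \<open>u also solves the equation with parameter \<open>?\<alpha>\<close> and input
        w', which contains the increment of the feedback.\<close>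
      define w' where "w' = w + (1 / real N) *\<^sub>R \<Delta> (G u)"
      have w': "w' \<in> L2e m" unfolding w'_def by (intro L2e_add L2e_scaleR GDu L2_imp_L2e[OF w])
      have "?\<beta> = 1 / real N + ?\<alpha>" by (simp add: add_divide_distrib)
      then have "u = w' + ?\<alpha> *\<^sub>R \<Delta> (G u)"
        unfolding w'_def using u(2) by (simp add: scaleR_add_left add.assoc)
      then have uX: "u = X ?\<alpha> w'" by (rule uniq[OF \<alpha> w' u(1)])
      have "nrm m (vtrunc \<tau> u) \<le> 2 * C * nrm m w" if \<tau>: "0 \<le> \<tau>" for \<tau>
      proof -
        \<comment> \<open>The truncated input has finite energy, so the induction hypothesis and the
          a priori bound apply to v; causality makes v agree with u before \<tau>.\<close>
        define v where "v = X ?\<alpha> (vtrunc \<tau> w')"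
        have wt: "vtrunc \<tau> w' \<in> L2 m" by (rule vtrunc_L2[OF \<tau> w'])
        then have v: "v \<in> L2 m" unfolding v_def using Suc by simp
        have ut: "vtrunc \<tau> u \<in> L2 m" by (rule vtrunc_L2[OF \<tau> u(1)])
        have "vtrunc \<tau> u = vtrunc \<tau> v" unfolding v_def uX by (rule X_causal[OF \<alpha> w' \<tau>])
        then have "nrm m (vtrunc \<tau> u) \<le> nrm m v" using nrm_vtrunc_le[OF v] by simp
        also have "\<dots> \<le> C * nrm m (vtrunc \<tau> w')"
          by (rule apriori[OF \<alpha> v wt]) (use sol[OF \<alpha> L2_imp_L2e[OF wt]] in \<open>simp add: v_def\<close>)
        also have "nrm m (vtrunc \<tau> w') \<le> nrm m w + (1 / real N) * (cD * cG * nrm m (vtrunc \<tau> u))"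
        proof -
          have GL: "G (vtrunc \<tau> u) \<in> L2 n" by (rule cG(2)[OF ut])
          \<comment> \<open>Causality of both maps allows u to be truncated inside, where the
            finite-energy gains are valid.\<close>
          have "vtrunc \<tau> (\<Delta> (G u)) = vtrunc \<tau> (\<Delta> (vtrunc \<tau> (G u)))"
            by (rule causal_vtrunc[OF stable_system_causal[OF \<Delta>] \<tau>])
               (rule causal_closed[OF stable_system_causal[OF G] u(1)])
          also have "vtrunc \<tau> (G u) = vtrunc \<tau> (G (vtrunc \<tau> u))"
            by (rule causal_vtrunc[OF stable_system_causal[OF G] \<tau> u(1)])
          also have "vtrunc \<tau> (\<Delta> (vtrunc \<tau> (G (vtrunc \<tau> u)))) = vtrunc \<tau> (\<Delta> (G (vtrunc \<tau> u)))"
            by (rule causal_vtrunc[OF stable_system_causal[OF \<Delta>] \<tau> L2_imp_L2e[OF GL], symmetric])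
          finally have "nrm m (vtrunc \<tau> (\<Delta> (G u))) \<le> nrm m (\<Delta> (G (vtrunc \<tau> u)))"
            using nrm_vtrunc_le[OF cD(2)[OF GL]] by simp
          also have "\<dots> \<le> cD * nrm n (G (vtrunc \<tau> u))" by (rule cD(3)[OF GL])
          also have "\<dots> \<le> cD * (cG * nrm m (vtrunc \<tau> u))" using cD(1) cG(3)[OF ut] by simp
          finally have d: "nrm m (vtrunc \<tau> (\<Delta> (G u))) \<le> cD * cG * nrm m (vtrunc \<tau> u)" by (simp add: mult.assoc)
          have "nrm m (vtrunc \<tau> w') \<le> nrm m (vtrunc \<tau> w) + nrm m (vtrunc \<tau> ((1 / real N) *\<^sub>R \<Delta> (G u)))"
            unfolding w'_def vtrunc_add using vtrunc_L2[OF \<tau>] L2e_scaleR[OF GDu] L2_imp_L2e[OF w]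
            by (intro nrm_triangle) auto
          also have "\<dots> \<le> nrm m w + (1 / real N) * nrm m (vtrunc \<tau> (\<Delta> (G u)))"
            using nrm_vtrunc_le[OF w] by (simp add: vtrunc_scaleR nrm_scaleR)
          also have "\<dots> \<le> nrm m w + (1 / real N) * (cD * cG * nrm m (vtrunc \<tau> u))"
            using d by (intro add_left_mono mult_left_mono) auto
          finally show ?thesis .
        qed
        finally have "nrm m (vtrunc \<tau> u) \<le> C * nrm m w + (C * (cD * cG) / real N) * nrm m (vtrunc \<tau> u)"
          using C1 by (simp add: algebra_simps)
        also have "(C * (cD * cG) / real N) * nrm m (vtrunc \<tau> u) \<le> (1/2) * nrm m (vtrunc \<tau> u)"
          using N N0 by (intro mult_right_mono) (auto simp: field_simps)
        finally show ?thesis by simp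
      qed
      then show "X ?\<beta> w \<in> L2 m" unfolding u_def[symmetric] by (rule L2I_vtrunc_bounded[OF u(1)])
    qed
  qed
  show ?thesis
  proof (intro exI[of _ C] conjI ballI)
    show "0 \<le> C" using C1 by simp
    fix w assume w: "w \<in> L2 m"
    show X1: "X 1 w \<in> L2 m" using L2X[of N] w N0 by simp
    show "nrm m (X 1 w) \<le> C * nrm m w"
      using sol[of 1 w] by (intro apriori[of 1] X1 w) (simp_all add: L2_imp_L2e w)
  qed
qed

section \<open>The operators of a subgraph\<close>

context partitioned_network
begin

lemma m_hat_eq: "m_hat g F p = sum dg (VV p)"
  by (simp add: m_hat_def)

lemma B_hat_eval:
  assumes i: "i \<in> VV p" and t: "t \<in> {1..dg i}"
  shows "B_hat g B F p k (offset (VV p) dg i + t) = B (st i + t) k"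
proof -
  have "B_hat g B F p k (offset (VV p) dg i + t) = (\<Sum>j\<in>VV p. if j = i then B (st i + t) k else 0)"
    unfolding B_hat_def Let_def
  proof (rule sum.cong)
    fix j assume "j \<in> VV p"
    with offset_disjoint[OF finite_sub_verts i this, of dg] t
    show "(if offset (VV p) dg i + t \<in> {offset (VV p) dg j + 1..offset (VV p) dg j + dg j}
           then B (st j + (offset (VV p) dg i + t - offset (VV p) dg j)) k else 0)
        = (if j = i then B (st i + t) k else 0)" by auto
  qed simp
  also have "\<dots> = B (st i + t) k" using i by simp
  finally show ?thesis .
qed

text \<open>The matrix has rank one: the transposed column forms the edge difference, and the column
  distributes it.\<close>

lemma Lk_hat_stack:
  "Lk_hat g B F p k (stack (VV p) dg x) = stack (VV p) dg (\<lambda>i. edge_col k i (edge_diff (VV p) k x))"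
proof (rule L2e_ext_blocks[OF finite_sub_verts])
  show "Lk_hat g B F p k (stack (VV p) dg x) \<in> L2e (sum dg (VV p))" by (simp add: Lk_hat_def m_hat_eq)
  fix i t assume it: "i \<in> VV p" "t \<in> {1..dg i}"
  let ?a = "offset (VV p) dg i + t"
  have "?a \<in> {1..sum dg (VV p)}" using offset_le[OF finite_sub_verts it(1), of dg] it(2) by auto
  then have "Lk_hat g B F p k (stack (VV p) dg x) ?a
      = (\<Sum>b\<in>{1..sum dg (VV p)}. (B_hat g B F p k ?a * B_hat g B F p k b) *\<^sub>R stack (VV p) dg x b)"
    by (simp add: Lk_hat_def m_hat_eq mat_op_def)
  also have "\<dots> = (\<Sum>h\<in>VV p. \<Sum>s\<in>{1..dg h}. (B (st i + t) k * B (st h + s) k) *\<^sub>R x h s)"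
    unfolding sum_blocks[OF finite_sub_verts]
    by (intro sum.cong refl) (simp only: B_hat_eval it stack_eval[OF finite_sub_verts])
  also have "\<dots> = B (st i + t) k *\<^sub>R edge_diff (VV p) k x"
    by (simp add: edge_diff_def scaleR_sum_right)
  also have "\<dots> = stack (VV p) dg (\<lambda>i. edge_col k i (edge_diff (VV p) k x)) ?a"
    using it by (simp add: stack_eval[where d = dg] edge_col_def)
  finally show "Lk_hat g B F p k (stack (VV p) dg x) ?a
    = stack (VV p) dg (\<lambda>i. edge_col k i (edge_diff (VV p) k x)) ?a" .
qed (rule stack_L2e, simp)

lemma Lk_hat_column:
  assumes p: "p \<in> {1..c}" and k: "k \<in> K_set g F p" and l: "l \<in> K_set g F p"
  shows "Lk_hat g B F p l (stack (VV p) dg (\<lambda>i. edge_col k i s))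
    = (if k = l then 2 *\<^sub>R stack (VV p) dg (\<lambda>i. edge_col k i s) else 0)"
proof -
  have kl: "k \<in> {1..size_m g}" "l \<in> {1..size_m g}" using K_set_subset[OF p] k l by blast+
  have "edge_diff (VV p) l (\<lambda>i. edge_col k i s)
      = (\<Sum>h\<in>VV p. \<Sum>t\<in>{1..dg h}. B (st h + t) l * B (st h + t) k) *\<^sub>R s"
    by (simp add: edge_diff_def edge_col_def scaleR_sum_left)
  also have "\<dots> = (if l = k then 2 else 0) *\<^sub>R s"
    by (simp only: edge_columns_orthogonal[OF kl(2,1) sub_verts_subset link_edge_K_set[OF p l]])
  finally have d: "edge_diff (VV p) l (\<lambda>i. edge_col k i s) = (if l = k then 2 *\<^sub>R s else 0)" by auto
  have e: "edge_col h i (2 *\<^sub>R s) = 2 *\<^sub>R edge_col h i s" "edge_col h i 0 = 0" for h i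
    by (auto simp: edge_col_def)
  have "stack (VV p) dg (\<lambda>i. 0) = 0" by (simp add: stack_def)
  then show ?thesis unfolding Lk_hat_stack d stack_scaleR eq_commute[of k l] by (cases "l = k") (simp_all only: e refl if_True if_False)
qed

lemma Lk_hat_sum: "Lk_hat g B F p l (sum v I) = (\<Sum>k\<in>I. Lk_hat g B F p l (v k))"
  by (simp add: Lk_hat_def mat_op_sum)

lemma Lk_hat_scaleR: "Lk_hat g B F p l (a *\<^sub>R v) = a *\<^sub>R Lk_hat g B F p l v"
  by (simp add: Lk_hat_def mat_op_scaleR)

lemma bounded_L2_Lk_hat: "bounded_linear_L2 (m_hat g F p) (m_hat g F p) (Lk_hat g B F p k)"
  unfolding Lk_hat_def by (rule bounded_L2_mat_op)

lemma ip_Lk_hat: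
  assumes "v \<in> L2 (m_hat g F p)" "w \<in> L2 (m_hat g F p)"
  shows "ip (m_hat g F p) v (Lk_hat g B F p k w) = ip (m_hat g F p) (Lk_hat g B F p k v) w"
proof -
  let ?I = "{1..m_hat g F p}" and ?b = "B_hat g B F p k"
  have fe: "finite_energy (v a)" "finite_energy (w a)" for a using assms by (auto intro: finite_energy_L2)
  have *: "signal_inner (x a) (\<Sum>b\<in>?I. (?b a * ?b b) *\<^sub>R y b) = (\<Sum>b\<in>?I. ?b a * ?b b * signal_inner (x a) (y b))"
    if "\<And>a. finite_energy (x a)" "\<And>a. finite_energy (y a)" for x y :: vsignal and a
  proof -
    have "signal_inner (x a) (sum z I) = (\<Sum>b\<in>I. signal_inner (x a) (z b))"
      if "\<And>b. finite_energy (z b)" for z :: "nat \<Rightarrow> signal" and I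
      using that \<open>\<And>a. finite_energy (x a)\<close>
      by (induction I rule: infinite_finite_induct) (auto simp: signal_inner_add_right finite_energy_sum)
    from this[of "\<lambda>b. (?b a * ?b b) *\<^sub>R y b"] show ?thesis
      by (simp add: that finite_energy_scaleR signal_inner_scale_right)
  qed
  have ip: "ip (m_hat g F p) x (Lk_hat g B F p k y) = (\<Sum>a\<in>?I. \<Sum>b\<in>?I. ?b a * ?b b * signal_inner (x a) (y b))"
    if "\<And>a. finite_energy (x a)" "\<And>a. finite_energy (y a)" for x y
  proof -
    have "ip (m_hat g F p) x (Lk_hat g B F p k y)
        = (\<Sum>a\<in>?I. signal_inner (x a) (\<Sum>b\<in>?I. (?b a * ?b b) *\<^sub>R y b))"
      by (simp add: ip_def Lk_hat_def mat_op_def)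
    then show ?thesis by (simp only: *[of x y, OF that])
  qed
  have "ip (m_hat g F p) v (Lk_hat g B F p k w) = (\<Sum>a\<in>?I. \<Sum>b\<in>?I. ?b a * ?b b * signal_inner (v a) (w b))"
    by (rule ip[OF fe])
  also have "\<dots> = (\<Sum>b\<in>?I. \<Sum>a\<in>?I. ?b a * ?b b * signal_inner (v a) (w b))" by (rule sum.swap)
  also have "\<dots> = (\<Sum>b\<in>?I. \<Sum>a\<in>?I. ?b b * ?b a * signal_inner (w b) (v a))"
    by (simp only: mult.commute[of "?b _" "?b _"] signal_inner_commute[of "v _" "w _"])
  also have "\<dots> = ip (m_hat g F p) w (Lk_hat g B F p k v)" by (rule ip[OF fe(2,1), symmetric])
  finally show ?thesis by (simp add: ip_commute)
qed

lemma sub_dsum_stack: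
  "(\<And>i. i \<in> VV p \<Longrightarrow> x i \<in> L2e (dg i)) \<Longrightarrow>
   sub_dsum g F p A (stack (VV p) dg x) = stack (VV p) dg (\<lambda>i. A i (x i))"
  unfolding sub_dsum_def by (rule dsum_stack[OF finite_sub_verts])

lemma bounded_L2_sub_dsum:
  "(\<And>i. i \<in> V \<Longrightarrow> bounded_linear_L2 (dg i) (dg i) (A i)) \<Longrightarrow>
   bounded_linear_L2 (m_hat g F p) (m_hat g F p) (sub_dsum g F p A)"
  unfolding sub_dsum_def m_hat_eq using sub_verts_subset
  by (intro bounded_L2_dsum) (auto simp: subset_iff)

text \<open>The certificate is used at the restriction to \<open>VV p\<close> of one global z. Since
  both ends of every edge of part p lie in \<open>VV p\<close>, the local edge differences are the
  global ones, so the vectors \<open>b k i\<close> do not depend on p. This is what allows the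
  certificates to be added.\<close>

lemma local_certificate_expand:
  fixes D :: "nat \<Rightarrow> sysmap" and z :: "nat \<Rightarrow> vsignal"
  assumes p: "p \<in> {1..c}"
    and D: "\<And>i. i \<in> V \<Longrightarrow> bounded_linear_L2 (dg i) (dg i) (D i)"
    and \<Psi>1: "\<And>i. i \<in> V \<Longrightarrow> bounded_linear_L2 (dg i) (dg i) (Psi1 g \<Psi> i)"
    and \<Psi>2: "\<And>i. i \<in> V \<Longrightarrow> bounded_linear_L2 (dg i) (dg i) (Psi2 g \<Psi> i)"
    and \<Psi>3: "\<And>i. i \<in> V \<Longrightarrow> bounded_linear_L2 (dg i) (dg i) (Psi3 g \<Psi> i)"
    and z: "\<And>i. i \<in> V \<Longrightarrow> z i \<in> L2 (dg i)"
    and cert: "local_certificate g B c F D \<Psi> p \<epsilon>"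
  defines "b \<equiv> \<lambda>k i. edge_col k i (edge_diff V k (\<lambda>i. D i (z i)))"
  shows "weighted_form p (\<lambda>i. ip (dg i) (z i) (Psi1 g \<Psi> i (z i)) + \<epsilon> * ip (dg i) (z i) (z i))
      (\<lambda>i k. ip (dg i) (z i) (Psi2 g \<Psi> i (b k i)))
      (\<lambda>i k l. ip (dg i) (b k i) (Psi3 g \<Psi> i (b l i))) \<le> 0"
proof -
  let ?h = "m_hat g F p" and ?K = "K_set g F p" and ?st = "stack (VV p) dg"
  let ?J = "\<lambda>i. 1 / real (card (J_set g c F i))" and ?O = "\<lambda>k. 1 / real (card (O_set g c F k))"
  let ?Q = "\<lambda>k l. 1 / real (card (Q_set g c F k l))"
  let ?D3 = "sub_dsum g F p (Psi3 g \<Psi>)"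
  have VVV: "i \<in> V" if "i \<in> VV p" for i using that sub_verts_subset by blast
  note zL = z[OF VVV]
  have Dz: "D i (z i) \<in> L2 (dg i)" if "i \<in> V" for i
    by (rule bounded_L2_closed[OF D[OF that] z[OF that]])
  have bL: "b k i \<in> L2 (dg i)" for k i
    unfolding b_def by (intro edge_col_L2 edge_diff_finite_energy Dz)
  have stL: "?st x \<in> L2 ?h" if "\<And>i. i \<in> VV p \<Longrightarrow> x i \<in> L2 (dg i)" for x
    unfolding m_hat_eq by (rule stack_L2[OF finite_sub_verts that])
  have ipst: "ip ?h (?st x) (?st y) = (\<Sum>i\<in>VV p. ip (dg i) (x i) (y i))"
    if "\<And>i. i \<in> VV p \<Longrightarrow> x i \<in> L2 (dg i)" "\<And>i. i \<in> VV p \<Longrightarrow> y i \<in> L2 (dg i)" for x y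
    unfolding m_hat_eq by (rule ip_stack_stack[OF finite_sub_verts that])
  define zz where "zz = ?st z"
  have zz: "zz \<in> L2 ?h" unfolding zz_def by (rule stL[OF zL])
  define kz where "kz = K_hat g B F D p zz"
  have sub: "sub_dsum g F p A zz = ?st (\<lambda>i. A i (z i))" for A
    unfolding zz_def by (rule sub_dsum_stack[OF L2_imp_L2e[OF zL]])
  have "Lk_hat g B F p k (?st (\<lambda>i. D i (z i))) = ?st (b k)" if "k \<in> ?K" for k
  proof -
    have "k \<in> {1..size_m g}" using that K_set_subset[OF p] by blast
    then show ?thesis
      unfolding Lk_hat_stack b_def by (simp only: edge_diff_mono[OF _ sub_verts_subset link_edge_K_set[OF p that]])
  qed
  then have kz_eq: "kz = (1/2) *\<^sub>R (\<Sum>k\<in>?K. ?st (b k))"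
    unfolding kz_def K_hat_def L_hat_def sub by simp
  have kz: "kz \<in> L2 ?h" unfolding kz_eq by (intro L2_scaleR L2_sum stL bL)
  have fK: "finite ?K" by (rule finite_subset[OF K_set_subset[OF p]]) simp
  \<comment> \<open>Orthogonality keeps the term k = l with factor 2, cancelled by the 1/2 in
    \<open>K_hat\<close>; \<open>Y_hat\<close> and \<open>Z_hat\<close> meet \<open>kz\<close> only
    through these products.\<close>
  have Lkz: "Lk_hat g B F p l kz = ?st (b l)" if l: "l \<in> ?K" for l
  proof -
    have "Lk_hat g B F p l kz = (1/2) *\<^sub>R (\<Sum>k\<in>?K. if k = l then 2 *\<^sub>R ?st (b k) else 0)"
      unfolding kz_eq Lk_hat_scaleR Lk_hat_sum
      by (intro arg_cong2[where f = scaleR] refl sum.cong) (simp only: b_def Lk_hat_column[OF p _ l])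
    also have "\<dots> = ?st (b l)" using l fK by simp
    finally show ?thesis .
  qed
  define A where "A x = X_hat g c F \<Psi> p x + \<epsilon> *\<^sub>R W_hat g c F p x" for x
  have A: "bounded_linear_L2 ?h ?h A"
    unfolding A_def[abs_def] X_hat_def W_hat_def
    by (intro bounded_L2_plus bounded_L2_scaled bounded_L2_sub_dsum
        bounded_L2_scale_id \<Psi>1)
  define Y where "Y = Y_hat g B c F \<Psi> p"
  have Y: "bounded_linear_L2 ?h ?h Y"
    unfolding Y_def Y_hat_def[abs_def]
    by (intro bounded_L2_comp[OF bounded_L2_sum_op bounded_L2_sub_dsum]
        bounded_L2_scaled bounded_L2_Lk_hat \<Psi>2)
  define Z where "Z = Z_hat g B c F \<Psi> p"
  have LDL: "bounded_linear_L2 ?h ?h (\<lambda>z. Lk_hat g B F p k (?D3 (Lk_hat g B F p l z)))" for k l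
    by (intro bounded_L2_comp[OF bounded_L2_comp[OF bounded_L2_Lk_hat
          bounded_L2_sub_dsum] bounded_L2_Lk_hat] \<Psi>3)
  have Z: "bounded_linear_L2 ?h ?h Z"
    unfolding Z_def Z_hat_def[abs_def]
    by (intro bounded_L2_plus bounded_L2_sum_op bounded_L2_scaled LDL)
  have "ip (?h + ?h) (vcat ?h ?h zz kz) (op22 ?h ?h ?h ?h A Y (adj ?h ?h Y) Z (vcat ?h ?h zz kz)) \<le> 0"
    using cert zz unfolding local_certificate_def Let_def A_def Y_def Z_def kz_def by blast
  then have main: "ip ?h zz (A zz) + 2 * ip ?h zz (Y kz) + ip ?h kz (Z kz) \<le> 0"
    unfolding ip_op22_symmetric[OF A Y Z zz zz kz kz] by (simp add: ip_commute[of ?h "Y kz"])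
  have "A zz = ?st (\<lambda>i. ?J i *\<^sub>R (Psi1 g \<Psi> i (z i) + \<epsilon> *\<^sub>R z i))"
    unfolding A_def X_hat_def W_hat_def sub stack_scaleR stack_add
    by (rule stack_cong) (simp add: scaleR_add_right scaleR_left_commute)
  then have e1: "ip ?h zz (A zz)
      = (\<Sum>i\<in>VV p. ?J i * (ip (dg i) (z i) (Psi1 g \<Psi> i (z i)) + \<epsilon> * ip (dg i) (z i) (z i)))"
    using bounded_L2_closed[OF \<Psi>1[OF VVV] zL] zL
    by (simp add: zz_def ipst L2_scaleR L2_add ip_scale_right ip_add_right)
  have "Y kz = sub_dsum g F p (Psi2 g \<Psi>) (\<Sum>k\<in>?K. ?O k *\<^sub>R ?st (b k))"
    unfolding Y_def Y_hat_def by (simp only: Lkz cong: sum.cong)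
  also have "\<dots> = ?st (\<lambda>i. Psi2 g \<Psi> i (\<Sum>k\<in>?K. ?O k *\<^sub>R b k i))"
    unfolding stack_scaleR stack_sum
    by (rule sub_dsum_stack) (intro L2_imp_L2e L2_sum L2_scaleR bL)
  also have "\<dots> = ?st (\<lambda>i. \<Sum>k\<in>?K. ?O k *\<^sub>R Psi2 g \<Psi> i (b k i))"
    by (rule stack_cong)
       (simp only: bounded_L2_sum[OF \<Psi>2[OF VVV]] bounded_L2_scaleR[OF \<Psi>2[OF VVV]] L2_scaleR bL)
  finally have "ip ?h zz (Y kz)
      = (\<Sum>i\<in>VV p. \<Sum>k\<in>?K. ?O k * ip (dg i) (z i) (Psi2 g \<Psi> i (b k i)))"
    using bounded_L2_closed[OF \<Psi>2[OF VVV] bL] zL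
    by (simp add: zz_def ipst L2_sum L2_scaleR ip_sum_right ip_scale_right)
  also have "\<dots> = (\<Sum>k\<in>?K. ?O k * (\<Sum>i\<in>VV p. ip (dg i) (z i) (Psi2 g \<Psi> i (b k i))))"
    unfolding sum_distrib_left by (rule sum.swap)
  finally have e2: "ip ?h zz (Y kz)
      = (\<Sum>k\<in>?K. ?O k * (\<Sum>i\<in>VV p. ip (dg i) (z i) (Psi2 g \<Psi> i (b k i))))" .
  \<comment> \<open>The outer operator is symmetric and is moved onto \<open>kz\<close>, so that
    both arguments of the form become columns.\<close>
  have e3: "ip ?h kz (Lk_hat g B F p k (?D3 (Lk_hat g B F p l kz)))
      = (\<Sum>i\<in>VV p. ip (dg i) (b k i) (Psi3 g \<Psi> i (b l i)))" if "k \<in> ?K" "l \<in> ?K" for k l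
  proof -
    have D3: "?D3 (Lk_hat g B F p l kz) = ?st (\<lambda>i. Psi3 g \<Psi> i (b l i))"
      unfolding Lkz[OF that(2)] by (rule sub_dsum_stack[OF L2_imp_L2e[OF bL]])
    have L3: "Psi3 g \<Psi> i (b l i) \<in> L2 (dg i)" if "i \<in> VV p" for i
      by (rule bounded_L2_closed[OF \<Psi>3[OF VVV[OF that]] bL])
    have "?st (\<lambda>i. Psi3 g \<Psi> i (b l i)) \<in> L2 ?h" by (rule stL[OF L3])
    then show ?thesis
      unfolding D3 by (simp only: ip_Lk_hat[OF kz] Lkz[OF that(1)] ipst[OF bL L3])
  qed
  have LL: "Lk_hat g B F p k (?D3 (Lk_hat g B F p l kz)) \<in> L2 ?h" for k l
    by (rule bounded_L2_closed[OF LDL kz])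
  have "ip ?h kz (Z kz) = (\<Sum>k\<in>?K. ?O k * ip ?h kz (Lk_hat g B F p k (?D3 (Lk_hat g B F p k kz))))
      + (\<Sum>k\<in>?K. \<Sum>l\<in>?K \<inter> L_set g k. ?Q k l * ip ?h kz (Lk_hat g B F p k (?D3 (Lk_hat g B F p l kz))))"
    unfolding Z_def Z_hat_def
    by (simp add: ip_add_right ip_sum_right ip_scale_right L2_sum L2_scaleR LL kz)
  also have "\<dots> = (\<Sum>k\<in>?K. ?O k * (\<Sum>i\<in>VV p. ip (dg i) (b k i) (Psi3 g \<Psi> i (b k i))))
      + (\<Sum>k\<in>?K. \<Sum>l\<in>?K \<inter> L_set g k. ?Q k l * (\<Sum>i\<in>VV p. ip (dg i) (b k i) (Psi3 g \<Psi> i (b l i))))"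
    by (intro arg_cong2[where f = "(+)"] sum.cong[OF refl] arg_cong2[where f = times] refl) (auto simp: e3)
  finally show ?thesis using main unfolding e1 e2 weighted_form_def by linarith
qed

end

section \<open>The closed loop\<close>

context network
begin

abbreviation "n \<equiv> nverts g"
abbreviation "ag \<equiv> (\<lambda>_::nat. 1::nat)"
abbreviation "bm i \<equiv> blk (st i) (dg i)"
abbreviation "cm i \<equiv> blk (offset V ag i) 1"

lemma sum_ag: "sum ag V = n" by (simp add: verts_def)

lemma offset_ag: "i \<in> V \<Longrightarrow> offset V ag i = i - 1"
proof -
  assume "i \<in> V"
  then have "{h \<in> V. h < i} = {1..<i}" by (auto simp: verts_def)
  then show ?thesis by (simp add: offset_def)
qed

lemma bm_dsum:
  "i \<in> V \<Longrightarrow> A i (bm i v) \<in> L2e (dg i) \<Longrightarrow> bm i (dsum V dg dg A v) = A i (bm i v)"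
  unfolding start_def by (rule blk_dsum[OF finite_verts])

lemma cm_dsum: "i \<in> V \<Longrightarrow> A i (bm i v) \<in> L2e 1 \<Longrightarrow> cm i (dsum V dg ag A v) = A i (bm i v)"
  using blk_dsum[OF finite_verts, of i A dg v ag] by (simp add: start_def)

lemma ones_op_L2e [simp]: "ones_op d v \<in> L2e d" by (simp add: ones_op_def)

lemma bm_T_op: "i \<in> V \<Longrightarrow> bm i (T_op g v) = ones_op (dg i) (cm i v)"
  unfolding start_def T_op_def
  using blk_dsum[OF finite_verts, of i "\<lambda>i. ones_op (dg i)" ag v dg] by simp

lemma cm_S_op: "i \<in> V \<Longrightarrow> A i (cm i v) \<in> L2e 1 \<Longrightarrow> cm i (S_op g A v) = A i (cm i v)"
  unfolding S_op_def using blk_dsum[OF finite_verts, of i A ag v ag] by simp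

lemma M_dsum_L2e: "dsum V a dg A v \<in> L2e M"
  using dsum_L2e[OF finite_verts, of a dg A v] by (simp add: handshake)

lemma n_dsum_L2e: "dsum V a ag A v \<in> L2e n"
  using dsum_L2e[OF finite_verts, of a ag A v] by (simp only: sum_ag)

lemma M_ext_bm: "v \<in> L2e M \<Longrightarrow> w \<in> L2e M \<Longrightarrow> (\<And>i. i \<in> V \<Longrightarrow> bm i v = bm i w) \<Longrightarrow> v = w"
  using L2e_ext_blk[OF finite_verts, of v dg w] by (simp add: handshake start_def)

lemma n_ext_cm: "v \<in> L2e n \<Longrightarrow> w \<in> L2e n \<Longrightarrow> (\<And>i. i \<in> V \<Longrightarrow> cm i v = cm i w) \<Longrightarrow> v = w"
  using L2e_ext_blk[OF finite_verts, of v ag w] by (simp only: sum_ag)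

lemma P_op_diff: "P_op g (x - y) = P_op g x - P_op g y" by (simp add: P_op_eq mat_op_diff)

lemma bounded_L2_P_op: "bounded_linear_L2 M M (P_op g)"
  unfolding P_op_eq by (rule bounded_L2_mat_op)

text \<open>As P is an involution, u = P (y - d_y), and the two loop equations collapse to P y - K y
  = d_u + P d_y.\<close>

lemma loop_eqD:
  assumes d: "d \<in> L2e (M + M)" and v: "loop_eq M M (P_op g) K d v"
  defines "y \<equiv> blk 0 M v"
  shows "y \<in> L2e M" "P_op g y - K y = blk M M d + P_op g (blk 0 M d)"
    "v = vcat M M y (P_op g (y - blk 0 M d))"
proof -
  let ?u = "blk M M v"
  have vL: "v \<in> L2e (M + M)" and y: "y = P_op g ?u + blk 0 M d" and u: "?u = K y + blk M M d"
    using v unfolding loop_eq_def Let_def y_def by blast+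
  show "y \<in> L2e M" by (simp add: y_def)
  have "y - blk 0 M d = P_op g ?u" by (subst y) simp
  then have Pu: "P_op g (y - blk 0 M d) = ?u" by (simp add: P_op_involution)
  then have "P_op g y - P_op g (blk 0 M d) = K y + blk M M d"
    using u by (simp add: P_op_diff)
  then show "P_op g y - K y = blk M M d + P_op g (blk 0 M d)" by (simp add: algebra_simps)
  show "v = vcat M M y (P_op g (y - blk 0 M d))"
    unfolding Pu unfolding y_def by (rule vcat_blk[OF vL, symmetric])
qed

lemma loop_eqI:
  assumes d: "d \<in> L2e (M + M)" and y: "y \<in> L2e M"
    and eq: "P_op g y - K y = blk M M d + P_op g (blk 0 M d)"
  shows "loop_eq M M (P_op g) K d (vcat M M y (P_op g (y - blk 0 M d)))"
proof -
  have "P_op g (P_op g (y - blk 0 M d)) = y - blk 0 M d"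
    by (rule P_op_involution[OF L2e_diff[OF y blk_L2e]])
  moreover have "P_op g (y - blk 0 M d) = K y + blk M M d"
    using eq by (simp add: P_op_diff algebra_simps)
  ultimately show ?thesis
    unfolding loop_eq_def Let_def blk_vcat_left[OF y] blk_vcat_right[OF P_op_L2e] by simp
qed

text \<open>The inverse of P - K on \<open>L2e M\<close>, when the loop of P and K is well-posed;
  for K = T H it is the map R.\<close>

definition sol :: "sysmap \<Rightarrow> sysmap" where
  "sol K w = (THE y. y \<in> L2e M \<and> P_op g y - K y = w)"

text \<open>Loop solutions for the disturbance (0, w) correspond to solutions y of P y - K y = w, so
  well-posedness gives both existence and uniqueness.\<close>

lemma sol:
  assumes wp: "well_posed M M (P_op g) K" and w: "w \<in> L2e M"
  shows sol_L2e: "sol K w \<in> L2e M" and sol_eq: "P_op g (sol K w) - K (sol K w) = w"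
    and sol_unique: "\<And>y. y \<in> L2e M \<Longrightarrow> P_op g y - K y = w \<Longrightarrow> y = sol K w"
proof -
  let ?d = "vcat M M 0 w"
  have d: "?d \<in> L2e (M + M)" "blk 0 M ?d = 0" "blk M M ?d = w"
    by (simp_all add: blk_vcat_left blk_vcat_right w)
  have P0: "P_op g 0 = 0" by (simp add: P_op_eq)
  from wp d(1) have ex1: "\<exists>!v. loop_eq M M (P_op g) K ?d v" by (simp add: well_posed_def)
  then obtain v where v: "loop_eq M M (P_op g) K ?d v" by blast
  have "\<exists>!y. y \<in> L2e M \<and> P_op g y - K y = w"
  proof (rule ex1I)
    show "blk 0 M v \<in> L2e M \<and> P_op g (blk 0 M v) - K (blk 0 M v) = w"
      using loop_eqD[OF d(1) v] by (simp add: d P0)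
    fix y assume y: "y \<in> L2e M \<and> P_op g y - K y = w"
    then have "loop_eq M M (P_op g) K ?d (vcat M M y (P_op g (y - blk 0 M ?d)))"
      by (intro loop_eqI[OF d(1)]) (simp_all add: d P0)
    with ex1 v have "v = vcat M M y (P_op g (y - blk 0 M ?d))" by blast
    then show "y = blk 0 M v" using y by (simp add: blk_vcat_left)
  qed
  from theI'[OF this] this
  show "sol K w \<in> L2e M" "P_op g (sol K w) - K (sol K w) = w"
    "\<And>y. y \<in> L2e M \<Longrightarrow> P_op g y - K y = w \<Longrightarrow> y = sol K w"
    unfolding sol_def by blast+
qed

lemma closed_loop_eq:
  assumes wp: "well_posed M M (P_op g) K" and d: "d \<in> L2e (M + M)"
  defines "y \<equiv> sol K (blk M M d + P_op g (blk 0 M d))"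
  shows "closed_loop M M (P_op g) K d = vcat M M y (P_op g (y - blk 0 M d))"
  unfolding closed_loop_def
proof (rule the1_equality)
  show "\<exists>!v. loop_eq M M (P_op g) K d v" using wp d by (simp add: well_posed_def)
  have "blk M M d + P_op g (blk 0 M d) \<in> L2e M" by (simp add: L2e_add)
  from sol_L2e[OF wp this] sol_eq[OF wp this]
  show "loop_eq M M (P_op g) K d (vcat M M y (P_op g (y - blk 0 M d)))"
    unfolding y_def by (intro loop_eqI[OF d])
qed

lemma closed_loop_injected:
  assumes wp: "well_posed M M (P_op g) K" and w: "w \<in> L2e M"
  shows "blk 0 M (closed_loop M M (P_op g) K (vcat M M 0 w)) = sol K w"
proof -
  have P0: "P_op g 0 = 0" by (simp add: P_op_eq)
  show ?thesis
    by (simp add: closed_loop_eq[OF wp vcat_L2e] blk_vcat_left blk_vcat_right w P0 sol_L2e[OF wp w])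
qed

text \<open>\<open>sol K w\<close> is the y-component of the closed loop driven by (0, w), and
  truncation acts separately on the two components. Causality is thus inherited from the
  loop.\<close>

lemma sol_causal:
  assumes wp: "well_posed M M (P_op g) K" and w: "w \<in> L2e M" and \<tau>: "0 \<le> \<tau>"
  shows "vtrunc \<tau> (sol K w) = vtrunc \<tau> (sol K (vtrunc \<tau> w))"
proof -
  let ?C = "closed_loop M M (P_op g) K"
  have c: "causal (M + M) (M + M) ?C" using wp by (simp add: well_posed_def)
  have vt: "vtrunc \<tau> (vcat M M 0 w) = vcat M M 0 (vtrunc \<tau> w)"
    by (simp add: vcat_def vtrunc_add vtrunc_emb)
  have "vtrunc \<tau> (sol K w) = blk 0 M (vtrunc \<tau> (?C (vcat M M 0 w)))"
    by (simp only: closed_loop_injected[OF wp w, symmetric] vtrunc_blk)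
  also have "\<dots> = blk 0 M (vtrunc \<tau> (?C (vtrunc \<tau> (vcat M M 0 w))))"
    by (simp only: causal_vtrunc[OF c \<tau> vcat_L2e])
  also have "\<dots> = vtrunc \<tau> (sol K (vtrunc \<tau> w))"
    by (simp only: vt closed_loop_injected[OF wp vtrunc_L2e[OF w], symmetric] vtrunc_blk)
  finally show ?thesis .
qed

lemma feedback_stable_sol_bound:
  assumes "feedback_stable M M (P_op g) K"
  obtains c where "c > 0" "\<And>w. w \<in> L2 M \<Longrightarrow> sol K w \<in> L2 M" "\<And>w. w \<in> L2 M \<Longrightarrow> nrm M (sol K w) \<le> c * nrm M w"
proof -
  let ?C = "closed_loop M M (P_op g) K"
  have wp: "well_posed M M (P_op g) K" and st: "stable_system (M + M) (M + M) ?C"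
    using assms by (auto simp: feedback_stable_def)
  obtain c where c: "c > 0" "\<And>d. d \<in> L2 (M + M) \<Longrightarrow> ?C d \<in> L2 (M + M)"
    "\<And>d. d \<in> L2 (M + M) \<Longrightarrow> nrm (M + M) (?C d) \<le> c * nrm (M + M) d"
    using stable_system_bound[OF st] by metis
  show thesis
  proof (rule that[OF c(1)])
    fix w assume w: "w \<in> L2 M"
    let ?d = "vcat M M 0 w"
    have d: "?d \<in> L2 (M + M)" by (rule vcat_L2[OF L2_0 w])
    note s = closed_loop_injected[OF wp L2_imp_L2e[OF w]]
    show "sol K w \<in> L2 M" unfolding s[symmetric] by (rule blk_L2[OF c(2)[OF d]])
    have "nrm M (sol K w) \<le> nrm (M + M) (?C ?d)"
      unfolding s[symmetric] by (rule nrm_blk_le[OF _ c(2)[OF d]]) simp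
    also have "\<dots> \<le> c * nrm (M + M) ?d" by (rule c(3)[OF d])
    also have "\<dots> \<le> c * nrm M w"
      using nrm_vcat_le[OF L2_0 w, of M] c(1) by (intro mult_left_mono) auto
    finally show "nrm M (sol K w) \<le> c * nrm M w" .
  qed
qed

text \<open>Every disturbance pair acts on y like the single input w = d_u + P d_y, and u = P (y -
  d_y) is bounded together with y.\<close>

lemma feedback_stableI:
  assumes wp: "well_posed M M (P_op g) K" and K0: "K 0 = 0"
    and c: "0 \<le> c" "\<And>w. w \<in> L2 M \<Longrightarrow> sol K w \<in> L2 M \<and> nrm M (sol K w) \<le> c * nrm M w"
  shows "feedback_stable M M (P_op g) K"
proof -
  let ?C = "closed_loop M M (P_op g) K"
  have P0: "P_op g 0 = 0" by (simp add: P_op_eq)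
  have "0 = sol K 0" by (rule sol_unique[OF wp L2e_0 L2e_0]) (simp add: P0 K0)
  then have C0: "?C 0 = 0" using closed_loop_eq[OF wp L2e_0] by (simp add: P0)
  obtain k where k: "k \<ge> 0" "\<And>x. x \<in> L2 M \<Longrightarrow> nrm M (P_op g x) \<le> k * nrm M x"
    using bounded_L2_bound[OF bounded_L2_P_op] by metis
  note PL = bounded_L2_closed[OF bounded_L2_P_op]
  let ?a = "c * (1 + k)"
  \<comment> \<open>Here \<open>?a\<close> bounds y and \<open>k * (?a + 1)\<close> bounds u; the
    final 1 makes the gain positive, as \<open>stable_system\<close> requires.\<close>
  have "?C d \<in> L2 (M + M) \<and> nrm (M + M) (?C d) \<le> (?a + k * (?a + 1) + 1) * nrm (M + M) d"
    if d: "d \<in> L2 (M + M)" for d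
  proof -
    let ?dy = "blk 0 M d" and ?du = "blk M M d"
    have dy: "?dy \<in> L2 M" "nrm M ?dy \<le> nrm (M + M) d" and du: "?du \<in> L2 M" "nrm M ?du \<le> nrm (M + M) d"
      using blk_L2[OF d] nrm_blk_le[OF _ d] by auto
    define w where "w = ?du + P_op g ?dy"
    have w: "w \<in> L2 M" unfolding w_def by (intro L2_add du PL dy)
    have "nrm M w \<le> nrm M ?du + nrm M (P_op g ?dy)" unfolding w_def by (intro nrm_triangle du PL dy)
    also have "\<dots> \<le> nrm (M + M) d + k * nrm (M + M) d"
      using k(2)[OF dy(1)] mult_left_mono[OF dy(2) k(1)] du(2) by linarith
    finally have nw: "nrm M w \<le> (1 + k) * nrm (M + M) d" by (simp add: algebra_simps)
    define y where "y = sol K w"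
    have y: "y \<in> L2 M" and "nrm M y \<le> c * nrm M w" using c(2)[OF w] by (auto simp: y_def)
    then have ny: "nrm M y \<le> ?a * nrm (M + M) d"
      using mult_left_mono[OF nw c(1)] by (simp add: mult.assoc)
    have ydy: "y - ?dy \<in> L2 M" by (intro L2_diff y dy)
    have "nrm M (P_op g (y - ?dy)) \<le> k * nrm M (y - ?dy)" by (rule k(2)[OF ydy])
    also have "\<dots> \<le> k * (nrm M y + nrm M ?dy)" by (intro mult_left_mono k(1) nrm_triangle_diff y dy)
    also have "\<dots> \<le> k * (?a * nrm (M + M) d + nrm (M + M) d)"
      using ny dy(2) by (intro mult_left_mono k(1) add_mono)
    finally have nu: "nrm M (P_op g (y - ?dy)) \<le> k * (?a + 1) * nrm (M + M) d"
      by (simp add: algebra_simps)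
    have Cd: "?C d = vcat M M y (P_op g (y - ?dy))"
      unfolding y_def w_def by (rule closed_loop_eq[OF wp L2_imp_L2e[OF d]])
    have "nrm (M + M) (?C d) \<le> nrm M y + nrm M (P_op g (y - ?dy))"
      unfolding Cd by (rule nrm_vcat_le[OF y PL[OF ydy]])
    also have "\<dots> \<le> (?a + k * (?a + 1)) * nrm (M + M) d"
      using ny nu by (simp add: distrib_right)
    also have "\<dots> \<le> (?a + k * (?a + 1) + 1) * nrm (M + M) d" by (intro mult_right_mono) auto
    finally show ?thesis using vcat_L2[OF y PL[OF ydy]] by (simp add: Cd)
  qed
  moreover have "0 < ?a + k * (?a + 1) + 1" using c(1) k(1) by (simp add: add_nonneg_pos)
  ultimately show ?thesis
    using wp C0 unfolding feedback_stable_def stable_system_def is_system_def well_posed_def by blast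
qed

end

section \<open>The uncertain network\<close>

declare One_nat_def [simp del]

locale uncertain_network = partitioned_network +
  fixes H :: "nat \<Rightarrow> sysmap" and \<Lambda> :: "nat \<Rightarrow> nat \<Rightarrow> sysmap"
    and S Sd :: "nat \<Rightarrow> sysmap" and domd :: "nat \<Rightarrow> vsignal set"
    and N D UB VB \<Phi> :: "nat \<Rightarrow> sysmap"
  assumes agents: "\<And>i. i \<in> V \<Longrightarrow> causal (dg i) 1 (H i) \<and> linear_on (L2e (dg i)) (H i)"
    and loop_well_posed: "\<And>\<alpha>. \<alpha> \<in> {0..1} \<Longrightarrow>
      well_posed M M (P_op g) ((\<lambda>w. w + \<alpha> *\<^sub>R (link_op g \<Lambda> w - w)) \<circ> TH_op g H)"
    and nominal: "feedback_stable M M (P_op g) (TH_op g H)"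
    and S_lin: "\<And>i. i \<in> V \<Longrightarrow> S i \<in> L2e 1 \<rightarrow> L2e 1 \<and> linear_on (L2e 1) (S i)"
    and S_dag: "\<And>i. i \<in> V \<Longrightarrow>
      domd i \<subseteq> L2e 1 \<and> subspace (domd i) \<and> Sd i \<in> domd i \<rightarrow> L2e 1 \<and> linear_on (domd i) (Sd i)"
    and range_in_dom: "\<And>u i. u \<in> L2e M \<Longrightarrow> i \<in> V \<Longrightarrow> blk (i - 1) 1 (H_PTH_inv g H u) \<in> domd i"
    and Delta_stable: "stable_system n M (Delta_op g \<Lambda> S)"
    and G_stable: "stable_system M n (G_op g H Sd)"
    and Delta_G: "\<And>u. u \<in> L2e M \<Longrightarrow>
      Delta_op g \<Lambda> S (G_op g H Sd u) =
      ((\<lambda>w. link_op g \<Lambda> w - w) \<circ> (T_op g \<circ> H_PTH_inv g H)) u"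
    and N: "\<And>i. i \<in> V \<Longrightarrow> stable_system (dg i) 1 (N i) \<and> linear_on (L2e (dg i)) (N i)"
    and D: "\<And>i. i \<in> V \<Longrightarrow> stable_system (dg i) (dg i) (D i) \<and> linear_on (L2e (dg i)) (D i)"
    and factorization: "\<And>i. i \<in> V \<Longrightarrow> bij_betw (D i) (L2e (dg i)) (L2e (dg i)) \<and>
      (\<forall>y\<in>L2e (dg i). H i y = N i (inv_into (L2e (dg i)) (D i) y))"
    and UB: "\<And>i. i \<in> V \<Longrightarrow> stable_system 1 (dg i) (UB i) \<and> linear_on (L2e 1) (UB i)"
    and VB: "\<And>i. i \<in> V \<Longrightarrow> stable_system (dg i) (dg i) (VB i) \<and> linear_on (L2e (dg i)) (VB i)"
    and Bezout: "\<And>i z. i \<in> V \<Longrightarrow> z \<in> L2e (dg i) \<Longrightarrow> UB i (N i z) + VB i (D i z) = z"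
    and multipliers: "\<And>i. i \<in> V \<Longrightarrow>
      bounded_linear_L2 (1 + dg i) (1 + dg i) (\<Phi> i) \<and> self_adjoint (1 + dg i) (\<Phi> i)"
    and IQC: "\<And>i y \<alpha>. i \<in> V \<Longrightarrow> y \<in> L2 1 \<Longrightarrow> \<alpha> \<in> {0..1} \<Longrightarrow>
      (let w = vcat 1 (dg i) y (\<alpha> *\<^sub>R local_Delta g \<Lambda> S i y)
       in ip (1 + dg i) w (\<Phi> i w) \<ge> 0)"
    and certificate: "\<And>p. p \<in> {1..c} \<Longrightarrow>
      \<exists>\<epsilon>>0. local_certificate g B c F D (Psi_op g Sd N D \<Phi>) p \<epsilon>"
begin

abbreviation "TH \<equiv> TH_op g H"
abbreviation "\<Delta> \<equiv> Delta_op g \<Lambda> S"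
abbreviation "G \<equiv> G_op g H Sd"

lemma N_closed: "i \<in> V \<Longrightarrow> x \<in> L2e (dg i) \<Longrightarrow> N i x \<in> L2e 1"
  using N causal_closed[OF stable_system_causal] by blast

lemma D_closed: "i \<in> V \<Longrightarrow> x \<in> L2e (dg i) \<Longrightarrow> D i x \<in> L2e (dg i)"
  using D causal_closed[OF stable_system_causal] by blast

lemma H_closed: "i \<in> V \<Longrightarrow> x \<in> L2e (dg i) \<Longrightarrow> H i x \<in> L2e 1"
  using agents causal_closed by blast

lemma H_D: "i \<in> V \<Longrightarrow> x \<in> L2e (dg i) \<Longrightarrow> H i (D i x) = N i x"
  using factorization[of i] D_closed[of i x] by (metis bij_betw_def inv_into_f_f)

lemma N_bounded: "i \<in> V \<Longrightarrow> bounded_linear_L2 (dg i) 1 (N i)"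
  using N stable_linear_bounded by blast

lemma D_bounded: "i \<in> V \<Longrightarrow> bounded_linear_L2 (dg i) (dg i) (D i)"
  using D stable_linear_bounded by blast

lemma TH_L2e: "TH v \<in> L2e M"
  by (simp add: TH_op_def T_op_def M_dsum_L2e)

lemma TH_causal:
  assumes v: "v \<in> L2e M" and \<tau>: "0 \<le> \<tau>"
  shows "vtrunc \<tau> (TH v) = vtrunc \<tau> (TH (vtrunc \<tau> v))"
proof -
  have "causal M n (H_op g H)"
    using causal_dsum[OF finite_verts, of dg ag H] agents by (simp only: H_op_def handshake sum_ag)
  from causal_vtrunc[OF this \<tau> v]
  have h: "vtrunc \<tau> (H_op g H v) = vtrunc \<tau> (H_op g H (vtrunc \<tau> v))" .
  have T: "vtrunc \<tau> (T_op g w) = T_op g (vtrunc \<tau> w)" for w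
    by (simp add: T_op_def dsum_def vtrunc_sum vtrunc_emb ones_op_def vtrunc_mat_op vtrunc_blk)
  show ?thesis by (simp add: TH_op_def T h)
qed

lemma wp_nominal: "well_posed M M (P_op g) TH"
  using nominal by (simp add: feedback_stable_def)

abbreviation "R \<equiv> sol TH"

text \<open>Uniqueness in the nominal loop makes P - T H injective, so \<open>inv_into\<close> in
  \<open>H_PTH_inv\<close> is the genuine inverse.\<close>

lemma H_PTH_inv_eq:
  assumes u: "u \<in> L2e M" shows "H_PTH_inv g H u = H_op g H (R u)"
proof -
  have "inj_on (\<lambda>y. P_op g y - TH y) (L2e M)"
  proof (rule inj_onI)
    fix x y assume "x \<in> L2e M" "y \<in> L2e M" "P_op g x - TH x = P_op g y - TH y"
    then show "x = y"
      using sol_unique[OF wp_nominal L2e_diff[OF P_op_L2e TH_L2e]] by metis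
  qed
  then have "inv_into (L2e M) (\<lambda>y. P_op g y - TH y) u = R u"
    using sol_L2e[OF wp_nominal u] sol_eq[OF wp_nominal u] by (intro inv_into_f_eq)
  then show ?thesis by (simp add: H_PTH_inv_def M_def)
qed

text \<open>The links are only assumed causal. That they vanish at 0 follows from \<Delta> being a
  system and T S being linear: 0 = \<Delta> 0 = \<Lambda> 0.\<close>

lemma link_zero: "link_op g \<Lambda> 0 = 0"
proof -
  have "S_op g S 0 = 0"
  proof -
    have "S i 0 = 0" if "i \<in> V" for i using S_lin[OF that] linear_on_0[of "L2e 1" "S i"] by simp
    then show ?thesis by (simp add: S_op_def dsum_def)
  qed
  moreover have "T_op g 0 = 0" by (simp add: T_op_def dsum_def ones_op_def)
  moreover have "\<Delta> 0 = 0" using Delta_stable by (simp add: stable_system_def is_system_def)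
  ultimately show ?thesis by (simp add: Delta_op_def)
qed

lemma TH_zero: "TH 0 = 0"
proof -
  have "H i 0 = 0" if "i \<in> V" for i using agents[OF that] linear_on_0[of "L2e (dg i)" "H i"] by simp
  then show ?thesis by (simp add: TH_op_def H_op_def T_op_def dsum_def ones_op_def)
qed

section \<open>The homotopy of loops\<close>

definition loop :: "real \<Rightarrow> sysmap" where
  "loop \<alpha> = (\<lambda>w. w + \<alpha> *\<^sub>R (link_op g \<Lambda> w - w)) \<circ> TH"

text \<open>With y the solution of the \<alpha>-loop for w, this is u = (P - T H) y, hence y = R u.
  Existence, uniqueness and causality for u = w + \<alpha> \<Delta> (G u) are read off from the
  well-posed loop.\<close>

definition X :: "real \<Rightarrow> sysmap" where
  "X \<alpha> w = P_op g (sol (loop \<alpha>) w) - TH (sol (loop \<alpha>) w)"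

lemma wp_loop: "\<alpha> \<in> {0..1} \<Longrightarrow> well_posed M M (P_op g) (loop \<alpha>)"
  unfolding loop_def by (rule loop_well_posed)

lemma loop_one: "loop 1 = link_op g \<Lambda> \<circ> TH"
  by (simp add: loop_def comp_def)

lemma Delta_G_R: "u \<in> L2e M \<Longrightarrow> \<Delta> (G u) = link_op g \<Lambda> (TH (R u)) - TH (R u)"
  by (simp add: Delta_G H_PTH_inv_eq TH_op_def)

lemma X_L2e: "X \<alpha> w \<in> L2e M"
  unfolding X_def by (intro L2e_diff P_op_L2e TH_L2e)

lemma R_X:
  assumes "\<alpha> \<in> {0..1}" "w \<in> L2e M" shows "R (X \<alpha> w) = sol (loop \<alpha>) w"
  by (rule sol_unique[OF wp_nominal X_L2e sol_L2e[OF wp_loop[OF assms(1)] assms(2)], symmetric])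
     (simp add: X_def)

lemma X_eq:
  assumes "\<alpha> \<in> {0..1}" "w \<in> L2e M" shows "X \<alpha> w = w + \<alpha> *\<^sub>R \<Delta> (G (X \<alpha> w))"
proof -
  let ?y = "sol (loop \<alpha>) w"
  have "P_op g ?y - loop \<alpha> ?y = w" by (rule sol_eq[OF wp_loop[OF assms(1)] assms(2)])
  then have "P_op g ?y - TH ?y = w + \<alpha> *\<^sub>R (link_op g \<Lambda> (TH ?y) - TH ?y)"
    by (simp add: loop_def algebra_simps)
  then show ?thesis by (simp only: Delta_G_R[OF X_L2e] R_X[OF assms]) (simp only: X_def)
qed

text \<open>For a solution u the signal R u solves the \<alpha>-loop, because P R u - T H R u = u
  and \<Delta> (G u) is the link perturbation at T H R u.\<close>

lemma X_unique:
  assumes \<alpha>: "\<alpha> \<in> {0..1}" and w: "w \<in> L2e M" and u: "u \<in> L2e M" and eq: "u = w + \<alpha> *\<^sub>R \<Delta> (G u)"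
  shows "u = X \<alpha> w"
proof -
  have R: "P_op g (R u) - TH (R u) = u" by (rule sol_eq[OF wp_nominal u])
  have "P_op g (R u) - loop \<alpha> (R u) = u - \<alpha> *\<^sub>R \<Delta> (G u)"
    unfolding Delta_G_R[OF u] using R by (simp add: loop_def algebra_simps)
  also have "\<dots> = w" using eq by (metis add_diff_cancel_right')
  finally have "R u = sol (loop \<alpha>) w" by (rule sol_unique[OF wp_loop[OF \<alpha>] w sol_L2e[OF wp_nominal u]])
  then show ?thesis using R by (simp add: X_def)
qed

lemma X_causal:
  assumes \<alpha>: "\<alpha> \<in> {0..1}" and w: "w \<in> L2e M" and \<tau>: "0 \<le> \<tau>"
  shows "vtrunc \<tau> (X \<alpha> w) = vtrunc \<tau> (X \<alpha> (vtrunc \<tau> w))"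
proof -
  note wp = wp_loop[OF \<alpha>]
  note s = sol_L2e[OF wp w] sol_L2e[OF wp vtrunc_L2e[OF w, of \<tau>]]
  have P: "vtrunc \<tau> (P_op g y) = P_op g (vtrunc \<tau> y)" for y by (simp add: P_op_eq vtrunc_mat_op)
  show ?thesis
    unfolding X_def vtrunc_diff P TH_causal[OF s(1) \<tau>] TH_causal[OF s(2) \<tau>] sol_causal[OF wp w \<tau>] ..
qed

section \<open>Inputs parametrized by the coprime factors\<close>

abbreviation "Dop \<equiv> dsum V dg dg D"
abbreviation "Nop \<equiv> H_op g N"

text \<open>The signals \<open>u\<close> with \<open>R u = D z\<close>, parametrized by \<open>z\<close>.\<close>

definition plant_in :: sysmap where
  "plant_in z = P_op g (Dop z) - T_op g (Nop z)"

lemma cm_Nop: "i \<in> V \<Longrightarrow> cm i (Nop z) = N i (bm i z)"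
  unfolding H_op_def by (rule cm_dsum) (auto intro: N_closed)

lemma bm_Dop: "i \<in> V \<Longrightarrow> bm i (Dop z) = D i (bm i z)"
  by (rule bm_dsum) (auto intro: D_closed)

lemma cm_Hop: "i \<in> V \<Longrightarrow> cm i (H_op g H z) = H i (bm i z)"
  unfolding H_op_def by (rule cm_dsum) (auto intro: H_closed)

lemma H_Dop: "H_op g H (Dop z) = Nop z"
proof (rule n_ext_cm)
  fix i assume i: "i \<in> V"
  show "cm i (H_op g H (Dop z)) = cm i (Nop z)"
    by (simp add: cm_Hop cm_Nop bm_Dop H_D i)
qed (simp_all only: H_op_def n_dsum_L2e)

lemma plant_in_L2e: "plant_in z \<in> L2e M"
  unfolding plant_in_def T_op_def by (intro L2e_diff P_op_L2e M_dsum_L2e)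

text \<open>H D = N turns P D z - T H D z into \<open>plant_in z\<close>, and R is the inverse of P
  - T H.\<close>

lemma R_plant_in: "R (plant_in z) = Dop z"
  by (rule sol_unique[OF wp_nominal plant_in_L2e M_dsum_L2e, symmetric])
     (simp add: plant_in_def TH_op_def H_Dop)

lemma H_PTH_inv_plant_in: "H_PTH_inv g H (plant_in z) = Nop z"
  by (simp add: H_PTH_inv_eq plant_in_L2e R_plant_in H_Dop)

text \<open>\<open>range_in_dom\<close> concerns outputs of H (P - T H)^{-1}; at the input obtained
  by placing x in block i and applying \<open>plant_in\<close>, component i of this output is
  \<open>N i x\<close>. Blocks of size 1 have offset i - 1.\<close>

lemma N_dom:
  assumes i: "i \<in> V" and x: "x \<in> L2e (dg i)" shows "N i x \<in> domd i"
proof -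
  have "blk (i - 1) 1 (H_PTH_inv g H (plant_in (emb (st i) (dg i) x))) \<in> domd i"
    by (rule range_in_dom[OF plant_in_L2e i])
  then show ?thesis
    using cm_Nop[OF i, of "emb (st i) (dg i) x"]
    by (simp add: H_PTH_inv_plant_in offset_ag i blk_emb_same x)
qed

lemma cm_G_plant_in:
  assumes i: "i \<in> V" shows "cm i (G (plant_in z)) = Sd i (N i (bm i z))"
proof -
  have "Sd i (N i (bm i z)) \<in> L2e 1" using S_dag[OF i] N_dom[OF i, of "bm i z"] by auto
  then show ?thesis unfolding G_op_def by (simp add: cm_S_op cm_Nop i H_PTH_inv_plant_in)
qed

lemma bounded_dsum_MM: "(\<And>i. i \<in> V \<Longrightarrow> bounded_linear_L2 (dg i) (dg i) (A i)) \<Longrightarrow> bounded_linear_L2 M M (dsum V dg dg A)"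
  using bounded_L2_dsum[OF finite_verts, of dg dg A] by (simp add: handshake)

lemma bounded_dsum_Mn: "(\<And>i. i \<in> V \<Longrightarrow> bounded_linear_L2 (dg i) 1 (A i)) \<Longrightarrow> bounded_linear_L2 M n (dsum V dg ag A)"
  using bounded_L2_dsum[OF finite_verts, of dg ag A] by (simp only: handshake sum_ag)

lemma bounded_dsum_nn: "(\<And>i. i \<in> V \<Longrightarrow> bounded_linear_L2 1 1 (A i)) \<Longrightarrow> bounded_linear_L2 n n (dsum V ag ag A)"
  using bounded_L2_dsum[OF finite_verts, of ag ag A] by (simp only: sum_ag)

lemma T_op_bounded: "bounded_linear_L2 n M (T_op g)"
  using bounded_L2_dsum[OF finite_verts, of ag dg "\<lambda>i. ones_op (dg i)"]
  by (simp only: T_op_def handshake sum_ag bounded_L2_ones_op)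

lemma plant_in_bounded: "bounded_linear_L2 M M plant_in"
  unfolding plant_in_def[abs_def] H_op_def
  by (intro bounded_L2_minus bounded_L2_comp[OF bounded_dsum_MM bounded_L2_P_op]
      bounded_L2_comp[OF bounded_dsum_Mn T_op_bounded] D_bounded N_bounded)

lemma start_cm_le: "i \<in> V \<Longrightarrow> offset V ag i + 1 \<le> n"
  using offset_le[OF finite_verts, of i ag] by (simp only: sum_ag)

text \<open>\<open>S\<^sub>i\<^sup>\<dagger> N\<^sub>i\<close> is bounded although \<open>S\<^sub>i\<^sup>\<dagger>\<close> need not be: it is a block of \<open>G (P D - T N)\<close>.\<close>

lemma SdN_bounded:
  assumes i: "i \<in> V" shows "bounded_linear_L2 (dg i) 1 (\<lambda>x. Sd i (N i x))"
proof -
  obtain cG where cG: "0 < cG" "\<And>u. u \<in> L2 M \<Longrightarrow> G u \<in> L2 n" "\<And>u. u \<in> L2 M \<Longrightarrow> nrm n (G u) \<le> cG * nrm M u"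
    using stable_system_bound[OF G_stable] by metis
  obtain cu where cu: "0 \<le> cu" "\<And>z. z \<in> L2 M \<Longrightarrow> nrm M (plant_in z) \<le> cu * nrm M z"
    using bounded_L2_bound[OF plant_in_bounded] by metis
  have eq: "Sd i (N i x) = cm i (G (plant_in (emb (st i) (dg i) x)))" if "x \<in> L2e (dg i)" for x
    using that by (simp add: cm_G_plant_in[OF i] blk_emb_same)
  \<comment> \<open>Linearity is taken from \<open>N i\<close> and from \<open>Sd i\<close> on its
    domain, the bound from G.\<close>
  have linN: "linear_on (L2e (dg i)) (N i)" and linS: "linear_on (domd i) (Sd i)"
    using N[OF i] S_dag[OF i] by auto
  show ?thesis
  proof (rule bounded_L2I[where c = "cG * cu"])
    fix x assume x: "x \<in> L2 (dg i)"
    let ?z = "emb (st i) (dg i) x"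
    have z: "?z \<in> L2 M" "nrm M ?z = nrm (dg i) x"
      using start_le[OF i] x by (auto intro: emb_L2 nrm_emb)
    have pz: "plant_in ?z \<in> L2 M" by (rule bounded_L2_closed[OF plant_in_bounded z(1)])
    show "Sd i (N i x) \<in> L2 1" unfolding eq[OF L2_imp_L2e[OF x]] by (rule blk_L2[OF cG(2)[OF pz]])
    have "nrm 1 (Sd i (N i x)) \<le> nrm n (G (plant_in ?z))"
      unfolding eq[OF L2_imp_L2e[OF x]] by (rule nrm_blk_le[OF start_cm_le[OF i] cG(2)[OF pz]])
    also have "\<dots> \<le> cG * nrm M (plant_in ?z)" by (rule cG(3)[OF pz])
    also have "\<dots> \<le> cG * (cu * nrm M ?z)" using cG(1) cu(2)[OF z(1)] by (intro mult_left_mono) auto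
    finally show "nrm 1 (Sd i (N i x)) \<le> cG * cu * nrm (dg i) x" by (simp add: z(2) mult.assoc)
    fix y assume y: "y \<in> L2 (dg i)"
    show "Sd i (N i (x + y)) = Sd i (N i x) + Sd i (N i y)"
      using linear_on_add[OF linN L2_imp_L2e[OF x] L2_imp_L2e[OF y]]
        linear_on_add[OF linS N_dom[OF i L2_imp_L2e[OF x]] N_dom[OF i L2_imp_L2e[OF y]]] by simp
  next
    fix a x assume x: "x \<in> L2 (dg i)"
    show "Sd i (N i (a *\<^sub>R x)) = a *\<^sub>R Sd i (N i x)"
      using linear_on_scaleR[OF linN L2_imp_L2e[OF x]]
        linear_on_scaleR[OF linS N_dom[OF i L2_imp_L2e[OF x]]] by simp
  qed
qed

text \<open>Block i of the operator with rows (N, 0) and (J, -I), by which \<Psi> is obtained from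
  \<Pi>.\<close>

definition rho :: "nat \<Rightarrow> vsignal \<Rightarrow> vsignal \<Rightarrow> vsignal" where
  "rho i a b = vcat 1 (dg i) (Sd i (N i a)) (D i a - ones_op (dg i) (N i a) - b)"

lemma J_bounded: "i \<in> V \<Longrightarrow> bounded_linear_L2 (dg i) (dg i) (\<lambda>a. D i a - ones_op (dg i) (N i a))"
  by (intro bounded_L2_minus D_bounded bounded_L2_comp[OF N_bounded bounded_L2_ones_op])

lemma rho_L2: "i \<in> V \<Longrightarrow> a \<in> L2 (dg i) \<Longrightarrow> b \<in> L2 (dg i) \<Longrightarrow> rho i a b \<in> L2 (1 + dg i)"
  unfolding rho_def
  by (intro vcat_L2 L2_diff[of "D i a - _"] bounded_L2_closed[OF J_bounded]
      bounded_L2_closed[OF SdN_bounded])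

lemma rho_split: "i \<in> V \<Longrightarrow> a \<in> L2 (dg i) \<Longrightarrow> b \<in> L2 (dg i) \<Longrightarrow> rho i a b = rho i a 0 + rho i 0 b"
  using bounded_L2_0[OF SdN_bounded, of i] bounded_L2_0[OF J_bounded, of i]
  by (simp add: rho_def flip: vcat_add)

lemma rho_0: "i \<in> V \<Longrightarrow> rho i 0 0 = 0"
  using bounded_L2_0[OF SdN_bounded, of i] bounded_L2_0[OF J_bounded, of i]
  by (simp add: rho_def)

section \<open>Multiplier forms computed by blocks\<close>

lemma Pi_op_eq: "Pi_op g \<Phi> = op22 n M n M (Pi1_op g \<Phi>) (Pi2_op g \<Phi>) (adj M n (Pi2_op g \<Phi>)) (Pi3_op g \<Phi>)"
  by (simp add: Pi_op_def Let_def M_def)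

lemma cut_Phi_bounded:
  assumes i: "i \<in> V"
  shows "bounded_linear_L2 1 1 (cut 0 1 0 1 (\<Phi> i))"
    "bounded_linear_L2 (dg i) 1 (cut 1 (dg i) 0 1 (\<Phi> i))"
    "bounded_linear_L2 (dg i) (dg i) (cut 1 (dg i) 1 (dg i) (\<Phi> i))"
  using multipliers[OF i] by (auto intro!: bounded_L2_cut[of "1 + dg i" "1 + dg i"])

lemma Pi_parts_bounded:
  "bounded_linear_L2 n n (Pi1_op g \<Phi>)" "bounded_linear_L2 M n (Pi2_op g \<Phi>)" "bounded_linear_L2 M M (Pi3_op g \<Phi>)"
  unfolding Pi1_op_def Pi2_op_def Pi3_op_def
  by (intro bounded_dsum_nn bounded_dsum_Mn bounded_dsum_MM cut_Phi_bounded; assumption)+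

lemma Pi_bounded: "bounded_linear_L2 (n + M) (n + M) (Pi_op g \<Phi>)"
  unfolding Pi_op_eq
  by (intro bounded_L2_op22 Pi_parts_bounded adj_bounded_linear)

lemma ip_n: "v \<in> L2 n \<Longrightarrow> w \<in> L2 n \<Longrightarrow> ip n v w = (\<Sum>i\<in>V. ip 1 (cm i v) (cm i w))"
  using ip_blocks[OF finite_verts, of v ag w] by (simp only: sum_ag)

lemma ip_M: "v \<in> L2 M \<Longrightarrow> w \<in> L2 M \<Longrightarrow> ip M v w = (\<Sum>i\<in>V. ip (dg i) (bm i v) (bm i w))"
  using ip_blocks[OF finite_verts, of v dg w] by (simp add: handshake start_def)

text \<open>Both sides expand into four block terms: for \<Pi> the lower left block is an adjoint by
  definition, for \<open>\<Phi> i\<close> by self-adjointness. Two different arguments are allowed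
  because \<open>Psi2\<close> pairs different ones.\<close>

lemma Pi_form:
  assumes y: "y \<in> L2 n" "y' \<in> L2 n" and v: "v \<in> L2 M" "v' \<in> L2 M"
  shows "ip (n + M) (vcat n M y v) (Pi_op g \<Phi> (vcat n M y' v'))
    = (\<Sum>i\<in>V. ip (1 + dg i) (vcat 1 (dg i) (cm i y) (bm i v)) (\<Phi> i (vcat 1 (dg i) (cm i y') (bm i v'))))"
proof -
  note pb = Pi_parts_bounded
  have c1: "cm i (Pi1_op g \<Phi> w) = cut 0 1 0 1 (\<Phi> i) (cm i w)" if "i \<in> V" for i w
    unfolding Pi1_op_def
    using blk_dsum[OF finite_verts that, of "\<lambda>i. cut 0 1 0 1 (\<Phi> i)" ag w ag] by (simp add: cut_def)
  have c2: "cm i (Pi2_op g \<Phi> w) = cut 1 (dg i) 0 1 (\<Phi> i) (bm i w)" if "i \<in> V" for i w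
    unfolding Pi2_op_def by (rule cm_dsum[OF that]) (simp add: cut_def)
  have c3: "bm i (Pi3_op g \<Phi> w) = cut 1 (dg i) 1 (dg i) (\<Phi> i) (bm i w)" if "i \<in> V" for i w
    unfolding Pi3_op_def by (rule bm_dsum[OF that]) (simp add: cut_def)
  have "ip (n + M) (vcat n M y v) (Pi_op g \<Phi> (vcat n M y' v'))
    = ip n y (Pi1_op g \<Phi> y') + ip n y (Pi2_op g \<Phi> v') + ip n (Pi2_op g \<Phi> v) y' + ip M v (Pi3_op g \<Phi> v')"
    unfolding Pi_op_eq by (rule ip_op22_symmetric[OF pb y v])
  also have "\<dots> = (\<Sum>i\<in>V. ip 1 (cm i y) (cut 0 1 0 1 (\<Phi> i) (cm i y')))
      + (\<Sum>i\<in>V. ip 1 (cm i y) (cut 1 (dg i) 0 1 (\<Phi> i) (bm i v')))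
      + (\<Sum>i\<in>V. ip 1 (cut 1 (dg i) 0 1 (\<Phi> i) (bm i v)) (cm i y'))
      + (\<Sum>i\<in>V. ip (dg i) (bm i v) (cut 1 (dg i) 1 (dg i) (\<Phi> i) (bm i v')))"
    using y v pb[THEN bounded_L2_closed]
    by (simp add: ip_n ip_M c1 c2 c3)
  also have "\<dots> = (\<Sum>i\<in>V. ip (1 + dg i) (vcat 1 (dg i) (cm i y) (bm i v))
      (\<Phi> i (vcat 1 (dg i) (cm i y') (bm i v'))))"
    unfolding sum.distrib[symmetric]
  proof (rule sum.cong[OF refl])
    fix i assume i: "i \<in> V"
    show "ip 1 (cm i y) (cut 0 1 0 1 (\<Phi> i) (cm i y')) + ip 1 (cm i y) (cut 1 (dg i) 0 1 (\<Phi> i) (bm i v'))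
        + ip 1 (cut 1 (dg i) 0 1 (\<Phi> i) (bm i v)) (cm i y')
        + ip (dg i) (bm i v) (cut 1 (dg i) 1 (dg i) (\<Phi> i) (bm i v'))
      = ip (1 + dg i) (vcat 1 (dg i) (cm i y) (bm i v)) (\<Phi> i (vcat 1 (dg i) (cm i y') (bm i v')))"
      by (rule ip_vcat_block_form[symmetric]) (use multipliers[OF i] blk_L2 y v in blast)+
  qed
  finally show ?thesis .
qed

lemma bm_Delta: assumes i: "i \<in> V" shows "bm i (\<Delta> y) = local_Delta g \<Lambda> S i (cm i y)"
proof -
  have "cm i (S_op g S y) = S i (cm i y)" by (rule cm_S_op[OF i]) (use S_lin[OF i] in auto)
  then have T: "bm i (T_op g (S_op g S y)) = ones_op (dg i) (S i (cm i y))" by (simp add: bm_T_op i)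
  have "local_link g \<Lambda> i w \<in> L2e (dg i)" for w
    using dsum_L2e[of "{1..dg i}" ag ag "\<Lambda> i" w] by (simp add: local_link_def)
  then have "bm i (link_op g \<Lambda> w) = local_link g \<Lambda> i (bm i w)" for w
    unfolding link_op_def by (intro bm_dsum i)
  then show ?thesis by (simp add: Delta_op_def local_Delta_def blk_diff T)
qed

text \<open>The local constraints add up, since \<Delta> acts blockwise and the common \<alpha>
  scales every block.\<close>

lemma Delta_IQC:
  assumes \<alpha>: "\<alpha> \<in> {0..1}" and y: "y \<in> L2 n"
  shows "0 \<le> ip (n + M) (vcat n M y (\<alpha> *\<^sub>R \<Delta> y)) (Pi_op g \<Phi> (vcat n M y (\<alpha> *\<^sub>R \<Delta> y)))"
proof -
  have Dy: "\<alpha> *\<^sub>R \<Delta> y \<in> L2 M"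
    using Delta_stable y by (intro L2_scaleR) (auto simp: stable_system_def)
  have "0 \<le> ip (1 + dg i) (vcat 1 (dg i) (cm i y) (\<alpha> *\<^sub>R local_Delta g \<Lambda> S i (cm i y)))
      (\<Phi> i (vcat 1 (dg i) (cm i y) (\<alpha> *\<^sub>R local_Delta g \<Lambda> S i (cm i y))))" if "i \<in> V" for i
    using IQC[OF that blk_L2[OF y] \<alpha>] by (simp only: Let_def)
  then show ?thesis
    unfolding Pi_form[OF y y Dy Dy] by (intro sum_nonneg) (simp only: blk_scaleR bm_Delta)
qed

abbreviation "\<Psi> \<equiv> Psi_op g Sd N D \<Phi>"

abbreviation "Rop \<equiv> op22 n M M M (N_op g Sd N) (\<lambda>_. 0) (J_op g N D) (\<lambda>w. - w)"

lemma Psi_eq: "\<Psi> = adj (M + M) (n + M) Rop \<circ> Pi_op g \<Phi> \<circ> Rop"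
  by (simp add: Psi_op_def Let_def M_def)

lemma N_op_bounded: "bounded_linear_L2 M n (N_op g Sd N)"
  unfolding N_op_def comp_def by (intro bounded_dsum_Mn SdN_bounded)

lemma J_op_bounded: "bounded_linear_L2 M M (J_op g N D)"
  unfolding J_op_def by (intro bounded_dsum_MM J_bounded)

lemma Rop_bounded: "bounded_linear_L2 (M + M) (n + M) Rop"
  by (intro bounded_L2_op22 N_op_bounded J_op_bounded bounded_L2_zero bounded_L2_uminus)

lemma Psi_bounded: "bounded_linear_L2 (M + M) (M + M) \<Psi>"
  unfolding Psi_eq comp_def
  by (intro bounded_L2_comp[OF bounded_L2_comp[OF Rop_bounded Pi_bounded]]
      adj_bounded_linear Rop_bounded)

text \<open>The outer adjoint moves to the left argument, and what remains is the form of \<Pi> at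
  two images of \<open>Rop\<close>, whose blocks are \<open>rho\<close>.\<close>

lemma Psi_form:
  assumes "z \<in> L2 M" "z' \<in> L2 M" "w \<in> L2 M" "w' \<in> L2 M"
  shows "ip (M + M) (vcat M M z w) (\<Psi> (vcat M M z' w'))
    = (\<Sum>j\<in>V. ip (1 + dg j) (rho j (bm j z) (bm j w)) (\<Phi> j (rho j (bm j z') (bm j w'))))"
proof -
  have R: "Rop (vcat M M z w) = vcat n M (N_op g Sd N z) (J_op g N D z - w)" if "z \<in> L2 M" "w \<in> L2 M" for z w
    using that by (simp add: op22_vcat L2_imp_L2e)
  have c: "cm j (N_op g Sd N z) = Sd j (N j (bm j z))" if "j \<in> V" for j z
  proof -
    have "Sd j (N j (bm j z)) \<in> L2e 1" using S_dag[OF that] N_dom[OF that, of "bm j z"] by auto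
    then show ?thesis unfolding N_op_def using cm_dsum[OF that, of "\<lambda>i. Sd i \<circ> N i"] by simp
  qed
  have b: "bm j (J_op g N D z - w) = D j (bm j z) - ones_op (dg j) (N j (bm j z)) - bm j w" if "j \<in> V" for j z w
  proof -
    have "bm j (J_op g N D z) = D j (bm j z) - ones_op (dg j) (N j (bm j z))"
      unfolding J_op_def by (rule bm_dsum[OF that]) (intro L2e_diff D_closed that blk_L2e ones_op_L2e)
    then show ?thesis by (simp add: blk_diff)
  qed
  have NL: "N_op g Sd N z \<in> L2 n" "J_op g N D z - w \<in> L2 M" if "z \<in> L2 M" "w \<in> L2 M" for z w
    using that bounded_L2_closed[OF N_op_bounded] bounded_L2_closed[OF J_op_bounded]
    by (auto intro: L2_diff)
  have L: "vcat M M z w \<in> L2 (M + M)" "vcat M M z' w' \<in> L2 (M + M)" using assms by (auto intro: vcat_L2)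
  have "ip (M + M) (vcat M M z w) (\<Psi> (vcat M M z' w'))
      = ip (n + M) (Rop (vcat M M z w)) (Pi_op g \<Phi> (Rop (vcat M M z' w')))"
    unfolding Psi_eq comp_def
    by (intro adj_inner[OF Rop_bounded] L bounded_L2_closed[OF Pi_bounded] bounded_L2_closed[OF Rop_bounded])
  also have "\<dots> = (\<Sum>j\<in>V. ip (1 + dg j) (vcat 1 (dg j) (cm j (N_op g Sd N z)) (bm j (J_op g N D z - w)))
      (\<Phi> j (vcat 1 (dg j) (cm j (N_op g Sd N z')) (bm j (J_op g N D z' - w')))))"
    using assms by (simp only: R Pi_form NL)
  also have "\<dots> = (\<Sum>j\<in>V. ip (1 + dg j) (rho j (bm j z) (bm j w)) (\<Phi> j (rho j (bm j z') (bm j w'))))"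
    by (rule sum.cong[OF refl]) (simp only: c b rho_def)
  finally show ?thesis .
qed

text \<open>Vectors supported in block i make every other \<open>rho\<close> vanish. In this form
  the block-diagonal structure of \<Psi> is used.\<close>

lemma Psi_form_block:
  assumes i: "i \<in> V" and "a \<in> L2 (dg i)" "a' \<in> L2 (dg i)" "b \<in> L2 (dg i)" "b' \<in> L2 (dg i)"
  defines "E \<equiv> emb (st i) (dg i)"
  shows "ip (M + M) (vcat M M (E a) (E b)) (\<Psi> (vcat M M (E a') (E b')))
    = ip (1 + dg i) (rho i a b) (\<Phi> i (rho i a' b'))"
proof -
  have bE: "bm j (E x) = (if j = i then x else 0)" if "j \<in> V" "x \<in> L2 (dg i)" for j x
  proof (cases "j = i")
    case False
    then show ?thesis using offset_disjoint[OF finite_verts that(1) i False, of dg]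
      by (simp add: E_def blk_emb_disjoint start_def)
  qed (use that in \<open>simp add: E_def blk_emb_same L2_imp_L2e\<close>)
  have EL: "E x \<in> L2 M" if "x \<in> L2 (dg i)" for x unfolding E_def by (rule emb_L2[OF start_le[OF i] that])
  have "ip (M + M) (vcat M M (E a) (E b)) (\<Psi> (vcat M M (E a') (E b')))
      = (\<Sum>j\<in>V. ip (1 + dg j) (rho j (bm j (E a)) (bm j (E b))) (\<Phi> j (rho j (bm j (E a')) (bm j (E b')))))"
    using assms by (intro Psi_form EL)
  also have "\<dots> = (\<Sum>j\<in>V. if j = i then ip (1 + dg i) (rho i a b) (\<Phi> i (rho i a' b')) else 0)"
    by (rule sum.cong[OF refl]) (simp add: bE rho_0 assms(1-5))
  also have "\<dots> = ip (1 + dg i) (rho i a b) (\<Phi> i (rho i a' b'))" using i by simp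
  finally show ?thesis .
qed

text \<open>A cut-out block is tested by embedding both vectors, as \<open>emb\<close> is adjoint to
  \<open>blk\<close>. These forms, together with boundedness, take the place of formulas for the
  operators.\<close>

lemma Psi_blocks:
  assumes i: "i \<in> V" and a: "a \<in> L2 (dg i)" "a' \<in> L2 (dg i)"
  shows "ip (dg i) a (Psi1 g \<Psi> i a') = ip (1 + dg i) (rho i a 0) (\<Phi> i (rho i a' 0))"
    and "ip (dg i) a (Psi2 g \<Psi> i a') = ip (1 + dg i) (rho i a 0) (\<Phi> i (rho i 0 a'))"
    and "ip (dg i) a (Psi3 g \<Psi> i a') = ip (1 + dg i) (rho i 0 a) (\<Phi> i (rho i 0 a'))"
proof -
  let ?E = "emb (st i) (dg i)"
  have v: "emb 0 M x = vcat M M x 0" "emb M M x = vcat M M 0 x" for x by (simp_all add: vcat_def)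
  have s: "st i + dg i \<le> M" by (rule start_le[OF i])
  have "ip (dg i) a (Psi1 g \<Psi> i a') = ip (M + M) (emb 0 M (?E a)) (\<Psi> (emb 0 M (?E a')))"
    by (simp add: Psi1_def Let_def cut_def ip_emb s flip: M_def)
  then show "ip (dg i) a (Psi1 g \<Psi> i a') = ip (1 + dg i) (rho i a 0) (\<Phi> i (rho i a' 0))"
    using Psi_form_block[OF i a L2_0 L2_0] by (simp add: v)
  have "ip (dg i) a (Psi2 g \<Psi> i a') = ip (M + M) (emb 0 M (?E a)) (\<Psi> (emb M M (?E a')))"
    by (simp add: Psi2_def Let_def cut_def ip_emb s flip: M_def)
  then show "ip (dg i) a (Psi2 g \<Psi> i a') = ip (1 + dg i) (rho i a 0) (\<Phi> i (rho i 0 a'))"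
    using Psi_form_block[OF i a(1) L2_0 L2_0 a(2)] by (simp add: v)
  have "ip (dg i) a (Psi3 g \<Psi> i a') = ip (M + M) (emb M M (?E a)) (\<Psi> (emb M M (?E a')))"
    by (simp add: Psi3_def Let_def cut_def ip_emb s flip: M_def)
  then show "ip (dg i) a (Psi3 g \<Psi> i a') = ip (1 + dg i) (rho i 0 a) (\<Phi> i (rho i 0 a'))"
    using Psi_form_block[OF i L2_0 L2_0 a] by (simp add: v)
qed

lemma Psi_blocks_bounded:
  assumes i: "i \<in> V"
  shows "bounded_linear_L2 (dg i) (dg i) (Psi1 g \<Psi> i)" "bounded_linear_L2 (dg i) (dg i) (Psi2 g \<Psi> i)"
    "bounded_linear_L2 (dg i) (dg i) (Psi3 g \<Psi> i)"
  unfolding Psi1_def Psi2_def Psi3_def Let_def M_def[symmetric]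
  by (rule bounded_L2_cut[OF bounded_L2_cut[OF Psi_bounded] start_le[OF i] start_le[OF i]]; simp)+

text \<open>Self-adjointness of \<open>\<Phi> i\<close> merges the two mixed terms, hence the factor
  2; the rest is bilinearity in the columns \<open>b k\<close>.\<close>

lemma rho_form_expand:
  assumes i: "i \<in> V" and a: "a \<in> L2 (dg i)" and b: "\<And>k. k \<in> I \<Longrightarrow> b k \<in> L2 (dg i)"
  defines "w \<equiv> \<Sum>k\<in>I. b k"
  shows "ip (1 + dg i) (rho i a w) (\<Phi> i (rho i a w))
    = ip (dg i) a (Psi1 g \<Psi> i a) + 2 * (\<Sum>k\<in>I. ip (dg i) a (Psi2 g \<Psi> i (b k)))
      + (\<Sum>k\<in>I. \<Sum>l\<in>I. ip (dg i) (b k) (Psi3 g \<Psi> i (b l)))"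
proof -
  let ?d = "1 + dg i" and ?a = "rho i a 0" and ?w = "rho i 0 w"
  have \<Phi>: "bounded_linear_L2 ?d ?d (\<Phi> i)" and sa: "self_adjoint ?d (\<Phi> i)" using multipliers[OF i] by auto
  have w: "w \<in> L2 (dg i)" unfolding w_def by (intro L2_sum b)
  have L: "?a \<in> L2 ?d" "?w \<in> L2 ?d" by (intro rho_L2 i a w L2_0)+
  note \<Phi>L = L[THEN bounded_L2_closed[OF \<Phi>]]
  have "ip ?d (rho i a w) (\<Phi> i (rho i a w)) = ip ?d ?a (\<Phi> i ?a) + ip ?d ?a (\<Phi> i ?w) + ip ?d ?w (\<Phi> i ?a) + ip ?d ?w (\<Phi> i ?w)"
    unfolding rho_split[OF i a w] bounded_L2_add[OF \<Phi> L]
    using L \<Phi>L by (simp add: ip_add_left ip_add_right L2_add)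
  also have "ip ?d ?w (\<Phi> i ?a) = ip ?d ?a (\<Phi> i ?w)"
    using self_adjoint_inner[OF \<Phi> sa L(2,1)] by (simp add: ip_commute)
  also have "ip ?d ?a (\<Phi> i ?a) + ip ?d ?a (\<Phi> i ?w) + ip ?d ?a (\<Phi> i ?w) + ip ?d ?w (\<Phi> i ?w)
      = ip (dg i) a (Psi1 g \<Psi> i a) + 2 * ip (dg i) a (Psi2 g \<Psi> i w) + ip (dg i) w (Psi3 g \<Psi> i w)"
    by (simp add: Psi_blocks[OF i] a w)
  also have "ip (dg i) a (Psi2 g \<Psi> i w) = (\<Sum>k\<in>I. ip (dg i) a (Psi2 g \<Psi> i (b k)))"
    unfolding w_def using a b bounded_L2_closed[OF Psi_blocks_bounded(2)[OF i]]
    by (simp add: bounded_L2_sum[OF Psi_blocks_bounded(2)[OF i]] ip_sum_right)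
  also have "ip (dg i) w (Psi3 g \<Psi> i w) = (\<Sum>k\<in>I. ip (dg i) (b k) (Psi3 g \<Psi> i w))"
    using b bounded_L2_closed[OF Psi_blocks_bounded(3)[OF i] w] unfolding w_def by (simp add: ip_sum_left)
  also have "\<dots> = (\<Sum>k\<in>I. \<Sum>l\<in>I. ip (dg i) (b k) (Psi3 g \<Psi> i (b l)))"
    unfolding w_def using b bounded_L2_closed[OF Psi_blocks_bounded(3)[OF i]]
    by (simp add: bounded_L2_sum[OF Psi_blocks_bounded(3)[OF i]] ip_sum_right)
  finally show ?thesis .
qed

text \<open>In block i, \<open>plant_in z\<close> equals J_i z_i minus block i of L D z, and the
  latter is the sum of the columns \<open>b k i\<close>. So block i of (G u, u) is
  \<open>rho i (zi i)\<close> at this sum, and \<open>certificate_sum\<close> applies to the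
  expanded forms.\<close>

lemma plant_dissipative:
  "\<exists>e>0. \<forall>z\<in>L2 M. ip (n + M) (vcat n M (G (plant_in z)) (plant_in z))
     (Pi_op g \<Phi> (vcat n M (G (plant_in z)) (plant_in z))) \<le> - e * (nrm M z)\<^sup>2"
proof -
  obtain \<epsilon> where \<epsilon>: "\<And>p. p \<in> {1..c} \<Longrightarrow> \<epsilon> p > 0"
    "\<And>p. p \<in> {1..c} \<Longrightarrow> local_certificate g B c F D \<Psi> p (\<epsilon> p)"
    using certificate by metis
  have "1 \<in> V" using graph by (auto simp: verts_def network_graph_def)
  then have c: "{1..c} \<noteq> {}" using vert_covered by blast
  \<comment> \<open>The least margin is positive because there are finitely many parts, and there is
    at least one, as vertex 1 is covered.\<close>
  define e where "e = Min (\<epsilon> ` {1..c})"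
  have e0: "0 < e" unfolding e_def using c \<epsilon>(1) by (subst Min_gr_iff) auto
  have e: "e \<le> \<epsilon> p" if "p \<in> {1..c}" for p unfolding e_def by (rule Min_le) (use that in auto)
  show ?thesis
  proof (intro exI[of _ e] conjI e0 ballI)
    fix z assume z: "z \<in> L2 M"
    let ?m = "{1..size_m g}"
    define zi where "zi i = bm i z" for i
    define b where "b k i = edge_col k i (edge_diff V k (\<lambda>i. D i (zi i)))" for k i
    have zi: "zi i \<in> L2 (dg i)" for i unfolding zi_def by (rule blk_L2[OF z])
    have Dz: "D i (zi i) \<in> L2 (dg i)" if "i \<in> V" for i
      by (rule bounded_L2_closed[OF D_bounded[OF that] zi])
    have bL: "b k i \<in> L2 (dg i)" for k i
      unfolding b_def by (intro edge_col_L2 edge_diff_finite_energy Dz)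
    have b0: "b k i = 0" if "i \<in> V" "k \<in> ?m" "i \<notin> link_edge g k" for i k
      unfolding b_def by (rule edge_col_eq_0[OF that(2,1,3)])
    have Dop: "Dop z = stack V dg (\<lambda>i. D i (zi i))"
      by (simp add: dsum_eq_stack zi_def start_def)
    have sumb: "(\<Sum>k\<in>?m. b k i) = D i (zi i) - bm i (P_op g (Dop z))" if "i \<in> V" for i
      unfolding b_def Dop by (rule block_P_op[OF L2_imp_L2e[OF Dz] that])
    have pin: "plant_in z \<in> L2 M" by (rule bounded_L2_closed[OF plant_in_bounded z])
    have Gpin: "G (plant_in z) \<in> L2 n" using G_stable pin by (auto simp: stable_system_def)
    have rho: "vcat 1 (dg i) (cm i (G (plant_in z))) (bm i (plant_in z)) = rho i (zi i) (\<Sum>k\<in>?m. b k i)"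
      if i: "i \<in> V" for i
    proof -
      have "bm i (plant_in z) = bm i (P_op g (Dop z)) - ones_op (dg i) (N i (zi i))"
        unfolding plant_in_def blk_diff by (simp add: bm_T_op i cm_Nop zi_def)
      then show ?thesis
        unfolding rho_def sumb[OF i] cm_G_plant_in[OF i] by (simp add: zi_def)
    qed
    have le: "(\<Sum>i\<in>V. ip (dg i) (zi i) (Psi1 g \<Psi> i (zi i)))
        + 2 * (\<Sum>k\<in>?m. \<Sum>i\<in>V. ip (dg i) (zi i) (Psi2 g \<Psi> i (b k i)))
        + (\<Sum>k\<in>?m. \<Sum>l\<in>?m. \<Sum>i\<in>V. ip (dg i) (b k i) (Psi3 g \<Psi> i (b l i)))
        \<le> - e * (\<Sum>i\<in>V. ip (dg i) (zi i) (zi i))"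
    proof (rule certificate_sum[where \<epsilon> = \<epsilon>])
      fix p assume p: "p \<in> {1..c}"
      show "e \<le> \<epsilon> p" by (rule e[OF p])
      show "weighted_form p (\<lambda>i. ip (dg i) (zi i) (Psi1 g \<Psi> i (zi i)) + \<epsilon> p * ip (dg i) (zi i) (zi i))
          (\<lambda>i k. ip (dg i) (zi i) (Psi2 g \<Psi> i (b k i)))
          (\<lambda>i k l. ip (dg i) (b k i) (Psi3 g \<Psi> i (b l i))) \<le> 0"
        unfolding b_def
        by (rule local_certificate_expand[OF p D_bounded Psi_blocks_bounded zi \<epsilon>(2)[OF p]])
    next
      fix i k assume "i \<in> V" "k \<in> ?m" "i \<notin> link_edge g k"
      then show "ip (dg i) (zi i) (Psi2 g \<Psi> i (b k i)) = 0"
        using bounded_L2_0[OF Psi_blocks_bounded(2), of i] by (simp add: b0)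
    next
      fix i k l assume "i \<in> V" "k \<in> ?m" "l \<in> ?m" "i \<notin> link_edge g k \<or> i \<notin> link_edge g l"
      then show "ip (dg i) (b k i) (Psi3 g \<Psi> i (b l i)) = 0"
        using bounded_L2_0[OF Psi_blocks_bounded(3), of i] b0[of i k] b0[of i l] by auto
    qed (rule ip_nonneg)
    have "ip (n + M) (vcat n M (G (plant_in z)) (plant_in z)) (Pi_op g \<Phi> (vcat n M (G (plant_in z)) (plant_in z)))
      = (\<Sum>i\<in>V. ip (1 + dg i) (rho i (zi i) (\<Sum>k\<in>?m. b k i)) (\<Phi> i (rho i (zi i) (\<Sum>k\<in>?m. b k i))))"
      unfolding Pi_form[OF Gpin Gpin pin pin] by (rule sum.cong[OF refl]) (simp only: rho)
    also have "\<dots> = (\<Sum>i\<in>V. ip (dg i) (zi i) (Psi1 g \<Psi> i (zi i))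
        + 2 * (\<Sum>k\<in>?m. ip (dg i) (zi i) (Psi2 g \<Psi> i (b k i)))
        + (\<Sum>k\<in>?m. \<Sum>l\<in>?m. ip (dg i) (b k i) (Psi3 g \<Psi> i (b l i))))"
      by (rule sum.cong[OF refl]) (rule rho_form_expand[OF _ zi bL])
    also have "\<dots> = (\<Sum>i\<in>V. ip (dg i) (zi i) (Psi1 g \<Psi> i (zi i)))
        + 2 * (\<Sum>k\<in>?m. \<Sum>i\<in>V. ip (dg i) (zi i) (Psi2 g \<Psi> i (b k i)))
        + (\<Sum>k\<in>?m. \<Sum>l\<in>?m. \<Sum>i\<in>V. ip (dg i) (b k i) (Psi3 g \<Psi> i (b l i)))"
      unfolding sum.distrib sum_distrib_left[symmetric] sum.swap[of _ ?m V] ..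
    also have "\<dots> \<le> - e * (\<Sum>i\<in>V. ip (dg i) (zi i) (zi i))" by (rule le)
    also have "(\<Sum>i\<in>V. ip (dg i) (zi i) (zi i)) = (nrm M z)\<^sup>2"
      unfolding nrm_square zi_def by (rule ip_M[OF z z, symmetric])
    finally show "ip (n + M) (vcat n M (G (plant_in z)) (plant_in z))
      (Pi_op g \<Phi> (vcat n M (G (plant_in z)) (plant_in z))) \<le> - e * (nrm M z)\<^sup>2" .
  qed
qed

lemma R_bound:
  obtains cR where "cR > 0" "\<And>w. w \<in> L2 M \<Longrightarrow> R w \<in> L2 M" "\<And>w. w \<in> L2 M \<Longrightarrow> nrm M (R w) \<le> cR * nrm M w"
  using feedback_stable_sol_bound[OF nominal] by metis

text \<open>The inverse of \<open>D i\<close> is given on the extended space, so z_i is obtained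
  there. Then D z = R u has finite energy, T N z = P R u - u has it as well, and U_i N_i + V_i D_i =
  I returns finite energy to z_i.\<close>

lemma plant_in_onto:
  assumes u: "u \<in> L2 M" obtains z where "z \<in> L2 M" "u = plant_in z"
proof -
  have uL: "u \<in> L2e M" by (rule L2_imp_L2e[OF u])
  have Ru: "R u \<in> L2 M" using R_bound u by metis
  define zi where "zi i = inv_into (L2e (dg i)) (D i) (bm i (R u))" for i
  have zi: "zi i \<in> L2e (dg i)" "D i (zi i) = bm i (R u)" if i: "i \<in> V" for i
  proof -
    have "bm i (R u) \<in> D i ` L2e (dg i)" using factorization[OF i] by (auto simp: bij_betw_def)
    then show "zi i \<in> L2e (dg i)" "D i (zi i) = bm i (R u)"
      unfolding zi_def by (rule inv_into_into, rule f_inv_into_f)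
  qed
  define z where "z = stack V dg zi"
  have zL: "z \<in> L2e M" unfolding z_def using stack_L2e[OF finite_verts, of dg zi] by (simp add: handshake)
  have bz: "bm i z = zi i" if "i \<in> V" for i
    unfolding z_def start_def using blk_stack[OF finite_verts that, of zi dg] zi(1)[OF that] by simp
  have Dz: "Dop z = R u"
    by (rule M_ext_bm[OF M_dsum_L2e sol_L2e[OF wp_nominal uL]]) (simp add: bm_Dop bz zi)
  have eq: "u = plant_in z"
    using sol_eq[OF wp_nominal uL] by (simp add: plant_in_def Dz TH_op_def flip: H_Dop)
  have "bm i z \<in> L2 (dg i)" if i: "i \<in> V" for i
  proof -
    have "t = p - x" if "x = p - t" for p t x :: vsignal using that by simp
    from this[OF eq[unfolded plant_in_def Dz]] have "T_op g (Nop z) = P_op g (R u) - u" .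
    also have "\<dots> \<in> L2 M" by (intro L2_diff bounded_L2_closed[OF bounded_L2_P_op Ru] u)
    finally have "ones_op (dg i) (N i (zi i)) \<in> L2 (dg i)"
      using blk_L2[of "T_op g (Nop z)" M "st i" "dg i"] by (simp add: bm_T_op i cm_Nop bz)
    \<comment> \<open>The first copy of \<open>N i (zi i)\<close> suffices; it exists because the
      degree is positive.\<close>
    then have "finite_energy (ones_op (dg i) (N i (zi i)) 1)" by (rule finite_energy_L2)
    then have "finite_energy (N i (zi i) 1)" using deg_pos[OF i] by (simp add: ones_op_def mat_op_def)
    then have Nz: "N i (zi i) \<in> L2 1" using N_closed[OF i zi(1)[OF i]] by (simp add: L2_def)
    have DzL: "D i (zi i) \<in> L2 (dg i)" unfolding zi(2)[OF i] by (rule blk_L2[OF Ru])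
    have "UB i (N i (zi i)) \<in> L2 (dg i)" "VB i (D i (zi i)) \<in> L2 (dg i)"
      using UB[OF i] VB[OF i] Nz DzL by (auto simp: stable_system_def)
    then have "UB i (N i (zi i)) + VB i (D i (zi i)) \<in> L2 (dg i)" by (rule L2_add)
    then show ?thesis by (simp add: Bezout[OF i zi(1)[OF i]] bz i)
  qed
  then have "z \<in> L2 M" using L2I_blocks[OF finite_verts, of z dg] zL by (simp add: handshake start_def)
  with eq that show thesis by blast
qed

lemma G_strictly_dissipative:
  "\<exists>e>0. \<forall>u\<in>L2 M. ip (n + M) (vcat n M (G u) u) (Pi_op g \<Phi> (vcat n M (G u) u)) \<le> - e * (nrm M u)\<^sup>2"
proof -
  obtain e where e: "e > 0" "\<And>z. z \<in> L2 M \<Longrightarrow> ip (n + M) (vcat n M (G (plant_in z)) (plant_in z))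
     (Pi_op g \<Phi> (vcat n M (G (plant_in z)) (plant_in z))) \<le> - e * (nrm M z)\<^sup>2"
    using plant_dissipative by blast
  obtain k where k: "0 \<le> k" "\<And>z. z \<in> L2 M \<Longrightarrow> nrm M (plant_in z) \<le> k * nrm M z"
    using bounded_L2_bound[OF plant_in_bounded] by metis
  \<comment> \<open>Using k + 1 keeps the divisor positive even if k = 0.\<close>
  define k' where "k' = (k + 1)\<^sup>2"
  have k': "k' > 0" using k(1) by (simp add: k'_def)
  show ?thesis
  proof (intro exI[of _ "e / k'"] conjI ballI)
    show "0 < e / k'" using e(1) k' by simp
    fix u assume "u \<in> L2 M"
    then obtain z where z: "z \<in> L2 M" "u = plant_in z" by (rule plant_in_onto)
    have "nrm M u \<le> (k + 1) * nrm M z" using k(2)[OF z(1)] by (simp add: z(2) distrib_right add.commute add_increasing)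
    then have "(nrm M u)\<^sup>2 \<le> k' * (nrm M z)\<^sup>2" unfolding k'_def power_mult_distrib[symmetric] by (intro power_mono) auto
    then have "e * ((nrm M u)\<^sup>2 / k') \<le> e * (nrm M z)\<^sup>2"
      using e(1) k' by (intro mult_left_mono) (auto simp: field_simps)
    then show "ip (n + M) (vcat n M (G u) u) (Pi_op g \<Phi> (vcat n M (G u) u)) \<le> - (e / k') * (nrm M u)\<^sup>2"
      using e(2)[OF z(1)] by (simp add: z(2))
  qed
qed

theorem uncertain_network_stable: "feedback_stable M M (P_op g) (link_op g \<Lambda> \<circ> TH)"
proof -
  obtain e where e: "e > 0"
    "\<And>u. u \<in> L2 M \<Longrightarrow> ip (n + M) (vcat n M (G u) u) (Pi_op g \<Phi> (vcat n M (G u) u)) \<le> - e * (nrm M u)\<^sup>2"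
    using G_strictly_dissipative by blast
  have "\<exists>C\<ge>0. \<forall>w\<in>L2 M. X 1 w \<in> L2 M \<and> nrm M (X 1 w) \<le> C * nrm M w"
    by (rule IQC_homotopy[OF G_stable Delta_stable Pi_bounded _ X_unique X_causal Delta_IQC e])
       (auto intro: X_L2e X_eq)
  then obtain C where C: "0 \<le> C" "\<And>w. w \<in> L2 M \<Longrightarrow> X 1 w \<in> L2 M" "\<And>w. w \<in> L2 M \<Longrightarrow> nrm M (X 1 w) \<le> C * nrm M w"
    by blast
  obtain cR where cR: "cR > 0" "\<And>w. w \<in> L2 M \<Longrightarrow> R w \<in> L2 M" "\<And>w. w \<in> L2 M \<Longrightarrow> nrm M (R w) \<le> cR * nrm M w"
    using R_bound by metis
  have "feedback_stable M M (P_op g) (loop 1)"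
  proof (rule feedback_stableI[where c = "cR * C"])
    show "well_posed M M (P_op g) (loop 1)" by (rule wp_loop) simp
    show "loop 1 0 = 0" by (simp add: loop_one TH_zero link_zero)
    show "0 \<le> cR * C" using cR(1) C(1) by simp
    fix w assume w: "w \<in> L2 M"
    \<comment> \<open>The loop signal y is R u, so its gain is that of the map from w to u times
      that of R.\<close>
    have s: "sol (loop 1) w = R (X 1 w)" using R_X[of 1 w] w by (simp add: L2_imp_L2e)
    have "nrm M (R (X 1 w)) \<le> cR * nrm M (X 1 w)" by (rule cR(3)[OF C(2)[OF w]])
    also have "\<dots> \<le> cR * (C * nrm M w)" using cR(1) C(3)[OF w] by (intro mult_left_mono) auto
    finally show "sol (loop 1) w \<in> L2 M \<and> nrm M (sol (loop 1) w) \<le> cR * C * nrm M w"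
      unfolding s using cR(2)[OF C(2)[OF w]] by (simp add: mult.assoc)
  qed
  then show ?thesis by (simp only: loop_one)
qed

end

theorem theorem4:
  fixes g :: graph
    and B :: "nat \<Rightarrow> nat \<Rightarrow> real"
    and H :: "nat \<Rightarrow> sysmap" and \<Lambda> :: "nat \<Rightarrow> nat \<Rightarrow> sysmap"
    and S S\<^sub>d :: "nat \<Rightarrow> sysmap" and dom\<^sub>d :: "nat \<Rightarrow> vsignal set"
    and N D U V \<Phi> :: "nat \<Rightarrow> sysmap"
    and c :: nat and F :: "nat \<Rightarrow> nat set set"
  defines "n \<equiv> nverts g" and "M \<equiv> 2 * size_m g"
  assumes graph: "network_graph g" "is_B_mat g B"
    and agents: "\<And>i. i \<in> verts g \<Longrightarrow> causal (deg g i) 1 (H i) \<and> linear_on (L2e (deg g i)) (H i)"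
    and links: "\<And>i k. i \<in> verts g \<Longrightarrow> k \<in> {1..deg g i} \<Longrightarrow> causal 1 1 (\<Lambda> i k)"
    and loop_well_posed: "\<And>\<alpha>. \<alpha> \<in> {0..1} \<Longrightarrow>
      well_posed M M (P_op g) ((\<lambda>w. w + \<alpha> *\<^sub>R (link_op g \<Lambda> w - w)) \<circ> TH_op g H)"
    and nominal: "feedback_stable M M (P_op g) (TH_op g H)"
    and S_lin: "\<And>i. i \<in> verts g \<Longrightarrow> S i \<in> L2e 1 \<rightarrow> L2e 1 \<and> linear_on (L2e 1) (S i)"
    and S_dag: "\<And>i. i \<in> verts g \<Longrightarrow>
      dom\<^sub>d i \<subseteq> L2e 1 \<and> subspace (dom\<^sub>d i) \<and> S\<^sub>d i \<in> dom\<^sub>d i \<rightarrow> L2e 1 \<and> linear_on (dom\<^sub>d i) (S\<^sub>d i)"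
    and range_in_dom: "\<And>u i. u \<in> L2e M \<Longrightarrow> i \<in> verts g \<Longrightarrow> blk (i - 1) 1 (H_PTH_inv g H u) \<in> dom\<^sub>d i"
    and Delta_stable: "stable_system n M (Delta_op g \<Lambda> S)"
    and G_stable: "stable_system M n (G_op g H S\<^sub>d)"
    and Delta_G: "\<And>u. u \<in> L2e M \<Longrightarrow>
      Delta_op g \<Lambda> S (G_op g H S\<^sub>d u) =
      ((\<lambda>w. link_op g \<Lambda> w - w) \<circ> (T_op g \<circ> H_PTH_inv g H)) u"
    and N: "\<And>i. i \<in> verts g \<Longrightarrow> stable_system (deg g i) 1 (N i) \<and> linear_on (L2e (deg g i)) (N i)"
    and D: "\<And>i. i \<in> verts g \<Longrightarrow> stable_system (deg g i) (deg g i) (D i) \<and> linear_on (L2e (deg g i)) (D i)"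
    and factorization: "\<And>i. i \<in> verts g \<Longrightarrow> bij_betw (D i) (L2e (deg g i)) (L2e (deg g i)) \<and>
      (\<forall>y\<in>L2e (deg g i). H i y = N i (inv_into (L2e (deg g i)) (D i) y))"
    and U: "\<And>i. i \<in> verts g \<Longrightarrow> stable_system 1 (deg g i) (U i) \<and> linear_on (L2e 1) (U i)"
    and V: "\<And>i. i \<in> verts g \<Longrightarrow> stable_system (deg g i) (deg g i) (V i) \<and> linear_on (L2e (deg g i)) (V i)"
    and Bezout: "\<And>i z. i \<in> verts g \<Longrightarrow> z \<in> L2e (deg g i) \<Longrightarrow> U i (N i z) + V i (D i z) = z"
    and multipliers: "\<And>i. i \<in> verts g \<Longrightarrow>
      bounded_linear_L2 (1 + deg g i) (1 + deg g i) (\<Phi> i) \<and> self_adjoint (1 + deg g i) (\<Phi> i)"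
    and IQC: "\<And>i y \<alpha>. i \<in> verts g \<Longrightarrow> y \<in> L2 1 \<Longrightarrow> \<alpha> \<in> {0..1} \<Longrightarrow>
      (let w = vcat 1 (deg g i) y (\<alpha> *\<^sub>R local_Delta g \<Lambda> S i y)
       in ip (1 + deg g i) w (\<Phi> i w) \<ge> 0)"
    and partition: "localized_edge_partition g c F"
    and cover: "\<And>k. k \<in> {1..size_m g} \<Longrightarrow> L_set g k \<subseteq> (\<Union>p\<in>O_set g c F k. K_set g F p) - {k}"
    and certificate: "\<And>p. p \<in> {1..c} \<Longrightarrow>
      \<exists>\<epsilon>>0. local_certificate g B c F D (Psi_op g S\<^sub>d N D \<Phi>) p \<epsilon>"
  shows "feedback_stable M M (P_op g) (link_op g \<Lambda> \<circ> TH_op g H)"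
proof -
  have pn: "partitioned_network g B c F"
    using graph partition cover by (simp add: partitioned_network_def network_def partitioned_network_axioms_def)
  then have M: "M = network.M g" by (simp add: M_def partitioned_network_def network.M_def[of g B])
  have "uncertain_network g B c F H \<Lambda> S S\<^sub>d dom\<^sub>d N D U V \<Phi>"
    by (rule uncertain_network.intro[OF pn uncertain_network_axioms.intro], unfold M[symmetric] n_def[symmetric])
      (fact agents loop_well_posed nominal S_lin S_dag range_in_dom Delta_stable G_stable Delta_G
        N D factorization U V Bezout multipliers IQC certificate)+
  from uncertain_network.uncertain_network_stable[OF this] show ?thesis by (simp only: M)
qed

end
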